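(* Let $\phi\in V_1\otimes\cdots\otimes V_k$ be a nonzero $k$-tensor, let $B=(B_1,\dots,B_k)$ be bases of $V_1,\dots,V_k$, and let $\Phi\subseteq B_1\times\cdots\times B_k$ be the support of $\phi$ with respect to $B$. Suppose $\phi$ is tight with respect to $\alpha=\alpha_1\times\cdots\times\alpha_k$. Then $$\mathrm{q}_{\mathrm M}(\phi)\ \ge\ \max_{P\in\mathscr{P}_\Phi}\Bigl(H(P)-(k-2)\max_{R\in\mathscr{R}_\Phi}\frac{\max_{Q\in\mathscr{Q}_{\Phi,(P_1,\dots,P_k),R}}H(Q)-H(P)}{r_\alpha(R)}\Bigr),$$ where - $\mathscr{P}_\Phi$ is the set of all probability distributions $P$ on $\Phi$, and $P_1,\dots,P_k$ are the marginal distributions of $P$ on the $k$ components; - $\mathscr{R}_\Phi$ is the set of all subsets $R\subseteq\Phi\times\Phi$ that are not contained in the diagonal $\Delta_\Phi=\{(x,x)\mid x\in\Phi\}$ and such that $R\subseteq\mathcal{R}_i=\{(x,y)\in\Phi\times\Phi\mid x_i=y_i\}$ for some $i\in\{1,\dots,k\}$; - $\mathscr{Q}_{\Phi,(P_1,\dots,P_k),R}$ is the set of all probability distributions $Q$ on $R$ whose marginals on the $2k$ components of $R$ satisfy $Q_i=Q_{k+i}=P_i$ for $i\in\{1,\dots,k\}$.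
   Context: All vector spaces are finite-dimensional over $\mathbb{C}$. The support of $\phi$ with respect to $B$ is the set of $(b_1,\dots,b_k)\in B_1\times\cdots\times B_k$ such that the coefficient of $b_1\otimes\cdots\otimes b_k$ in $\phi$ is nonzero. $\phi$ is tight with respect to $\alpha=\alpha_1\times\cdots\times\alpha_k$ if $\alpha_i:B_i\to\mathbb{Z}$ are injective maps with $\alpha_1(b_1)+\cdots+\alpha_k(b_k)=0$ for every $(b_1,\dots,b_k)\in\Phi$. For $x\in\Phi$, $\alpha(x)=(\alpha_1(x_1),\dots,\alpha_k(x_k))\in\mathbb{Z}^k$. For $R\subseteq\Phi\times\Phi$, $r_\alpha(R)$ is the rank over $\mathbb{Q}$ of the matrix with rows $\{\alpha(x)-\alpha(y)\mid(x,y)\in R\}$. $H(P)=-\sum_i p_i\log_2p_i$ is Shannon entropy. Conventions: a maximum over an empty set of distributions $Q$ is $-\infty$; if $\mathscr{R}_\Phi=\emptyset$, the term $(k-2)\max_{R\in\mathscr{R}_\Phi}(\cdots)$ is read as $0$. Products of $k$-tensors are regarded as $k$-tensors (legs grouped position by position), and powers carry the product bases. $\mathrm{T}=\sum_{i=1}^2b_i^{\otimes k}\in(\mathbb{C}^2)^{\otimes k}$ with the standard basis. For $k$-tensors with fixed bases, $\phi\unrhd_{\mathrm M}\psi$ (monomial degeneration) if, after regarding both as elements of a common larger tensor product space by zero-padding (extending the bases), $\psi$ lies in the Zariski closure of the orbit of $\phi$ under the group of $k$-tuples of invertible monomial matrices (a monomial matrix has at most one nonzero entry in each row and each column). The monomial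 subexponent, in the basis $B$, is $\mathrm{q}_{\mathrm M}(\phi)=\bigl(\lim_{n\to\infty}\frac1n\min\{m\in\mathbb{N}\mid\phi^{\otimes m}\unrhd_{\mathrm M}\mathrm{T}^{\otimes n}\}\bigr)^{-1}$, with $\min\emptyset=\infty$, $\infty^{-1}=0$. *)

theory Defs
  imports "HOL-Probability.Probability" "Jordan_Normal_Form.Matrix" "HOL-Library.Function_Algebras"
begin

text \<open>
  The factors \<open>V i\<close>, for \<open>i\<close> in a finite index type \<open>'k\<close> (so \<open>k = CARD('k)\<close>), are subspaces of one
  ambient complex vector space with scalar multiplication \<open>smul\<close>. The elementary tensor of a
  family \<open>v\<close> is realised as evaluation at families \<open>f\<close> of linear functionals; since functionals
  separate linearly independent vectors, the span of these evaluations is a model of the algebraic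
  tensor product.
\<close>

definition elementary_tensor ::
  "(complex \<Rightarrow> 'v \<Rightarrow> 'v) \<Rightarrow> ('k \<Rightarrow> 'v) \<Rightarrow> ('k::finite \<Rightarrow> 'v::ab_group_add \<Rightarrow> complex) \<Rightarrow> complex"
  where "elementary_tensor smul v =
    (\<lambda>f. if \<forall>i. Vector_Spaces.linear smul (*) (f i) then \<Prod>i\<in>UNIV. f i (v i) else 0)"

abbreviation (input) tensor_smul :: "complex \<Rightarrow> ('f \<Rightarrow> complex) \<Rightarrow> 'f \<Rightarrow> complex"
  where "tensor_smul c \<phi> \<equiv> (\<lambda>f. c * \<phi> f)"

definition tensor_product ::
  "(complex \<Rightarrow> 'v \<Rightarrow> 'v) \<Rightarrow> ('k \<Rightarrow> 'v set) \<Rightarrow> (('k::finite \<Rightarrow> 'v::ab_group_add \<Rightarrow> complex) \<Rightarrow> complex) set"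
  where "tensor_product smul V =
    module.span tensor_smul (elementary_tensor smul ` (\<Pi> i\<in>UNIV. V i))"

definition is_basis_of :: "(complex \<Rightarrow> 'v \<Rightarrow> 'v) \<Rightarrow> 'v::ab_group_add set \<Rightarrow> 'v set \<Rightarrow> bool"
  where "is_basis_of smul b U \<longleftrightarrow>
    finite b \<and> \<not> module.dependent smul b \<and> module.span smul b = U"

definition tensor_coeff ::
  "(complex \<Rightarrow> 'v \<Rightarrow> 'v) \<Rightarrow> ('k \<Rightarrow> 'v set) \<Rightarrow>
   (('k::finite \<Rightarrow> 'v::ab_group_add \<Rightarrow> complex) \<Rightarrow> complex) \<Rightarrow> ('k \<Rightarrow> 'v) \<Rightarrow> complex"
  where "tensor_coeff smul B \<phi> b =
    (if b \<in> (\<Pi> i\<in>UNIV. B i)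
     then module.representation tensor_smul (elementary_tensor smul ` (\<Pi> i\<in>UNIV. B i)) \<phi>
            (elementary_tensor smul b)
     else 0)"

text \<open>
  The elementary tensors of basis vectors are independent, so \<open>representation\<close> does not fall back to
  its default value here.
\<close>

lemma tensor_coeff_expansion:
  fixes smul :: "complex \<Rightarrow> 'v::ab_group_add \<Rightarrow> 'v" and B V :: "'k::finite \<Rightarrow> 'v set"
  assumes vs: "vector_space smul"
    and basis: "\<And>i. is_basis_of smul (B i) (V i)"
    and \<phi>: "\<phi> \<in> tensor_product smul V"
  shows "\<phi> = (\<lambda>f. \<Sum>b\<in>(\<Pi> i\<in>UNIV. B i). tensor_coeff smul B \<phi> b * elementary_tensor smul b f)"
proof -
  interpret vs: vector_space smul by (rule vs)
  interpret D: vector_space_pair smul "(*) :: complex \<Rightarrow> complex \<Rightarrow> complex"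
    by unfold_locales (auto simp: algebra_simps)
  interpret T: vector_space "tensor_smul :: complex \<Rightarrow> (('k \<Rightarrow> 'v \<Rightarrow> complex) \<Rightarrow> complex) \<Rightarrow> _"
    by unfold_locales (auto simp: algebra_simps fun_eq_iff)
  let ?E = "elementary_tensor smul :: ('k \<Rightarrow> 'v) \<Rightarrow> _"
  let ?X = "\<Pi> i\<in>UNIV. B i"
  have fin: "finite (B i)" and indep: "vs.independent (B i)" and span: "vs.span (B i) = V i" for i
    using basis[of i] by (auto simp: is_basis_of_def)
  have X_PiE: "?X = Pi\<^sub>E UNIV B" by (auto simp: PiE_def)
  have finX: "finite ?X" unfolding X_PiE by (rule finite_PiE) (auto simp: fin)
  have sum_fun: "(\<Sum>x\<in>A. g x) f = (\<Sum>x\<in>A. g x f)"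
    for A :: "'z set" and g :: "'z \<Rightarrow> ('k \<Rightarrow> 'v \<Rightarrow> complex) \<Rightarrow> complex" and f
    by (induction A rule: infinite_finite_induct) auto
  have "\<exists>f. \<forall>b'\<in>?X. ?E b' f = (if b' = b then 1 else 0)" for b
  proof -
    have "\<exists>h. Vector_Spaces.linear smul (*) h \<and> (\<forall>v\<in>B i. h v = (if v = b i then 1 else 0))" for i
      using D.linear_independent_extend[OF indep[of i], of "\<lambda>v. if v = b i then 1 else 0"] by blast
    then obtain h where h: "\<And>i. Vector_Spaces.linear smul (*) (h i)"
      "\<And>i v. v \<in> B i \<Longrightarrow> h i v = (if v = b i then 1 else 0)" by metis
    have "?E b' h = (if b' = b then 1 else 0)" if "b' \<in> ?X" for b'
    proof -
      have "?E b' h = (\<Prod>i\<in>UNIV. if b' i = b i then 1 else 0)"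
        using that by (auto simp: elementary_tensor_def h Pi_iff intro!: prod.cong)
      also have "\<dots> = (if b' = b then 1 else 0)"
        by (auto simp: fun_eq_iff prod_zero_iff)
      finally show ?thesis .
    qed
    then show ?thesis by blast
  qed
  then obtain d where d: "\<And>b b'. b' \<in> ?X \<Longrightarrow> ?E b' (d b) = (if b' = b then 1 else 0)" by metis
  have inj: "inj_on ?E ?X"
    by (rule inj_onI) (metis d zero_neq_one)
  have "u x = 0" if sum: "(\<Sum>x\<in>?E ` ?X. tensor_smul (u x) x) = 0" and "x \<in> ?E ` ?X" for u x
  proof -
    from that obtain b where b: "b \<in> ?X" "x = ?E b" by blast
    have "0 = (\<Sum>b'\<in>?X. u (?E b') * ?E b' (d b))"
      using arg_cong[OF sum, of "\<lambda>F. F (d b)"] by (simp add: sum.reindex[OF inj] sum_fun)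
    also have "\<dots> = (\<Sum>b'\<in>?X. if b' = b then u (?E b') else 0)"
      by (intro sum.cong) (auto simp: d)
    also have "\<dots> = u x" using finX b by simp
    finally show "u x = 0" by simp
  qed
  then have "T.independent (?E ` ?X)"
    using finX by (subst T.dependent_finite) blast+
  moreover have "\<phi> \<in> T.span (?E ` ?X)"
  proof -
    have "?E v \<in> T.span (?E ` ?X)" if v: "v \<in> (\<Pi> i\<in>UNIV. V i)" for v
    proof -
      let ?r = "\<lambda>i. vs.representation (B i) (v i)"
      have v_eq: "v i = (\<Sum>b\<in>B i. smul (?r i b) b)" for i
        using v by (intro vs.sum_representation_eq[symmetric] indep fin) (auto simp: span)
      have "?E v f = (\<Sum>b\<in>?X. (\<Prod>i\<in>UNIV. ?r i (b i)) * ?E b f)" for f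
      proof (cases "\<forall>i. Vector_Spaces.linear smul (*) (f i)")
        case True
        have "f i (v i) = (\<Sum>b\<in>B i. ?r i b * f i b)" for i
        proof -
          interpret fi: Vector_Spaces.linear smul "(*)" "f i" using True by blast
          show ?thesis by (subst v_eq) (simp add: fi.sum fi.scale)
        qed
        then have "?E v f = (\<Prod>i\<in>UNIV. \<Sum>b\<in>B i. ?r i b * f i b)"
          using True by (simp add: elementary_tensor_def)
        also have "\<dots> = (\<Sum>b\<in>?X. \<Prod>i\<in>UNIV. ?r i (b i) * f i (b i))"
          unfolding X_PiE by (rule prod_sum_PiE) (auto simp: fin)
        finally show ?thesis using True by (simp add: elementary_tensor_def prod.distrib)
      next
        case False
        then have "?E w f = 0" for w unfolding elementary_tensor_def by (rule if_not_P)
        then show ?thesis by simp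
      qed
      then have "?E v = (\<Sum>b\<in>?X. tensor_smul (\<Prod>i\<in>UNIV. ?r i (b i)) (?E b))"
        by (simp add: fun_eq_iff sum_fun)
      also have "\<dots> \<in> T.span (?E ` ?X)"
        by (intro T.span_sum T.span_scale T.span_base imageI)
      finally show ?thesis .
    qed
    then have "T.span (?E ` (\<Pi> i\<in>UNIV. V i)) \<subseteq> T.span (?E ` ?X)"
      by (intro T.span_minimal) (auto simp: T.subspace_span)
    then show ?thesis using \<phi> by (auto simp: tensor_product_def)
  qed
  ultimately have "\<phi> = (\<Sum>x\<in>?E ` ?X. tensor_smul (T.representation (?E ` ?X) \<phi> x) x)"
    using finX by (intro T.sum_representation_eq[symmetric]) auto
  also have "\<dots> = (\<lambda>f. \<Sum>b\<in>?X. tensor_coeff smul B \<phi> b * ?E b f)"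
    by (auto simp: fun_eq_iff sum.reindex[OF inj] sum_fun tensor_coeff_def intro!: sum.cong)
  finally show ?thesis .
qed

definition tensor_support ::
  "(complex \<Rightarrow> 'v \<Rightarrow> 'v) \<Rightarrow> ('k \<Rightarrow> 'v set) \<Rightarrow>
   (('k::finite \<Rightarrow> 'v::ab_group_add \<Rightarrow> complex) \<Rightarrow> complex) \<Rightarrow> ('k \<Rightarrow> 'v) set"
  where "tensor_support smul B \<phi> = {b \<in> (\<Pi> i\<in>UNIV. B i). tensor_coeff smul B \<phi> b \<noteq> 0}"

definition tight_wrt :: "('k::finite \<Rightarrow> 'b set) \<Rightarrow> ('k \<Rightarrow> 'b) set \<Rightarrow> ('k \<Rightarrow> 'b \<Rightarrow> int) \<Rightarrow> bool"
  where "tight_wrt B \<Phi> \<alpha> \<longleftrightarrow>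
    (\<forall>i. inj_on (\<alpha> i) (B i)) \<and> (\<forall>b\<in>\<Phi>. (\<Sum>i\<in>UNIV. \<alpha> i (b i)) = 0)"

text \<open>
  From here on a tensor with fixed bases is given by the family \<open>B\<close> of (finite) index sets of its
  bases and its coefficient array \<open>t\<close>, of which only the values on \<open>\<Pi> i\<in>UNIV. B i\<close> matter.
  The product basis of an \<open>m\<close>-th power is indexed by lists of length \<open>m\<close>.
\<close>

definition power_basis :: "nat \<Rightarrow> ('k \<Rightarrow> 'b set) \<Rightarrow> 'k \<Rightarrow> 'b list set"
  where "power_basis m B i = {xs. set xs \<subseteq> B i \<and> length xs = m}"

definition tensor_power :: "nat \<Rightarrow> (('k \<Rightarrow> 'b) \<Rightarrow> complex) \<Rightarrow> ('k \<Rightarrow> 'b list) \<Rightarrow> complex"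
  where "tensor_power m t x = (\<Prod>j<m. t (\<lambda>i. x i ! j))"

definition unit_basis :: "'k \<Rightarrow> nat set"
  where "unit_basis i = {1, 2}"

definition unit_tensor :: "('k \<Rightarrow> nat) \<Rightarrow> complex"
  where "unit_tensor x = (\<Sum>c\<in>{1, 2}. if x = (\<lambda>_. c) then 1 else 0)"

definition index_box :: "('k \<Rightarrow> nat) \<Rightarrow> ('k \<Rightarrow> nat) set"
  where "index_box N = (\<Pi> i\<in>UNIV. {..<N i})"

definition zero_pad ::
  "('k \<Rightarrow> 'b \<Rightarrow> nat) \<Rightarrow> ('k \<Rightarrow> 'b set) \<Rightarrow> (('k \<Rightarrow> 'b) \<Rightarrow> complex) \<Rightarrow> ('k \<Rightarrow> nat) \<Rightarrow> complex"
  where "zero_pad \<iota> B t z =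
    (if \<forall>i. z i \<in> \<iota> i ` B i then t (\<lambda>i. inv_into (B i) (\<iota> i) (z i)) else 0)"

definition monomial_mat :: "complex mat \<Rightarrow> bool"
  where "monomial_mat A \<longleftrightarrow>
    (\<forall>r<dim_row A. \<forall>c<dim_col A. \<forall>c'<dim_col A. A $$ (r, c) \<noteq> 0 \<and> A $$ (r, c') \<noteq> 0 \<longrightarrow> c = c') \<and>
    (\<forall>c<dim_col A. \<forall>r<dim_row A. \<forall>r'<dim_row A. A $$ (r, c) \<noteq> 0 \<and> A $$ (r', c) \<noteq> 0 \<longrightarrow> r = r')"

definition monomial_group :: "('k \<Rightarrow> nat) \<Rightarrow> ('k \<Rightarrow> complex mat) set"
  where "monomial_group N =
    {g. \<forall>i. g i \<in> carrier_mat (N i) (N i) \<and> invertible_mat (g i) \<and> monomial_mat (g i)}"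

definition mat_action ::
  "('k::finite \<Rightarrow> nat) \<Rightarrow> ('k \<Rightarrow> complex mat) \<Rightarrow> (('k \<Rightarrow> nat) \<Rightarrow> complex) \<Rightarrow> ('k \<Rightarrow> nat) \<Rightarrow> complex"
  where "mat_action N g t z =
    (if z \<in> index_box N then \<Sum>w\<in>index_box N. (\<Prod>i\<in>UNIV. g i $$ (z i, w i)) * t w else 0)"

inductive_set polynomial_functions :: "'x set \<Rightarrow> (('x \<Rightarrow> complex) \<Rightarrow> complex) set"
  for I :: "'x set" where
  "(\<lambda>p. c) \<in> polynomial_functions I"
| "z \<in> I \<Longrightarrow> (\<lambda>p. p z) \<in> polynomial_functions I"
| "f \<in> polynomial_functions I \<Longrightarrow> g \<in> polynomial_functions I \<Longrightarrow>
    (\<lambda>p. f p + g p) \<in> polynomial_functions I"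
| "f \<in> polynomial_functions I \<Longrightarrow> g \<in> polynomial_functions I \<Longrightarrow>
    (\<lambda>p. f p * g p) \<in> polynomial_functions I"

text \<open>The affine space with coordinates \<open>I\<close> consists of the functions vanishing outside \<open>I\<close>.\<close>

definition zariski_closure :: "'x set \<Rightarrow> ('x \<Rightarrow> complex) set \<Rightarrow> ('x \<Rightarrow> complex) set"
  where "zariski_closure I S =
    {p. (\<forall>z. z \<notin> I \<longrightarrow> p z = 0) \<and>
        (\<forall>f\<in>polynomial_functions I. (\<forall>s\<in>S. f s = 0) \<longrightarrow> f p = 0)}"

text \<open>
  Both tensors are zero-padded into the space with basis \<open>index_box N\<close>. As the group contains all
  permutations of the basis vectors, the choice of the embeddings \<open>\<iota>\<close> and \<open>\<kappa>\<close> is immaterial.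
\<close>

definition monomial_degeneration ::
  "('k::finite \<Rightarrow> 'b set) \<Rightarrow> (('k \<Rightarrow> 'b) \<Rightarrow> complex) \<Rightarrow>
   ('k \<Rightarrow> 'c set) \<Rightarrow> (('k \<Rightarrow> 'c) \<Rightarrow> complex) \<Rightarrow> bool"
  where "monomial_degeneration B t C s \<longleftrightarrow>
    (\<exists>N \<iota> \<kappa>.
      (\<forall>i. inj_on (\<iota> i) (B i) \<and> \<iota> i ` B i \<subseteq> {..<N i}) \<and>
      (\<forall>i. inj_on (\<kappa> i) (C i) \<and> \<kappa> i ` C i \<subseteq> {..<N i}) \<and>
      zero_pad \<kappa> C s \<in>
        zariski_closure (index_box N) ((\<lambda>g. mat_action N g (zero_pad \<iota> B t)) ` monomial_group N))"

text \<open>In \<^typ>\<open>ereal\<close> the infimum of the empty set is \<open>\<infinity>\<close> and \<open>inverse \<infinity> = 0\<close>.\<close>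

definition monomial_subexponent ::
  "('k::finite \<Rightarrow> 'b set) \<Rightarrow> (('k \<Rightarrow> 'b) \<Rightarrow> complex) \<Rightarrow> ereal"
  where "monomial_subexponent B t =
    inverse (lim (\<lambda>n.
      (INF m\<in>{m. monomial_degeneration (power_basis m B) (tensor_power m t)
                    (power_basis n unit_basis) (tensor_power n unit_tensor)}. ereal (real m))
      / ereal (real n)))"

definition shannon_entropy :: "'x pmf \<Rightarrow> real"
  where "shannon_entropy P = - (\<Sum>x\<in>set_pmf P. pmf P x * log 2 (pmf P x))"

definition distributions_on :: "'x set \<Rightarrow> 'x pmf set"
  where "distributions_on X = {P. set_pmf P \<subseteq> X}"

definition marginal :: "'k \<Rightarrow> ('k \<Rightarrow> 'b) pmf \<Rightarrow> 'b pmf"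
  where "marginal i P = map_pmf (\<lambda>x. x i) P"

definition coupling_relations :: "('k \<Rightarrow> 'b) set \<Rightarrow> (('k \<Rightarrow> 'b) \<times> ('k \<Rightarrow> 'b)) set set"
  where "coupling_relations \<Phi> =
    {R. R \<subseteq> \<Phi> \<times> \<Phi> \<and> \<not> R \<subseteq> Id_on \<Phi> \<and> (\<exists>i. R \<subseteq> {(x, y). x \<in> \<Phi> \<and> y \<in> \<Phi> \<and> x i = y i})}"

definition couplings ::
  "('k \<Rightarrow> 'b pmf) \<Rightarrow> (('k \<Rightarrow> 'b) \<times> ('k \<Rightarrow> 'b)) set \<Rightarrow> (('k \<Rightarrow> 'b) \<times> ('k \<Rightarrow> 'b)) pmf set"
  where "couplings p R =
    {Q \<in> distributions_on R. \<forall>i. marginal i (map_pmf fst Q) = p i \<and> marginal i (map_pmf snd Q) = p i}"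

text \<open>As for \<^const>\<open>rank\<close>, the rank is the dimension of the span of the set of rows.\<close>

definition relation_rank ::
  "('k::finite \<Rightarrow> 'b \<Rightarrow> int) \<Rightarrow> (('k \<Rightarrow> 'b) \<times> ('k \<Rightarrow> 'b)) set \<Rightarrow> nat"
  where "relation_rank \<alpha> R =
    vec.dim ((\<lambda>(x, y). (\<chi> i. rat_of_int (\<alpha> i (x i) - \<alpha> i (y i))) :: rat ^ 'k) ` R)"

text \<open>
  Maxima are rendered as suprema in \<^typ>\<open>ereal\<close>, because those over distributions range over infinite
  sets; the maximum over an empty set of distributions thus is \<open>- \<infinity>\<close>.
\<close>

definition penalty ::
  "('k::finite \<Rightarrow> 'b \<Rightarrow> int) \<Rightarrow> ('k \<Rightarrow> 'b) set \<Rightarrow> ('k \<Rightarrow> 'b) pmf \<Rightarrow> ereal"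
  where "penalty \<alpha> \<Phi> P =
    (if coupling_relations \<Phi> = {} then 0
     else (SUP R\<in>coupling_relations \<Phi>.
       ((SUP Q\<in>couplings (\<lambda>i. marginal i P) R. ereal (shannon_entropy Q)) - ereal (shannon_entropy P))
       / ereal (real (relation_rank \<alpha> R))))"

end

theory Submission
  imports Defs "HOL-Number_Theory.Cong"
begin

text \<open>
  Let \<open>f n\<close> be the least \<open>m\<close> such that the \<open>m\<close>-th power of the given tensor degenerates to the \<open>n\<close>-th
  power of the unit tensor. Degenerations can be multiplied and unit tensors can be restricted, so \<open>f\<close>
  is subadditive and monotone, and by Fekete's lemma the limit of \<open>f n / n\<close> exists and is an infimum.
  Hence every single degeneration of the \<open>m\<close>-th power to the \<open>n\<close>-th power of the unit tensor bounds
  the subexponent from below by \<open>n / m\<close> (\<open>inverse_lim_subadditive\<close>).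

  The support of the \<open>m\<close>-th power consists of the words of length \<open>m\<close> over \<open>\<Phi>\<close>; a word has one leg for
  each of the \<open>k\<close> tensor factors. Call a set \<open>X\<close> of words an isolated diagonal if its members pairwise
  share no leg and no further word over \<open>\<Phi>\<close> has all its legs among the legs of \<open>X\<close>. Scaling the basis
  vectors outside these legs to zero turns the power into a unit tensor of size \<open>card X\<close>
  (\<open>unit_degeneration_of_diagonal\<close>). What remains is to find isolated diagonals of exponential size,
  which is Strassen's hashing argument (\<open>exists_isolated_family\<close>, \<open>exists_diagonal\<close>).

  Among the words of length \<open>N\<close> keep the set \<open>\<Psi>\<close> of those whose legs have the letter frequencies
  prescribed by \<open>P\<close>; there are about \<open>2 powr (N * H(P))\<close> of them. Random vectors in \<open>F_p^e\<close> and the maps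
  \<open>\<alpha> i\<close> give each leg a hash value. Tightness makes the hash values of the \<open>k\<close> legs of a word satisfy
  one linear relation, so that, for a set \<open>S\<close> without nontrivial averages, all legs of a word are
  accepted only if they hash to the same element of \<open>S\<close>. A given word survives with probability
  \<open>card S * p^(-e (k-1))\<close>. Two distinct words that share a leg, and whose pairs of letters form the
  relation \<open>R\<close>, both survive with probability smaller by the factor \<open>p^(-e r(R))\<close>, because the random
  directions must be orthogonal to a system of rank \<open>r(R)\<close>. There are at most about
  \<open>2 powr (N * max H(Q))\<close> such pairs, the maximum being over the couplings \<open>Q\<close> on \<open>R\<close>. So if \<open>p^e\<close> is about
  \<open>2 powr (N * \<mu>)\<close>, where \<open>\<mu>\<close> slightly exceeds the penalty term, the expected number of surviving pairs
  is smaller than that of surviving words, and dropping every word that shares a leg with another one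
  leaves an isolated diagonal of size about
  \<open>2 powr (N * H(P)) * card S * p^(-e (k-1))\<close>, which is \<open>2 powr (N * (H(P) - (k-2) * \<mu>))\<close> as
  \<open>card S = p^(e (1 - o(1)))\<close>.

  The prime \<open>p\<close> is large but fixed, and only \<open>e\<close> grows with \<open>N\<close>. Then \<open>p^e\<close> follows any growth rate up to
  a bounded factor, \<open>S\<close> can be taken to be a sphere in a box of \<open>F_p^e\<close> whose sides are too short for
  sums to wrap around, and the finitely many ranks that occur are the same over the rationals and
  modulo \<open>p\<close>. For real \<open>P\<close> the frequencies are only approximated by those of \<open>N\<close>-element multisets, and
  compactness of the set of distributions on \<open>R\<close> controls the entropies of the joint types.
\<close>

section \<open>Orbits of the monomial group and their closures\<close>

text \<open>
  The action of the monomial matrices whose row \<open>r\<close> in leg \<open>i\<close> has the entry \<open>d i r\<close> in column \<open>\<sigma> i r\<close>.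
\<close>

definition monomial_transform ::
  "('k::finite \<Rightarrow> nat) \<Rightarrow> ('k \<Rightarrow> nat \<Rightarrow> nat) \<Rightarrow> ('k \<Rightarrow> nat \<Rightarrow> complex) \<Rightarrow>
   (('k \<Rightarrow> nat) \<Rightarrow> complex) \<Rightarrow> ('k \<Rightarrow> nat) \<Rightarrow> complex"
  where "monomial_transform N \<sigma> d t z =
    (if z \<in> index_box N then (\<Prod>i\<in>UNIV. d i (z i)) * t (\<lambda>i. \<sigma> i (z i)) else 0)"

definition monomial_orbit ::
  "('k::finite \<Rightarrow> nat) \<Rightarrow> (('k \<Rightarrow> nat) \<Rightarrow> complex) \<Rightarrow> (('k \<Rightarrow> nat) \<Rightarrow> complex) set"
  where "monomial_orbit N t = {monomial_transform N \<sigma> d t | \<sigma> d.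
    (\<forall>i. bij_betw (\<sigma> i) {..<N i} {..<N i}) \<and> (\<forall>i. \<forall>r<N i. d i r \<noteq> 0)}"

text \<open>
  Every row of an invertible matrix has a nonzero entry, and for a monomial matrix it is the only one
  in its row and in its column; so its column is an injective function of the row.
\<close>

lemma invertible_monomial_mat_entries:
  assumes A: "A \<in> carrier_mat n n" and inv: "invertible_mat A" and mono: "monomial_mat A"
  shows "\<exists>\<sigma> d. bij_betw \<sigma> {..<n} {..<n} \<and> (\<forall>r<n. d r \<noteq> 0) \<and>
    (\<forall>r<n. \<forall>c<n. A $$ (r, c) = (if c = \<sigma> r then d r else 0))"
proof -
  from inv obtain A' where A': "A * A' = 1\<^sub>m n" "A' * A = 1\<^sub>m (dim_row A')"
    using A by (auto simp: invertible_mat_def inverts_mat_def)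
  have dims: "dim_col A' = n" "dim_row A' = n"
    using arg_cong[OF A'(1), of dim_col] arg_cong[OF A'(2), of dim_col] A by auto
  have ex: "\<exists>c<n. A $$ (r, c) \<noteq> 0" if r: "r < n" for r
  proof (rule ccontr)
    assume "\<not> ?thesis"
    then have "row A r \<bullet> col A' r = 0"
      using A r dims by (auto simp: scalar_prod_def intro!: sum.neutral)
    moreover have "(A * A') $$ (r, r) = 1" using A'(1) r by simp
    ultimately show False using A r dims by simp
  qed
  then obtain \<sigma> where \<sigma>: "\<And>r. r < n \<Longrightarrow> \<sigma> r < n \<and> A $$ (r, \<sigma> r) \<noteq> 0" by metis
  have row: "c = \<sigma> r" if "r < n" "c < n" "A $$ (r, c) \<noteq> 0" for r c
    using mono A that \<sigma>[OF that(1)] unfolding monomial_mat_def by (metis carrier_matD)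
  have "inj_on \<sigma> {..<n}"
    using mono A \<sigma> unfolding monomial_mat_def inj_on_def by (metis carrier_matD lessThan_iff)
  moreover have "\<sigma> ` {..<n} \<subseteq> {..<n}" using \<sigma> by auto
  ultimately have "bij_betw \<sigma> {..<n} {..<n}"
    by (simp add: bij_betw_def endo_inj_surj)
  then show ?thesis
    using \<sigma> row by (intro exI[of _ \<sigma>] exI[of _ "\<lambda>r. A $$ (r, \<sigma> r)"]) auto
qed

lemma finite_index_box [simp]: "finite (index_box (N :: 'k::finite \<Rightarrow> nat))"
proof -
  have "index_box N = Pi\<^sub>E UNIV (\<lambda>i. {..<N i})" by (auto simp: index_box_def PiE_def)
  then show ?thesis by (simp add: finite_PiE)
qed

lemma mat_action_monomial:
  fixes N :: "'k::finite \<Rightarrow> nat"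
  assumes g: "\<And>i r c. r < N i \<Longrightarrow> c < N i \<Longrightarrow> g i $$ (r, c) = (if c = \<sigma> i r then d i r else 0)"
    and \<sigma>: "\<And>i r. r < N i \<Longrightarrow> \<sigma> i r < N i"
  shows "mat_action N g t = monomial_transform N \<sigma> d t"
proof
  fix z
  show "mat_action N g t z = monomial_transform N \<sigma> d t z"
  proof (cases "z \<in> index_box N")
    case True
    let ?w = "\<lambda>i. \<sigma> i (z i)"
    have z: "z i < N i" for i using True by (auto simp: index_box_def)
    have "(\<Prod>i\<in>UNIV. g i $$ (z i, w i)) * t w
        = (if w = ?w then (\<Prod>i\<in>UNIV. d i (z i)) * t ?w else 0)" if w: "w \<in> index_box N" for w
    proof (cases "w = ?w")
      case True
      then show ?thesis using z \<sigma> by (simp add: g)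
    next
      case False
      then obtain i where "w i \<noteq> \<sigma> i (z i)" by auto
      then have "g i $$ (z i, w i) = 0" using z w by (auto simp: g index_box_def Pi_iff)
      then show ?thesis using False by (auto intro: prod_zero)
    qed
    then have "mat_action N g t z
        = (\<Sum>w\<in>index_box N. if w = ?w then (\<Prod>i\<in>UNIV. d i (z i)) * t ?w else 0)"
      using True by (simp add: mat_action_def)
    also have "\<dots> = (\<Prod>i\<in>UNIV. d i (z i)) * t ?w"
    proof -
      have "?w \<in> index_box N" using z \<sigma> by (simp add: index_box_def)
      then show ?thesis by (subst sum.delta) auto
    qed
    finally show ?thesis using True by (simp add: monomial_transform_def)
  qed (simp add: mat_action_def monomial_transform_def)
qed

lemma monomial_mat_of_bij:
  fixes d :: "nat \<Rightarrow> complex"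
  assumes \<sigma>: "bij_betw \<sigma> {..<n} {..<n}" and d: "\<And>r. r < n \<Longrightarrow> d r \<noteq> 0"
  shows "invertible_mat (mat n n (\<lambda>(r, c). if c = \<sigma> r then d r else 0))" (is "invertible_mat ?A")
    and "monomial_mat (mat n n (\<lambda>(r, c). if c = \<sigma> r then d r else 0))"
proof -
  let ?B = "mat n n (\<lambda>(r, c). if r = \<sigma> c then 1 / d c else 0)"
  have inj: "\<sigma> r = \<sigma> r' \<longleftrightarrow> r = r'" if "r < n" "r' < n" for r r'
    using \<sigma> that by (auto simp: bij_betw_def inj_on_def)
  have lt: "\<sigma> r < n" if "r < n" for r using \<sigma> that by (auto simp: bij_betw_def)
  have AB: "?A * ?B = 1\<^sub>m n"
  proof (rule eq_matI)
    fix i j assume ij: "i < dim_row (1\<^sub>m n :: complex mat)" "j < dim_col (1\<^sub>m n :: complex mat)"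
    have "(?A * ?B) $$ (i, j) =
        (\<Sum>k\<in>{0..<n}. (if k = \<sigma> i then d i else 0) * (if k = \<sigma> j then 1 / d j else 0))"
      using ij by (auto simp: scalar_prod_def intro!: sum.cong)
    also have "\<dots> = (\<Sum>k\<in>{0..<n}. if k = \<sigma> i then (if i = j then 1 else 0) else 0)"
      using ij inj d by (intro sum.cong) auto
    also have "\<dots> = (1\<^sub>m n) $$ (i, j)" using ij lt by auto
    finally show "(?A * ?B) $$ (i, j) = (1\<^sub>m n) $$ (i, j)" .
  qed auto
  have BA: "?B * ?A = 1\<^sub>m n"
  proof (rule eq_matI)
    fix i j assume ij: "i < dim_row (1\<^sub>m n :: complex mat)" "j < dim_col (1\<^sub>m n :: complex mat)"
    then obtain k0 where k0: "k0 < n" "\<sigma> k0 = i"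
      using bij_betw_imp_surj_on[OF \<sigma>] by (metis imageE index_one_mat(2) lessThan_iff)
    have "(?B * ?A) $$ (i, j) =
        (\<Sum>k\<in>{0..<n}. (if i = \<sigma> k then 1 / d k else 0) * (if j = \<sigma> k then d k else 0))"
      using ij by (auto simp: scalar_prod_def intro!: sum.cong)
    also have "\<dots> = (\<Sum>k\<in>{0..<n}. if k = k0 then (if i = j then 1 else 0) else 0)"
      using ij inj d k0 by (intro sum.cong) auto
    also have "\<dots> = (1\<^sub>m n) $$ (i, j)" using ij k0 by auto
    finally show "(?B * ?A) $$ (i, j) = (1\<^sub>m n) $$ (i, j)" .
  qed auto
  show "invertible_mat ?A"
    using AB BA by (auto simp: invertible_mat_def inverts_mat_def intro!: exI[of _ ?B])
  show "monomial_mat ?A" using inj by (auto simp: monomial_mat_def split: if_splits)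
qed

text \<open>
  Replacing matrices by pairs of a permutation and a vector of scalars makes products, scalings and
  Kronecker products of group elements computations with functions.
\<close>

lemma monomial_orbit_eq:
  "(\<lambda>g. mat_action N g t) ` monomial_group N = monomial_orbit N t"
proof (intro equalityI subsetI)
  fix p assume "p \<in> (\<lambda>g. mat_action N g t) ` monomial_group N"
  then obtain g where g: "g \<in> monomial_group N" and p: "p = mat_action N g t" by auto
  have "\<exists>\<sigma> d. bij_betw \<sigma> {..<N i} {..<N i} \<and> (\<forall>r<N i. d r \<noteq> 0) \<and>
    (\<forall>r<N i. \<forall>c<N i. g i $$ (r, c) = (if c = \<sigma> r then d r else 0))" for i
    using g by (intro invertible_monomial_mat_entries) (auto simp: monomial_group_def)
  then obtain \<sigma> d where \<sigma>: "\<And>i. bij_betw (\<sigma> i) {..<N i} {..<N i}" and d: "\<And>i. \<forall>r<N i. d i r \<noteq> 0"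
    and e: "\<And>i. \<forall>r<N i. \<forall>c<N i. g i $$ (r, c) = (if c = \<sigma> i r then d i r else 0)" by metis
  have "p = monomial_transform N \<sigma> d t"
    unfolding p
  proof (rule mat_action_monomial)
    show "\<sigma> i r < N i" if "r < N i" for i r using bij_betwE[OF \<sigma>[of i]] that by simp
  qed (use e in blast)
  then show "p \<in> monomial_orbit N t" using \<sigma> d by (auto simp: monomial_orbit_def)
next
  fix p assume "p \<in> monomial_orbit N t"
  then obtain \<sigma> d where \<sigma>: "\<And>i. bij_betw (\<sigma> i) {..<N i} {..<N i}" and d: "\<And>i. \<forall>r<N i. d i r \<noteq> 0"
    and p: "p = monomial_transform N \<sigma> d t" by (auto simp: monomial_orbit_def)
  define g where "g i = mat (N i) (N i) (\<lambda>(r, c). if c = \<sigma> i r then d i r else 0)" for i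
  have "mat_action N g t = p"
    unfolding p
  proof (rule mat_action_monomial)
    show "\<sigma> i r < N i" if "r < N i" for i r using bij_betwE[OF \<sigma>[of i]] that by simp
  qed (simp add: g_def)
  moreover have "g \<in> monomial_group N"
    using monomial_mat_of_bij \<sigma> d by (auto simp: monomial_group_def g_def)
  ultimately show "p \<in> (\<lambda>g. mat_action N g t) ` monomial_group N" by blast
qed

lemma zariski_closure_superset:
  "(\<And>s z. s \<in> S \<Longrightarrow> z \<notin> I \<Longrightarrow> s z = 0) \<Longrightarrow> S \<subseteq> zariski_closure I S"
  by (auto simp: zariski_closure_def)

text \<open>
  Polynomial functions are continuous, so Zariski closures are closed under pointwise limits. Limits of
  diagonal scalings are how restrictions of a tensor to a box arise below.
\<close>

lemma zariski_closure_limit: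
  assumes s: "\<And>n::nat. s n \<in> zariski_closure I S" and lim: "\<And>z. (\<lambda>n. s n z) \<longlonglongrightarrow> p z"
  shows "p \<in> zariski_closure I S"
proof -
  have "p z = 0" if "z \<notin> I" for z
    using lim[of z] s that by (simp add: zariski_closure_def LIMSEQ_const_iff)
  moreover have "f p = 0" if f: "f \<in> polynomial_functions I" and "\<forall>s\<in>S. f s = 0" for f
  proof -
    from f have "(\<lambda>n. f (s n)) \<longlonglongrightarrow> f p"
      by induction (auto intro!: tendsto_intros lim)
    moreover have "f (s n) = 0" for n using s[of n] that by (auto simp: zariski_closure_def)
    ultimately show ?thesis by (simp add: LIMSEQ_const_iff)
  qed
  ultimately show ?thesis by (simp add: zariski_closure_def)
qed

text \<open>
  Composition with a map with polynomial coordinates preserves polynomial functions; in other words,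
  such maps are continuous in the Zariski topology.
\<close>

lemma zariski_closure_image:
  assumes poly: "\<And>z. z \<in> J \<Longrightarrow> (\<lambda>p. F p z) \<in> polynomial_functions I"
    and zero: "\<And>p z. z \<notin> J \<Longrightarrow> F p z = 0"
    and S: "\<And>s. s \<in> S \<Longrightarrow> F s \<in> zariski_closure J T"
    and p: "p \<in> zariski_closure I S"
  shows "F p \<in> zariski_closure J T"
proof -
  have "f (F p) = 0" if f: "f \<in> polynomial_functions J" and T: "\<forall>s\<in>T. f s = 0" for f
  proof -
    from f have "(\<lambda>p. f (F p)) \<in> polynomial_functions I"
      by induction (auto intro: polynomial_functions.intros poly)
    moreover have "\<forall>s\<in>S. f (F s) = 0"
      using S f T by (auto simp: zariski_closure_def)
    ultimately show ?thesis using p by (auto simp: zariski_closure_def)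
  qed
  then show ?thesis using zero by (auto simp: zariski_closure_def)
qed

lemma monomial_orbit_outside: "s \<in> monomial_orbit N t \<Longrightarrow> z \<notin> index_box N \<Longrightarrow> s z = 0"
  by (auto simp: monomial_orbit_def monomial_transform_def)

lemma monomial_orbit_subset_closure:
  "monomial_orbit N t \<subseteq> zariski_closure (index_box N) (monomial_orbit N t)"
  by (rule zariski_closure_superset) (rule monomial_orbit_outside)

lemma diagonal_closure:
  assumes q: "q \<in> zariski_closure (index_box N) (monomial_orbit N t)"
    and d: "\<And>i r. r < N i \<Longrightarrow> d i r \<noteq> 0"
  shows "monomial_transform N (\<lambda>_ r. r) d q \<in> zariski_closure (index_box N) (monomial_orbit N t)"
proof (rule zariski_closure_image[OF _ _ _ q])
  fix z assume z: "z \<in> index_box N"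
  have "(\<lambda>p. (\<Prod>i\<in>UNIV. d i (z i)) * p z) \<in> polynomial_functions (index_box N)"
    using z by (intro polynomial_functions.intros)
  then show "(\<lambda>p. monomial_transform N (\<lambda>_ r. r) d p z) \<in> polynomial_functions (index_box N)"
    using z by (simp add: monomial_transform_def)
next
  fix s assume "s \<in> monomial_orbit N t"
  then obtain \<sigma> d' where \<sigma>: "\<And>i. bij_betw (\<sigma> i) {..<N i} {..<N i}" and d': "\<And>i. \<forall>r<N i. d' i r \<noteq> 0"
    and s: "s = monomial_transform N \<sigma> d' t" by (auto simp: monomial_orbit_def)
  have "monomial_transform N (\<lambda>_ r. r) d s = monomial_transform N \<sigma> (\<lambda>i r. d i r * d' i r) t"
    by (auto simp: monomial_transform_def s prod.distrib fun_eq_iff)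
  then have "monomial_transform N (\<lambda>_ r. r) d s \<in> monomial_orbit N t"
    unfolding monomial_orbit_def using \<sigma> d d'
    by (intro CollectI exI[of _ \<sigma>] exI[of _ "\<lambda>i r. d i r * d' i r"]) auto
  then show "monomial_transform N (\<lambda>_ r. r) d s \<in> zariski_closure (index_box N) (monomial_orbit N t)"
    using monomial_orbit_subset_closure by blast
qed (simp add: monomial_transform_def)

text \<open>
  The limit for \<open>n\<close> to infinity of diagonal matrices with entries \<open>d i r\<close> on \<open>K i\<close> and \<open>1 / (n + 1)\<close>
  elsewhere.
\<close>

lemma scaled_restriction_closure:
  fixes N :: "'k::finite \<Rightarrow> nat"
  assumes q: "q \<in> zariski_closure (index_box N) (monomial_orbit N t)"
    and d: "\<And>i r. r \<in> K i \<Longrightarrow> d i r \<noteq> 0"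
  shows "(\<lambda>z. if z \<in> index_box N \<and> (\<forall>i. z i \<in> K i) then (\<Prod>i\<in>UNIV. d i (z i)) * q z else 0)
    \<in> zariski_closure (index_box N) (monomial_orbit N t)" (is "?r \<in> _")
proof -
  define D :: "nat \<Rightarrow> 'k \<Rightarrow> nat \<Rightarrow> complex" where
    "D n i r = (if r \<in> K i then d i r else inverse (of_nat (Suc n)))" for n i r
  have "(\<lambda>n. monomial_transform N (\<lambda>_ r. r) (D n) q z) \<longlonglongrightarrow> ?r z" for z
  proof (cases "z \<in> index_box N")
    case True
    have "(\<lambda>n. D n i (z i)) \<longlonglongrightarrow> (if z i \<in> K i then d i (z i) else 0)" for i
      using LIMSEQ_inverse_real_of_nat[THEN tendsto_of_real, where 'a = complex]
      by (auto simp: D_def)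
    then have lim: "(\<lambda>n. (\<Prod>i\<in>UNIV. D n i (z i)) * q z)
        \<longlonglongrightarrow> (\<Prod>i\<in>UNIV. if z i \<in> K i then d i (z i) else 0) * q z"
      by (intro tendsto_intros)
    have eq: "(\<Prod>i\<in>UNIV. if z i \<in> K i then d i (z i) else 0) * q z = ?r z"
    proof (cases "\<forall>i. z i \<in> K i")
      case False
      then have "(\<Prod>i\<in>UNIV. if z i \<in> K i then d i (z i) else 0) = 0" by (intro prod_zero) auto
      then show ?thesis using False by simp
    qed (use True in simp)
    from lim show ?thesis
      unfolding monomial_transform_def if_P[OF True] eq .
  qed (simp add: monomial_transform_def)
  moreover have "monomial_transform N (\<lambda>_ r. r) (D n) q
      \<in> zariski_closure (index_box N) (monomial_orbit N t)" for n
    using d by (intro diagonal_closure q) (auto simp: D_def simp del: of_nat_Suc)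
  ultimately show ?thesis by (rule zariski_closure_limit[rotated])
qed

text \<open>
  The basis vector \<open>(a, b)\<close> of the product of spaces of dimensions \<open>N i\<close> and \<open>M i\<close> is number \<open>a * M i + b\<close>.
\<close>

definition kronecker ::
  "('k \<Rightarrow> nat) \<Rightarrow> ('k \<Rightarrow> nat) \<Rightarrow> (('k \<Rightarrow> nat) \<Rightarrow> complex) \<Rightarrow> (('k \<Rightarrow> nat) \<Rightarrow> complex) \<Rightarrow>
   ('k \<Rightarrow> nat) \<Rightarrow> complex"
  where "kronecker N M p q z = (if z \<in> index_box (\<lambda>i. N i * M i)
    then p (\<lambda>i. z i div M i) * q (\<lambda>i. z i mod M i) else 0)"

lemma index_box_mult:
  assumes "z \<in> index_box (\<lambda>i. N i * M i)"
  shows "(\<lambda>i. z i div M i) \<in> index_box N" "(\<lambda>i. z i mod M i) \<in> index_box M"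
proof -
  have z: "z i < N i * M i" for i using assms by (auto simp: index_box_def)
  then have "0 < M i" for i using mult_0_right not_less_zero by (metis gr0I)
  then show "(\<lambda>i. z i div M i) \<in> index_box N" "(\<lambda>i. z i mod M i) \<in> index_box M"
    using z by (auto simp: index_box_def less_mult_imp_div_less)
qed

lemma pair_less: "a < N \<Longrightarrow> b < M \<Longrightarrow> a * M + b < N * (M::nat)"
  using mult_le_mono1[of "Suc a" N M] by simp

lemma kronecker_orbit:
  fixes N M :: "'k::finite \<Rightarrow> nat"
  assumes p: "p \<in> monomial_orbit N t" and q: "q \<in> monomial_orbit M s"
  shows "kronecker N M p q \<in> monomial_orbit (\<lambda>i. N i * M i) (kronecker N M t s)"
proof -
  from p obtain \<sigma> d where \<sigma>: "\<And>i. bij_betw (\<sigma> i) {..<N i} {..<N i}" and d: "\<And>i. \<forall>r<N i. d i r \<noteq> 0"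
    and p: "p = monomial_transform N \<sigma> d t" by (auto simp: monomial_orbit_def)
  from q obtain \<tau> e where \<tau>: "\<And>i. bij_betw (\<tau> i) {..<M i} {..<M i}" and e: "\<And>i. \<forall>r<M i. e i r \<noteq> 0"
    and q: "q = monomial_transform M \<tau> e s" by (auto simp: monomial_orbit_def)
  let ?\<rho> = "\<lambda>i r. \<sigma> i (r div M i) * M i + \<tau> i (r mod M i)"
  let ?f = "\<lambda>i r. d i (r div M i) * e i (r mod M i)"
  have M: "0 < M i" if "r < N i * M i" for i r using that by (cases "M i") auto
  have \<sigma>_lt: "\<sigma> i r < N i" if "r < N i" for i r using \<sigma>[of i] that by (auto simp: bij_betw_def)
  have \<tau>_lt: "\<tau> i r < M i" if "r < M i" for i r using \<tau>[of i] that by (auto simp: bij_betw_def)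
  have dm: "?\<rho> i r div M i = \<sigma> i (r div M i)" "?\<rho> i r mod M i = \<tau> i (r mod M i)"
    if "r < N i * M i" for i r
    using M[OF that] \<tau>_lt[of "r mod M i" i] by auto
  have bij: "bij_betw (?\<rho> i) {..<N i * M i} {..<N i * M i}" for i
  proof -
    have "inj_on (?\<rho> i) {..<N i * M i}"
    proof (rule inj_onI)
      fix r r' assume r: "r \<in> {..<N i * M i}" and r': "r' \<in> {..<N i * M i}" and eq: "?\<rho> i r = ?\<rho> i r'"
      from r r' have lt: "r < N i * M i" "r' < N i * M i" by auto
      have "\<sigma> i (r div M i) = \<sigma> i (r' div M i)" "\<tau> i (r mod M i) = \<tau> i (r' mod M i)"
        using dm[OF lt(1)] dm[OF lt(2)] eq by simp_all
      then have "r div M i = r' div M i" "r mod M i = r' mod M i"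
        using \<sigma>[of i] \<tau>[of i] lt M[OF lt(1)]
        by (auto simp: bij_betw_def inj_on_def less_mult_imp_div_less)
      then show "r = r'" by (metis div_mult_mod_eq)
    qed
    moreover have "?\<rho> i ` {..<N i * M i} \<subseteq> {..<N i * M i}"
      using M \<sigma>_lt \<tau>_lt by (auto intro!: pair_less simp: less_mult_imp_div_less)
    ultimately show ?thesis by (simp add: bij_betw_def endo_inj_surj)
  qed
  have "kronecker N M p q z = monomial_transform (\<lambda>i. N i * M i) ?\<rho> ?f (kronecker N M t s) z" for z
  proof (cases "z \<in> index_box (\<lambda>i. N i * M i)")
    case True
    then have z: "z i < N i * M i" for i by (auto simp: index_box_def)
    have "?\<rho> i (z i) < N i * M i" for i using bij[of i] z by (auto simp: bij_betw_def)
    then have "(\<lambda>i. ?\<rho> i (z i)) \<in> index_box (\<lambda>i. N i * M i)" by (simp add: index_box_def)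
    then show ?thesis
      using True index_box_mult[OF True] dm[OF z]
      by (simp add: kronecker_def monomial_transform_def p q prod.distrib)
  qed (simp add: kronecker_def monomial_transform_def)
  moreover have "?f i r \<noteq> 0" if "r < N i * M i" for i r
    using d e M[OF that] that by (simp add: less_mult_imp_div_less)
  ultimately show ?thesis
    unfolding monomial_orbit_def using bij by (intro CollectI exI[of _ ?\<rho>] exI[of _ ?f]) auto
qed

text \<open>
  The product is polynomial in each factor separately. So first the right factor may pass from the
  orbit to its closure while the left one stays in the orbit, and then the left one follows.
\<close>

lemma kronecker_closure:
  fixes N M :: "'k::finite \<Rightarrow> nat"
  assumes p: "p \<in> zariski_closure (index_box N) (monomial_orbit N t)"
    and q: "q \<in> zariski_closure (index_box M) (monomial_orbit M s)"
  shows "kronecker N M p q \<in> zariski_closure (index_box (\<lambda>i. N i * M i))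
    (monomial_orbit (\<lambda>i. N i * M i) (kronecker N M t s))" (is "_ \<in> ?C")
proof -
  have 1: "kronecker N M p' q \<in> ?C" if p': "p' \<in> monomial_orbit N t" for p'
  proof (rule zariski_closure_image[OF _ _ _ q])
    fix z assume z: "z \<in> index_box (\<lambda>i. N i * M i)"
    have "(\<lambda>q. p' (\<lambda>i. z i div M i) * q (\<lambda>i. z i mod M i)) \<in> polynomial_functions (index_box M)"
      using index_box_mult[OF z] by (intro polynomial_functions.intros)
    then show "(\<lambda>q. kronecker N M p' q z) \<in> polynomial_functions (index_box M)"
      using z by (simp add: kronecker_def)
  next
    fix q' assume "q' \<in> monomial_orbit M s"
    then show "kronecker N M p' q' \<in> ?C"
      using kronecker_orbit[OF p'] monomial_orbit_subset_closure by blast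
  qed (simp add: kronecker_def)
  show ?thesis
  proof (rule zariski_closure_image[OF _ _ _ p])
    fix z assume z: "z \<in> index_box (\<lambda>i. N i * M i)"
    have "(\<lambda>p. p (\<lambda>i. z i div M i) * q (\<lambda>i. z i mod M i)) \<in> polynomial_functions (index_box N)"
      using index_box_mult[OF z] by (intro polynomial_functions.intros)
    then show "(\<lambda>p. kronecker N M p q z) \<in> polynomial_functions (index_box N)"
      using z by (simp add: kronecker_def)
  qed (simp_all add: 1, simp add: kronecker_def)
qed

section \<open>Degenerations of tensor powers to powers of the unit tensor\<close>

lemma monomial_degeneration_iff:
  "monomial_degeneration B t C s \<longleftrightarrow>
    (\<exists>N \<iota> \<kappa>.
      (\<forall>i. inj_on (\<iota> i) (B i) \<and> \<iota> i ` B i \<subseteq> {..<N i}) \<and>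
      (\<forall>i. inj_on (\<kappa> i) (C i) \<and> \<kappa> i ` C i \<subseteq> {..<N i}) \<and>
      zero_pad \<kappa> C s \<in> zariski_closure (index_box N) (monomial_orbit N (zero_pad \<iota> B t)))"
  unfolding monomial_degeneration_def monomial_orbit_eq ..

lemma monomial_degenerationE:
  assumes "monomial_degeneration B t C s"
  obtains N \<iota> \<kappa> where "\<And>i. inj_on (\<iota> i) (B i)" "\<And>i. \<iota> i ` B i \<subseteq> {..<N i}"
    "\<And>i. inj_on (\<kappa> i) (C i)" "\<And>i. \<kappa> i ` C i \<subseteq> {..<N i}"
    "zero_pad \<kappa> C s \<in> zariski_closure (index_box N) (monomial_orbit N (zero_pad \<iota> B t))"
  using assms unfolding monomial_degeneration_iff
proof (elim exE conjE)
  fix N \<iota> \<kappa>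
  assume "\<forall>i. inj_on (\<iota> i) (B i) \<and> \<iota> i ` B i \<subseteq> {..<N i}"
    and "\<forall>i. inj_on (\<kappa> i) (C i) \<and> \<kappa> i ` C i \<subseteq> {..<N i}"
    and "zero_pad \<kappa> C s \<in> zariski_closure (index_box N) (monomial_orbit N (zero_pad \<iota> B t))"
  then show thesis by (intro that[of \<iota> N \<kappa>]) simp_all
qed

lemma zero_pad_image:
  assumes "\<And>i. inj_on (\<iota> i) (B i)" "\<And>i. b i \<in> B i"
  shows "zero_pad \<iota> B t (\<lambda>i. \<iota> i (b i)) = t b"
  using assms by (simp add: zero_pad_def)

lemma zero_pad_outside: "z i \<notin> \<iota> i ` B i \<Longrightarrow> zero_pad \<iota> B t z = 0"
  by (auto simp: zero_pad_def)

lemma power_basis_append: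
  assumes "xs \<in> power_basis (m + m') B i"
  shows "take m xs \<in> power_basis m B i" "drop m xs \<in> power_basis m' B i"
  using assms set_take_subset[of m xs] set_drop_subset[of m xs] by (auto simp: power_basis_def)

lemma tensor_power_add:
  assumes "\<And>i. length (x i) = m + m'"
  shows "tensor_power (m + m') t x
    = tensor_power m t (\<lambda>i. take m (x i)) * tensor_power m' t (\<lambda>i. drop m (x i))"
proof -
  have split: "(\<Prod>j<m + m'. f j) = (\<Prod>j<m. f j) * (\<Prod>j<m'. f (m + j))" for f :: "nat \<Rightarrow> complex"
    by (induction m') (simp_all add: mult.assoc)
  show ?thesis unfolding tensor_power_def split using assms by simp
qed

text \<open>
  A word of length \<open>m + m'\<close> is a pair of words of lengths \<open>m\<close> and \<open>m'\<close>, so that with compatible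
  numberings of the basis the padded power is the Kronecker product of the padded powers.
\<close>

lemma zero_pad_kronecker:
  assumes \<iota>: "\<And>i. inj_on (\<iota> i) (power_basis m B i)" "\<And>i. \<iota> i ` power_basis m B i \<subseteq> {..<N i}"
    and \<iota>': "\<And>i. inj_on (\<iota>' i) (power_basis m' B i)" "\<And>i. \<iota>' i ` power_basis m' B i \<subseteq> {..<M i}"
  defines "\<rho> \<equiv> \<lambda>i xs. \<iota> i (take m xs) * M i + \<iota>' i (drop m xs)"
  shows "inj_on (\<rho> i) (power_basis (m + m') B i)"
    and "\<rho> i ` power_basis (m + m') B i \<subseteq> {..<N i * M i}"
    and "zero_pad \<rho> (power_basis (m + m') B) (tensor_power (m + m') t)
      = kronecker N M (zero_pad \<iota> (power_basis m B) (tensor_power m t))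
          (zero_pad \<iota>' (power_basis m' B) (tensor_power m' t))"
proof -
  have lt: "\<iota> i (take m xs) < N i" "\<iota>' i (drop m xs) < M i"
    if "xs \<in> power_basis (m + m') B i" for i xs
    using power_basis_append[OF that] \<iota>(2)[of i] \<iota>'(2)[of i] by auto
  have dm: "\<rho> i xs div M i = \<iota> i (take m xs)" "\<rho> i xs mod M i = \<iota>' i (drop m xs)"
    if "xs \<in> power_basis (m + m') B i" for i xs
    using lt[OF that] by (auto simp: \<rho>_def)
  have inj: "inj_on (\<rho> i) (power_basis (m + m') B i)" for i
  proof (rule inj_onI)
    fix xs ys assume xs: "xs \<in> power_basis (m + m') B i" and ys: "ys \<in> power_basis (m + m') B i"
      and eq: "\<rho> i xs = \<rho> i ys"
    from eq have "\<iota> i (take m xs) = \<iota> i (take m ys)" "\<iota>' i (drop m xs) = \<iota>' i (drop m ys)"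
      using dm[OF xs] dm[OF ys] by simp_all
    then have "take m xs = take m ys" "drop m xs = drop m ys"
      using inj_onD[OF \<iota>(1)[of i]] inj_onD[OF \<iota>'(1)[of i]] power_basis_append[OF xs]
        power_basis_append[OF ys] by blast+
    then show "xs = ys" by (metis append_take_drop_id)
  qed
  have range: "\<rho> i ` power_basis (m + m') B i \<subseteq> {..<N i * M i}" for i
    using lt by (auto simp: \<rho>_def intro!: pair_less)
  show "inj_on (\<rho> i) (power_basis (m + m') B i)" by (rule inj)
  show "\<rho> i ` power_basis (m + m') B i \<subseteq> {..<N i * M i}" by (rule range)
  show "zero_pad \<rho> (power_basis (m + m') B) (tensor_power (m + m') t)
      = kronecker N M (zero_pad \<iota> (power_basis m B) (tensor_power m t))
          (zero_pad \<iota>' (power_basis m' B) (tensor_power m' t))" (is "?l = ?r")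
  proof
    fix z
    show "?l z = ?r z"
    proof (cases "\<forall>i. z i \<in> \<rho> i ` power_basis (m + m') B i")
      case True
      then have "\<forall>i. \<exists>x. x \<in> power_basis (m + m') B i \<and> z i = \<rho> i x" by blast
      then obtain x where x: "\<And>i. x i \<in> power_basis (m + m') B i" "\<And>i. z i = \<rho> i (x i)" by metis
      have z: "z = (\<lambda>i. \<rho> i (x i))" using x by auto
      have "z i < N i * M i" for i using range[of i] x by auto
      then have box: "z \<in> index_box (\<lambda>i. N i * M i)" by (simp add: index_box_def)
      have "?l z = tensor_power (m + m') t x" unfolding z by (rule zero_pad_image) (auto simp: inj x)
      also have "\<dots> = tensor_power m t (\<lambda>i. take m (x i)) * tensor_power m' t (\<lambda>i. drop m (x i))"
        using x by (intro tensor_power_add) (auto simp: power_basis_def)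
      also have "\<dots> = zero_pad \<iota> (power_basis m B) (tensor_power m t) (\<lambda>i. \<iota> i (take m (x i)))
          * zero_pad \<iota>' (power_basis m' B) (tensor_power m' t) (\<lambda>i. \<iota>' i (drop m (x i)))"
        using zero_pad_image[where \<iota> = \<iota> and b = "\<lambda>i. take m (x i)", OF \<iota>(1) power_basis_append(1)[OF x(1)]]
          zero_pad_image[where \<iota> = \<iota>' and b = "\<lambda>i. drop m (x i)", OF \<iota>'(1) power_basis_append(2)[OF x(1)]]
        by simp
      also have "\<dots> = ?r z" using box x by (simp add: kronecker_def dm)
      finally show ?thesis .
    next
      case False
      then obtain i where i: "z i \<notin> \<rho> i ` power_basis (m + m') B i" by blast
      have "z i div M i \<notin> \<iota> i ` power_basis m B i \<or> z i mod M i \<notin> \<iota>' i ` power_basis m' B i"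
      proof (rule ccontr)
        assume "\<not> ?thesis"
        then obtain a b where ab: "a \<in> power_basis m B i" "b \<in> power_basis m' B i"
          "z i div M i = \<iota> i a" "z i mod M i = \<iota>' i b" by auto
        then have "z i = \<rho> i (a @ b)"
          using div_mult_mod_eq[of "z i" "M i"] by (simp add: \<rho>_def power_basis_def)
        moreover have "a @ b \<in> power_basis (m + m') B i" using ab by (auto simp: power_basis_def)
        ultimately show False using i by blast
      qed
      then have "?r z = 0" by (auto simp: kronecker_def zero_pad_outside)
      moreover have "?l z = 0" using i by (rule zero_pad_outside)
      ultimately show ?thesis by simp
    qed
  qed
qed

lemma monomial_degeneration_power_add:
  assumes "monomial_degeneration (power_basis m B) (tensor_power m t) (power_basis n C) (tensor_power n s)"
    and "monomial_degeneration (power_basis m' B) (tensor_power m' t) (power_basis n' C) (tensor_power n' s)"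
  shows "monomial_degeneration (power_basis (m + m') B) (tensor_power (m + m') t)
    (power_basis (n + n') C) (tensor_power (n + n') s)"
proof -
  from assms(1) obtain N \<iota> \<kappa> where
    1: "\<And>i. inj_on (\<iota> i) (power_basis m B i)" "\<And>i. \<iota> i ` power_basis m B i \<subseteq> {..<N i}"
      "\<And>i. inj_on (\<kappa> i) (power_basis n C i)" "\<And>i. \<kappa> i ` power_basis n C i \<subseteq> {..<N i}"
      "zero_pad \<kappa> (power_basis n C) (tensor_power n s) \<in> zariski_closure (index_box N)
        (monomial_orbit N (zero_pad \<iota> (power_basis m B) (tensor_power m t)))"
    by (rule monomial_degenerationE) (rule that; simp only:)
  from assms(2) obtain M \<iota>' \<kappa>' where
    2: "\<And>i. inj_on (\<iota>' i) (power_basis m' B i)" "\<And>i. \<iota>' i ` power_basis m' B i \<subseteq> {..<M i}"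
      "\<And>i. inj_on (\<kappa>' i) (power_basis n' C i)" "\<And>i. \<kappa>' i ` power_basis n' C i \<subseteq> {..<M i}"
      "zero_pad \<kappa>' (power_basis n' C) (tensor_power n' s) \<in> zariski_closure (index_box M)
        (monomial_orbit M (zero_pad \<iota>' (power_basis m' B) (tensor_power m' t)))"
    by (rule monomial_degenerationE) (rule that; simp only:)
  note i = zero_pad_kronecker[where \<iota> = \<iota> and \<iota>' = \<iota>' and N = N and M = M, OF 1(1,2) 2(1,2)]
  note k = zero_pad_kronecker[where \<iota> = \<kappa> and \<iota>' = \<kappa>' and N = N and M = M, OF 1(3,4) 2(3,4)]
  show ?thesis
    unfolding monomial_degeneration_iff
    by (intro exI conjI allI, rule i(1), rule i(2), rule k(1), rule k(2),
        unfold i(3) k(3), rule kronecker_closure[OF 1(5) 2(5)])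
qed

lemma tensor_power_unit_tensor:
  fixes x :: "'k::finite \<Rightarrow> nat list"
  assumes x: "\<And>i. x i \<in> power_basis n unit_basis i"
  shows "tensor_power n unit_tensor x = (if \<forall>i j. x i = x j then 1 else 0)"
proof (cases "\<forall>i j. x i = x j")
  case True
  define w where "w = x undefined"
  have w: "x = (\<lambda>_. w)" using True by (auto simp: w_def fun_eq_iff)
  have "unit_tensor ((\<lambda>_. w ! j) :: 'k \<Rightarrow> nat) = 1" if "j < n" for j
  proof -
    have "w ! j \<in> {1, 2}" using x that unfolding w power_basis_def unit_basis_def
      using nth_mem by blast
    then show ?thesis by (auto simp: unit_tensor_def fun_eq_iff)
  qed
  then show ?thesis by (simp add: tensor_power_def w)
next
  case False
  then obtain i i' where "x i \<noteq> x i'" by auto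
  moreover have "length (x i) = n" "length (x i') = n" using x by (auto simp: power_basis_def)
  ultimately obtain j where j: "j < n" "x i ! j \<noteq> x i' ! j" by (metis nth_equalityI)
  have "(\<lambda>i. x i ! j) \<noteq> (\<lambda>_. c)" for c using j by (metis)
  then have "unit_tensor (\<lambda>i. x i ! j) = 0" by (simp add: unit_tensor_def)
  then have "tensor_power n unit_tensor x = 0" unfolding tensor_power_def using j by (intro prod_zero) auto
  then show ?thesis using False by auto
qed

text \<open>
  Padding the words of length \<open>n'\<close> by a constant suffix identifies the shorter power with the
  restriction of the longer one to a box. That the least \<open>m\<close> is monotone in \<open>n\<close> is what makes it either
  finite for all \<open>n\<close> or infinite for all positive \<open>n\<close>, so that its growth rate has a limit.
\<close>

lemma unit_degeneration_antimono:
  assumes "monomial_degeneration B t (power_basis n (unit_basis :: 'k::finite \<Rightarrow> _)) (tensor_power n unit_tensor)"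
    and le: "n' \<le> n"
  shows "monomial_degeneration B t (power_basis n' unit_basis) (tensor_power n' unit_tensor)"
proof -
  from assms(1) obtain N \<iota> \<kappa> where
    0: "\<And>i. inj_on (\<iota> i) (B i)" "\<And>i. \<iota> i ` B i \<subseteq> {..<N i}" and
    1:
      "\<And>i. inj_on (\<kappa> i) (power_basis n unit_basis i)" "\<And>i. \<kappa> i ` power_basis n unit_basis i \<subseteq> {..<N i}"
      "zero_pad \<kappa> (power_basis n unit_basis) (tensor_power n unit_tensor) \<in> zariski_closure (index_box N)
        (monomial_orbit N (zero_pad \<iota> B t))" (is "?q \<in> ?C")
    by (rule monomial_degenerationE) (rule that; simp only:)
  define e where "e w = w @ replicate (n - n') (1::nat)" for w
  define \<kappa>' where "\<kappa>' i w = \<kappa> i (e w)" for i w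
  have e: "e w \<in> power_basis n unit_basis i" if "w \<in> power_basis n' unit_basis i" for i :: 'k and w
    using that le by (auto simp: power_basis_def unit_basis_def e_def)
  have e_eq: "e w = e w' \<longleftrightarrow> w = w'" for w w' by (simp add: e_def)
  have inj: "inj_on (\<kappa>' i) (power_basis n' unit_basis i)" for i
  proof (rule inj_onI)
    fix w w' assume "w \<in> power_basis n' unit_basis i" "w' \<in> power_basis n' unit_basis i" "\<kappa>' i w = \<kappa>' i w'"
    then have "e w = e w'" using inj_onD[OF 1(1)] e unfolding \<kappa>'_def by blast
    then show "w = w'" by (simp add: e_eq)
  qed
  let ?K = "\<lambda>i. \<kappa>' i ` power_basis n' unit_basis i"
  have range: "?K i \<subseteq> {..<N i}" for i
    using 1(2)[of i] e by (auto simp: \<kappa>'_def)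
  have "zero_pad \<kappa>' (power_basis n' unit_basis) (tensor_power n' unit_tensor)
      = (\<lambda>z. if z \<in> index_box N \<and> (\<forall>i. z i \<in> ?K i) then (\<Prod>i\<in>(UNIV :: 'k set). 1) * ?q z else 0)"
  proof
    fix z
    show "zero_pad \<kappa>' (power_basis n' unit_basis) (tensor_power n' unit_tensor) z
      = (if z \<in> index_box N \<and> (\<forall>i. z i \<in> ?K i) then (\<Prod>i\<in>(UNIV :: 'k set). 1) * ?q z else 0)" (is "?l = ?r")
    proof (cases "\<forall>i. z i \<in> ?K i")
      case True
      then have "\<forall>i. \<exists>x. x \<in> power_basis n' unit_basis i \<and> z i = \<kappa>' i x" by blast
      then obtain x where x: "\<And>i. x i \<in> power_basis n' unit_basis i" "\<And>i. z i = \<kappa>' i (x i)" by metis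
      have box: "z \<in> index_box N" using True range by (fastforce simp: index_box_def)
      have z: "z = (\<lambda>i. \<kappa>' i (x i))" using x by auto
      then have z': "z = (\<lambda>i. \<kappa> i (e (x i)))" by (simp add: \<kappa>'_def)
      have "?l = tensor_power n' unit_tensor x"
        unfolding z by (rule zero_pad_image) (auto simp: inj x)
      also have "\<dots> = tensor_power n unit_tensor (\<lambda>i. e (x i))"
        using x e by (simp add: tensor_power_unit_tensor e_eq)
      also have "\<dots> = ?q z"
        unfolding z' by (rule zero_pad_image[symmetric]) (auto simp: 1(1) x e)
      finally show ?thesis using True box by simp
    next
      case False
      then show ?thesis by (auto intro: zero_pad_outside)
    qed
  qed
  then have "zero_pad \<kappa>' (power_basis n' unit_basis) (tensor_power n' unit_tensor) \<in> ?C"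
    using scaled_restriction_closure[OF 1(3), of ?K "\<lambda>_ _. 1", OF one_neq_zero] by (simp only:)
  note closure = this
  show ?thesis
    unfolding monomial_degeneration_iff
    by (intro exI conjI allI, rule 0(1), rule 0(2), rule inj, rule range, rule closure)
qed

abbreviation leg :: "'k \<Rightarrow> ('k \<Rightarrow> 'b) list \<Rightarrow> 'b list"
  where "leg i ys \<equiv> map (\<lambda>y. y i) ys"

lemma tensor_power_legs:
  "length ys = m \<Longrightarrow> tensor_power m t (\<lambda>i. leg i ys) = (\<Prod>j<m. t (ys ! j))"
  by (simp add: tensor_power_def)

text \<open>
  The words of \<open>X\<close> are the only words over \<open>\<Phi>\<close> of length \<open>m\<close> in the box spanned by their legs, and in this
  box they form a diagonal.
\<close>

definition isolated_diagonal :: "('k \<Rightarrow> 'b) set \<Rightarrow> nat \<Rightarrow> ('k \<Rightarrow> 'b) list set \<Rightarrow> bool"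
  where "isolated_diagonal \<Phi> m X \<longleftrightarrow>
    (\<forall>ys\<in>X. length ys = m \<and> set ys \<subseteq> \<Phi>) \<and> (\<forall>i. inj_on (leg i) X) \<and>
    (\<forall>ys. length ys = m \<longrightarrow> set ys \<subseteq> \<Phi> \<longrightarrow> (\<forall>i. leg i ys \<in> leg i ` X) \<longrightarrow> ys \<in> X)"

text \<open>
  Restricted to the legs of \<open>X\<close>, the power of the tensor is diagonal. Rescaling the basis in a single leg
  makes the diagonal entries equal to one, and the words over \<open>{1, 2}\<close> can be embedded into \<open>X\<close>.
\<close>

lemma unit_degeneration_of_diagonal:
  fixes B :: "'k::finite \<Rightarrow> 'b set"
  assumes fin: "\<And>i. finite (B i)"
    and \<Phi>: "\<Phi> = {b \<in> (\<Pi> i\<in>UNIV. B i). t b \<noteq> 0}"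
    and diagonal: "isolated_diagonal \<Phi> m X"
    and card: "2 ^ n \<le> card X"
  shows "monomial_degeneration (power_basis m B) (tensor_power m t)
    (power_basis n unit_basis) (tensor_power n unit_tensor)"
proof -
  have X: "length ys = m \<and> set ys \<subseteq> \<Phi>" if "ys \<in> X" for ys
    using diagonal that by (simp add: isolated_diagonal_def)
  have inj: "inj_on (leg i) X" for i
    using diagonal by (simp add: isolated_diagonal_def)
  have closed: "ys \<in> X" if "length ys = m" "set ys \<subseteq> \<Phi>" "\<And>i. leg i ys \<in> leg i ` X" for ys
    using diagonal that unfolding isolated_diagonal_def by blast
  define W where "W = {w. set w \<subseteq> {1, 2::nat} \<and> length w = n}"
  have W: "power_basis n unit_basis i = W" for i :: 'k
    by (simp add: power_basis_def unit_basis_def W_def)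
  have "0 < card X" using card by (rule less_le_trans[rotated]) simp
  then have "finite X" by (rule card_ge_0_finite)
  moreover have "card W = card {1, 2::nat} ^ n" "finite W"
    unfolding W_def by (rule card_lists_length_eq finite_lists_length_eq, simp)+
  moreover have "card {1, 2::nat} = 2" by simp
  ultimately obtain \<beta> where \<beta>: "\<beta> ` W \<subseteq> X" "inj_on \<beta> W"
    using card card_le_inj[of W X] by metis
  have "\<exists>h. bij_betw h (power_basis m B i) {0..<card (power_basis m B i)}" for i
    by (intro ex_bij_betw_finite_nat) (auto simp: power_basis_def fin intro: finite_lists_length_eq)
  then obtain \<iota> where \<iota>: "\<And>i. bij_betw (\<iota> i) (power_basis m B i) {0..<card (power_basis m B i)}" by metis
  define N where "N i = card (power_basis m B i)" for i
  have \<iota>_inj: "inj_on (\<iota> i) (power_basis m B i)" and \<iota>_range: "\<iota> i ` power_basis m B i \<subseteq> {..<N i}" for i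
    using \<iota>[of i] by (auto simp: bij_betw_def N_def)
  define \<kappa> where "\<kappa> i w = \<iota> i (leg i (\<beta> w))" for i w
  have leg_pb: "leg i ys \<in> power_basis m B i" if "ys \<in> X" for i ys
    using X[OF that] by (auto simp: power_basis_def \<Phi>)
  have \<kappa>_inj: "inj_on (\<kappa> i) W" for i
  proof (rule inj_onI)
    fix w w' assume w: "w \<in> W" "w' \<in> W" "\<kappa> i w = \<kappa> i w'"
    then have "\<beta> w \<in> X" "\<beta> w' \<in> X" using \<beta> by auto
    then have "leg i (\<beta> w) = leg i (\<beta> w')"
      using inj_onD[OF \<iota>_inj[of i]] leg_pb w(3) unfolding \<kappa>_def by blast
    then have "\<beta> w = \<beta> w'" using inj_onD[OF inj[of i]] \<open>\<beta> w \<in> X\<close> \<open>\<beta> w' \<in> X\<close> by blast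
    then show "w = w'" using \<beta>(2) w by (auto dest: inj_onD)
  qed
  have \<kappa>_range: "\<kappa> i ` W \<subseteq> {..<N i}" for i
  proof -
    have "\<kappa> i w \<in> \<iota> i ` power_basis m B i" if "w \<in> W" for w
      unfolding \<kappa>_def using that \<beta>(1) by (intro imageI leg_pb) blast
    then show ?thesis using \<iota>_range[of i] by blast
  qed
  let ?p = "zero_pad \<iota> (power_basis m B) (tensor_power m t)"
  have p: "?p \<in> zariski_closure (index_box N) (monomial_orbit N ?p)"
  proof -
    have "?p z = 0" if z: "z \<notin> index_box N" for z
    proof -
      from z obtain i where "z i \<notin> {..<N i}" by (auto simp: index_box_def)
      then have "z i \<notin> \<iota> i ` power_basis m B i" using \<iota>_range by blast
      then show ?thesis by (rule zero_pad_outside)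
    qed
    then have "?p = monomial_transform N (\<lambda>_ r. r) (\<lambda>_ _. 1) ?p"
      by (auto simp: monomial_transform_def fun_eq_iff)
    moreover have "monomial_transform N (\<lambda>_ r. r) (\<lambda>_ _. 1) ?p \<in> monomial_orbit N ?p"
      unfolding monomial_orbit_def
      by (intro CollectI exI[of _ "\<lambda>_ r. r"] exI[of _ "\<lambda>_ _. 1"]) (simp add: bij_betw_id[unfolded id_def])
    ultimately show ?thesis using monomial_orbit_subset_closure by force
  qed
  define c where "c ys = (\<Prod>j<m. t (ys ! j))" for ys
  have c: "c ys \<noteq> 0 \<longleftrightarrow> set ys \<subseteq> {b. t b \<noteq> 0}" if "length ys = m" for ys
    using that by (auto simp: c_def set_conv_nth)
  \<comment> \<open>The rescaling takes place in the arbitrarily chosen leg \<open>i0\<close>.\<close>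
  define i0 :: 'k where "i0 = undefined"
  define d where "d i r = (if i = i0 then inverse (c (\<beta> (inv_into W (\<kappa> i0) r))) else 1)" for i r
  have d: "d i r \<noteq> 0" if r: "r \<in> \<kappa> i ` W" for i r
  proof (cases "i = i0")
    case True
    have "\<beta> (inv_into W (\<kappa> i0) r) \<in> X"
      using r \<beta>(1) unfolding True by (metis image_subset_iff inv_into_into)
    then have "c (\<beta> (inv_into W (\<kappa> i0) r)) \<noteq> 0" using X by (subst c) (auto simp: \<Phi>)
    then show ?thesis by (simp add: d_def)
  qed (simp add: d_def)
  have "zero_pad \<kappa> (\<lambda>_. W) (tensor_power n unit_tensor)
      = (\<lambda>z. if z \<in> index_box N \<and> (\<forall>i. z i \<in> \<kappa> i ` W) then (\<Prod>i\<in>UNIV. d i (z i)) * ?p z else 0)"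
  proof
    fix z
    show "zero_pad \<kappa> (\<lambda>_. W) (tensor_power n unit_tensor) z
      = (if z \<in> index_box N \<and> (\<forall>i. z i \<in> \<kappa> i ` W) then (\<Prod>i\<in>UNIV. d i (z i)) * ?p z else 0)"
      (is "?l = ?r")
    proof (cases "\<forall>i. z i \<in> \<kappa> i ` W")
      case True
      then have "\<forall>i. \<exists>x. x \<in> W \<and> z i = \<kappa> i x" by blast
      then obtain w where w: "\<And>i. w i \<in> W" "\<And>i. z i = \<kappa> i (w i)" by metis
      have box: "z \<in> index_box N" using True \<kappa>_range by (fastforce simp: index_box_def)
      have z: "z = (\<lambda>i. \<kappa> i (w i))" using w by auto
      then have z': "z = (\<lambda>i. \<iota> i (leg i (\<beta> (w i))))" by (simp add: \<kappa>_def)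
      have \<beta>w: "\<beta> (w i) \<in> X" for i using w \<beta> by auto
      have "?l = tensor_power n unit_tensor w"
        unfolding z by (rule zero_pad_image) (auto simp: \<kappa>_inj w)
      also have "\<dots> = (if \<forall>i j. w i = w j then 1 else 0)"
        using w by (intro tensor_power_unit_tensor) (simp add: W)
      finally have l: "?l = \<dots>" .
      have pz: "?p z = tensor_power m t (\<lambda>i. leg i (\<beta> (w i)))"
        unfolding z' by (rule zero_pad_image) (auto simp: \<iota>_inj leg_pb \<beta>w simp del: map_map)
      have "(\<Prod>i\<in>UNIV. d i (z i)) = (\<Prod>i\<in>UNIV. if i = i0 then inverse (c (\<beta> (w i0))) else 1)"
        using w \<kappa>_inj by (intro prod.cong) (auto simp: d_def inv_into_f_f)
      also have "\<dots> = inverse (c (\<beta> (w i0)))" by simp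
      finally have dz: "(\<Prod>i\<in>UNIV. d i (z i)) = inverse (c (\<beta> (w i0)))" .
      show ?thesis
      proof (cases "\<forall>i j. w i = w j")
        case eq: True
        then have w': "w i = w i0" for i by blast
        have "?p z = tensor_power m t (\<lambda>i. leg i (\<beta> (w i0)))"
          unfolding pz by (intro arg_cong[where f = "tensor_power m t"] ext) (metis w')
        also have "\<dots> = c (\<beta> (w i0))"
          unfolding c_def using X[OF \<beta>w[of i0]] by (intro tensor_power_legs) simp
        finally have "?p z = c (\<beta> (w i0))" .
        moreover have "c (\<beta> (w i0)) \<noteq> 0" using X[OF \<beta>w[of i0]] by (subst c) (auto simp: \<Phi>)
        ultimately show ?thesis using l eq dz True box by simp
      next
        case ne: False
        have "?p z = 0"
        proof (rule ccontr)
          assume nz: "?p z \<noteq> 0"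
          \<comment> \<open>The word over \<open>\<Phi>\<close> assembled from legs of different members of \<open>X\<close>.\<close>
          define ys where "ys = map (\<lambda>j i. leg i (\<beta> (w i)) ! j) [0..<m]"
          have len: "length ys = m" by (simp add: ys_def)
          have len': "length (\<beta> (w i)) = m" for i using X[OF \<beta>w] by auto
          have legs: "leg i ys = leg i (\<beta> (w i))" for i
            using len' by (intro nth_equalityI) (auto simp: ys_def)
          have "c ys = ?p z"
            unfolding pz legs[symmetric] c_def using len by (rule tensor_power_legs[symmetric])
          then have "set ys \<subseteq> {b. t b \<noteq> 0}" using nz c[OF len] by simp
          moreover have "y i \<in> B i" if "y \<in> set ys" for y i
          proof -
            from that have "y i \<in> set (leg i ys)" by auto
            then have "y i \<in> set (leg i (\<beta> (w i)))" unfolding legs .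
            then show ?thesis using leg_pb[OF \<beta>w, of i i] by (auto simp: power_basis_def)
          qed
          ultimately have "set ys \<subseteq> \<Phi>" by (auto simp: \<Phi>)
          moreover have "leg i ys \<in> leg i ` X" for i using legs \<beta>w by (metis imageI)
          ultimately have ys: "ys \<in> X" using closed len by blast
          then have "\<beta> (w i) = ys" for i
            using inj_onD[OF inj[of i], of "\<beta> (w i)" ys] \<beta>w legs by metis
          then have "w i = w j" for i j
            using \<beta>(2) w(1) by (metis inj_onD)
          then show False using ne by blast
        qed
        then show ?thesis using l ne by auto
      qed
    next
      case False
      then show ?thesis by (auto intro: zero_pad_outside)
    qed
  qed
  moreover have "(\<lambda>z. if z \<in> index_box N \<and> (\<forall>i. z i \<in> \<kappa> i ` W) then (\<Prod>i\<in>UNIV. d i (z i)) * ?p z else 0)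
      \<in> zariski_closure (index_box N) (monomial_orbit N ?p)"
    by (rule scaled_restriction_closure[OF p]) (rule d)
  ultimately have "zero_pad \<kappa> (\<lambda>_. W) (tensor_power n unit_tensor)
      \<in> zariski_closure (index_box N) (monomial_orbit N ?p)"
    by (simp only:)
  note closure = this
  show ?thesis
    unfolding monomial_degeneration_iff W[abs_def]
    by (intro exI conjI allI, rule \<iota>_inj, rule \<iota>_range, rule \<kappa>_inj, rule \<kappa>_range,
        rule closure)
qed

section \<open>The subexponent as the limit of a subadditive sequence\<close>

text \<open>
  Division with remainder by \<open>m\<close> gives \<open>a n / n \<le> a m / m + C / n\<close>, where \<open>C\<close> bounds \<open>a\<close> below \<open>m\<close>.
\<close>

lemma fekete:
  fixes a :: "nat \<Rightarrow> real"
  assumes nonneg: "\<And>n. 0 \<le> a n" and sub: "\<And>m n. a (m + n) \<le> a m + a n"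
  obtains L where "(\<lambda>n. a n / n) \<longlonglongrightarrow> L" "0 \<le> L" "\<And>n. 0 < n \<Longrightarrow> L \<le> a n / n"
proof -
  define L where "L = (INF n\<in>{0<..}. a n / real n)"
  have bdd: "bdd_below ((\<lambda>n. a n / real n) ` {0<..})"
    using nonneg by (intro bdd_belowI2[of _ 0]) simp
  have lower: "L \<le> a n / n" if "0 < n" for n
    unfolding L_def using that by (intro cINF_lower bdd) auto
  have mult: "a (q * m + r) \<le> q * a m + a r" for q m r
  proof (induction q)
    case (Suc q)
    have "a (Suc q * m + r) \<le> a m + a (q * m + r)" using sub[of m "q * m + r"] by (simp add: add.assoc)
    then show ?case using Suc by (simp add: algebra_simps)
  qed simp
  have "(\<lambda>n. a n / n) \<longlonglongrightarrow> L"
  proof (rule LIMSEQ_I)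
    fix e :: real assume e: "0 < e"
    have "\<exists>m\<in>{0<..}. a m / real m < L + e / 2"
      using e bdd by (intro cINF_less_iff[THEN iffD1]) (auto simp: L_def)
    then obtain m where m: "0 < m" "a m / m < L + e / 2" by auto
    \<comment> \<open>A crude bound for the values of \<open>a\<close> at the possible remainders.\<close>
    define C where "C = (\<Sum>r<m. a r)"
    have C: "a r \<le> C" if "r < m" for r
      unfolding C_def using that nonneg by (intro member_le_sum) auto
    obtain n0 :: nat where n0: "0 < n0" "2 * C / e < n0"
    proof -
      obtain n0 :: nat where "max 1 (2 * C / e) < n0" using reals_Archimedean2 by blast
      then show ?thesis by (intro that[of n0]) auto
    qed
    have "norm (a n / n - L) < e" if n: "n0 \<le> n" for n
    proof -
      have "0 < n" using n n0 by simp
      have "a n \<le> (n div m) * a m + a (n mod m)"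
        using mult[of "n div m" m "n mod m"] by simp
      also have "\<dots> \<le> (real n / m) * a m + C"
        using m nonneg by (intro add_mono mult_right_mono C) (auto simp: of_nat_div_le_of_nat)
      finally have "a n / n \<le> ((real n / m) * a m + C) / n"
        by (rule divide_right_mono) simp
      also have "\<dots> = a m / m + C / n" using \<open>0 < n\<close> by (simp add: field_simps)
      also have "C / n < e / 2"
      proof -
        have "2 * C / e < n" using n0 n by linarith
        then show ?thesis using e \<open>0 < n\<close> by (simp add: field_simps)
      qed
      finally show ?thesis using m lower[OF \<open>0 < n\<close>] by simp
    qed
    then show "\<exists>n0. \<forall>n\<ge>n0. norm (a n / n - L) < e" by blast
  qed
  moreover have "0 \<le> L" unfolding L_def using nonneg by (intro cINF_greatest) auto
  ultimately show ?thesis using that lower by blast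
qed

text \<open>
  If \<open>D m 1\<close> holds for no \<open>m\<close>, then all infima with \<open>n > 0\<close> are infinite, and so is the limit. Otherwise
  all are finite, and Fekete's lemma applies to the least \<open>m\<close>.
\<close>

lemma inverse_lim_subadditive:
  fixes D :: "nat \<Rightarrow> nat \<Rightarrow> bool"
  assumes add: "\<And>m n m' n'. D m n \<Longrightarrow> D m' n' \<Longrightarrow> D (m + m') (n + n')"
    and antimono: "\<And>m n n'. D m n \<Longrightarrow> n' \<le> n \<Longrightarrow> D m n'"
  defines "s \<equiv> inverse (lim (\<lambda>n. (INF m\<in>{m. D m n}. ereal (real m)) / ereal (real n)))"
  shows "0 \<le> s" and "D m n \<Longrightarrow> 0 < m \<Longrightarrow> ereal (real n / real m) \<le> s"
proof -
  let ?f = "\<lambda>n. (INF m\<in>{m. D m n}. ereal (real m)) / ereal (real n)"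
  have "0 \<le> s \<and> (D m n \<longrightarrow> 0 < m \<longrightarrow> ereal (real n / real m) \<le> s)"
  proof (cases "\<exists>m. D m 1")
    case True
    then obtain m1 where m1: "D m1 1" ..
    have ex: "\<exists>m. D m n" for n
    proof (induction n)
      case 0
      show ?case using antimono[OF m1, of 0] by auto
    next
      case (Suc n)
      then show ?case using add[OF _ m1] by fastforce
    qed
    define a where "a n = (LEAST m. D m n)" for n
    have a: "D (a n) n" for n unfolding a_def using ex[of n] by (rule LeastI_ex)
    have a_le: "a n \<le> m" if "D m n" for m n unfolding a_def using that by (rule Least_le)
    have inf: "(INF m\<in>{m. D m n}. ereal (real m)) = ereal (real (a n))" for n
      using a a_le by (intro antisym INF_lower2[of "a n"] INF_greatest) auto
    have sub: "real (a (m + n)) \<le> real (a m) + real (a n)" for m n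
      using a_le[OF add[OF a a], of m n] by linarith
    obtain L where L: "(\<lambda>n. real (a n) / n) \<longlonglongrightarrow> L" "0 \<le> L" "\<And>n. 0 < n \<Longrightarrow> L \<le> a n / n"
      using fekete[of "\<lambda>n. real (a n)", OF _ sub] by auto
    have "\<forall>\<^sub>F n in sequentially. ereal (real (a n) / n) = ?f n"
      using eventually_gt_at_top[of 0] by eventually_elim (simp add: inf)
    then have "?f \<longlonglongrightarrow> ereal L"
      using L(1) by (intro Lim_transform_eventually[OF tendsto_ereal])
    then have s: "s = inverse (ereal L)" unfolding s_def by (simp add: limI)
    have "ereal (real n / real m) \<le> s" if "D m n" "0 < m"
    proof (cases "n = 0 \<or> L = 0")
      case True
      then show ?thesis using s L(2) by auto
    next
      case False
      have "L \<le> a n / n" using False by (intro L(3)) simp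
      also have "\<dots> \<le> m / n" using a_le[OF that(1)] by (intro divide_right_mono) auto
      finally have "L * n \<le> m" using False by (simp add: field_simps)
      then show ?thesis using s False L(2) that(2) by (auto simp: field_simps)
    qed
    then show ?thesis using s L(2) by auto
  next
    case False
    have none: "{m. D m n} = {}" if "0 < n" for n
      using False antimono[of _ n 1] that by auto
    have "\<forall>\<^sub>F n in sequentially. \<infinity> = ?f n"
      using eventually_gt_at_top[of 0] by eventually_elim (simp add: none top_ereal_def)
    then have "?f \<longlonglongrightarrow> \<infinity>" by (rule Lim_transform_eventually[OF tendsto_const])
    then have s: "s = 0" unfolding s_def by (simp add: limI)
    have "n = 0" if "D m n" using none[of n] that by auto
    then show ?thesis using s by (auto simp: zero_ereal_def[symmetric])
  qed
  then show "0 \<le> s" and "D m n \<Longrightarrow> 0 < m \<Longrightarrow> ereal (real n / real m) \<le> s" by auto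
qed

lemma monomial_subexponent_nonneg: "0 \<le> monomial_subexponent B t"
  unfolding monomial_subexponent_def
proof (rule inverse_lim_subadditive(1)[where D = "\<lambda>m n. monomial_degeneration (power_basis m B)
    (tensor_power m t) (power_basis n unit_basis) (tensor_power n unit_tensor)"])
qed (erule (1) monomial_degeneration_power_add unit_degeneration_antimono)+

lemma monomial_subexponent_ge:
  assumes "monomial_degeneration (power_basis m B) (tensor_power m t)
      (power_basis n unit_basis) (tensor_power n unit_tensor)"
    and "0 < m"
  shows "ereal (real n / real m) \<le> monomial_subexponent B t"
  unfolding monomial_subexponent_def
proof (rule inverse_lim_subadditive(2)[where D = "\<lambda>m n. monomial_degeneration (power_basis m B)
    (tensor_power m t) (power_basis n unit_basis) (tensor_power n unit_tensor)", OF _ _ assms])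
qed (erule (1) monomial_degeneration_power_add unit_degeneration_antimono)+

section \<open>Entropy and type classes\<close>

text \<open>
  Stirling's formula up to a factor that is polynomial in \<open>n\<close>. The terms \<open>- n\<close> cancel in multinomial
  coefficients.
\<close>

lemma ln_fact_bounds:
  "real n * ln (real n) - real n \<le> ln (fact n)"
  "ln (fact n) \<le> real n * ln (real n) - real n + 1 + ln (real n + 1)"
proof -
  have "real n * ln (real n) - real n \<le> ln (fact n) \<and>
      ln (fact n) \<le> real n * ln (real n) - real n + 1 + ln (real n)" if "1 \<le> n"
    using that
  proof (induction n rule: dec_induct)
    case (step n)
    have n: "0 < real n" using step by simp
    have fact: "ln (fact (Suc n)) = ln (real n + 1) + ln (fact n)"
      by (simp add: ln_mult add_ac)
    have "ln ((real n + 1) / n) \<le> (real n + 1) / n - 1" using n by (intro ln_le_minus_one) simp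
    then have 1: "real n * (ln (real n + 1) - ln (real n)) \<le> 1"
      using n by (simp add: ln_div field_simps)
    have "ln (real n / (real n + 1)) \<le> real n / (real n + 1) - 1" using n by (intro ln_le_minus_one) simp
    then have 2: "1 \<le> (real n + 1) * (ln (real n + 1) - ln (real n))"
      using n by (simp add: ln_div field_simps)
    show ?case using step.IH 1 2 unfolding fact by (simp add: algebra_simps)
  qed simp
  moreover have "ln (real n) \<le> ln (real n + 1)" if "1 \<le> n" using that by simp
  ultimately have "real n * ln (real n) - real n \<le> ln (fact n) \<and>
    ln (fact n) \<le> real n * ln (real n) - real n + 1 + ln (real n + 1)"
    by (cases "1 \<le> n") (linarith, auto simp: not_le)
  then show "real n * ln (real n) - real n \<le> ln (fact n)"
    "ln (fact n) \<le> real n * ln (real n) - real n + 1 + ln (real n + 1)" by auto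
qed

text \<open>
  The permutations of \<open>M\<close> are the words with letter frequencies \<open>M\<close>. Their number is a multinomial
  coefficient, which is \<open>2 powr (N * H)\<close> up to factors polynomial in \<open>N\<close>.
\<close>

lemma ln_card_type_class:
  assumes "M \<noteq> {#}"
  defines "N \<equiv> size M" and "H \<equiv> shannon_entropy (pmf_of_multiset M)"
  shows "ln (card (permutations_of_multiset M)) \<le> N * (ln 2 * H) + 1 + ln (real N + 1)"
    and "N * (ln 2 * H) - card (set_mset M) * (1 + ln (real N + 1)) \<le> ln (card (permutations_of_multiset M))"
proof -
  let ?c = "\<lambda>x. real (count M x)"
  let ?S = "\<lambda>c. real c * ln (real c) - real c"
  have N: "0 < real N" using assms by (simp add: N_def nonempty_has_size)
  have c: "0 < ?c x" if "x \<in># M" for x using that by simp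
  have cN: "?c x \<le> N" for x by (simp add: N_def count_le_size)
  have sum_c: "(\<Sum>x\<in>set_mset M. ?c x) = N" by (simp add: N_def size_multiset_overloaded_eq)
  have "real (card (permutations_of_multiset M)) = fact N / (\<Prod>x\<in>set_mset M. fact (count M x))"
    unfolding card_permutations_of_multiset(1)
    using card_permutations_of_multiset(2)[of M] by (simp add: real_of_nat_div N_def)
  then have card: "ln (card (permutations_of_multiset M))
      = ln (fact N) - (\<Sum>x\<in>set_mset M. ln (fact (count M x)))"
    by (simp add: ln_div ln_prod prod_pos)
  have "N * (ln 2 * H) = - (\<Sum>x\<in>set_mset M. ?c x * ln (?c x / N))"
    using N assms(1) by (simp add: H_def shannon_entropy_def sum_distrib_left log_def N_def field_simps)
  also have "\<dots> = - (\<Sum>x\<in>set_mset M. ?c x * ln (?c x) - ?c x * ln N)"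
    using N c by (intro arg_cong[where f = uminus] sum.cong) (auto simp: ln_div field_simps)
  also have "\<dots> = N * ln N - (\<Sum>x\<in>set_mset M. ?c x * ln (?c x))"
    by (simp add: sum_subtractf flip: sum_distrib_right sum_c)
  also have "\<dots> = ?S N - (\<Sum>x\<in>set_mset M. ?S (count M x))"
    by (simp add: sum_subtractf sum_c)
  finally have H: "N * (ln 2 * H) = ?S N - (\<Sum>x\<in>set_mset M. ?S (count M x))" .
  have "(\<Sum>x\<in>set_mset M. ?S (count M x)) \<le> (\<Sum>x\<in>set_mset M. ln (fact (count M x)))"
    by (intro sum_mono ln_fact_bounds)
  then show "ln (card (permutations_of_multiset M)) \<le> N * (ln 2 * H) + 1 + ln (real N + 1)"
    using ln_fact_bounds(2)[of N] unfolding card H by simp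
  have "(\<Sum>x\<in>set_mset M. ln (fact (count M x)))
      \<le> (\<Sum>x\<in>set_mset M. ?S (count M x) + (1 + ln (real N + 1)))"
  proof (intro sum_mono)
    fix x
    have "ln (?c x + 1) \<le> ln (real N + 1)" using cN[of x] by simp
    then show "ln (fact (count M x)) \<le> ?S (count M x) + (1 + ln (real N + 1))"
      using ln_fact_bounds(2)[of "count M x"] by linarith
  qed
  also have "\<dots> = (\<Sum>x\<in>set_mset M. ?S (count M x)) + card (set_mset M) * (1 + ln (real N + 1))"
    by (simp add: sum.distrib)
  finally show "N * (ln 2 * H) - card (set_mset M) * (1 + ln (real N + 1))
      \<le> ln (card (permutations_of_multiset M))"
    using ln_fact_bounds(1)[of N] unfolding card H by simp
qed

text \<open>
  There are at most \<open>(N + 1) ^ card A\<close> letter frequencies of words of length \<open>N\<close>.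
\<close>

lemma card_lists_bounded_entropy:
  assumes A: "finite A" and N: "0 < N"
    and Z: "\<And>zs. zs \<in> Z \<Longrightarrow> set zs \<subseteq> A \<and> length zs = N"
    and h: "\<And>zs. zs \<in> Z \<Longrightarrow> shannon_entropy (pmf_of_multiset (mset zs)) \<le> h"
  shows "card Z \<le> exp 1 * (real N + 1) ^ Suc (card A) * 2 powr (N * h)"
proof -
  have fin: "finite Z"
    by (rule finite_subset[OF _ finite_lists_length_eq[OF A, of N]]) (use Z in auto)
  let ?T = "mset ` Z"
  have T: "size M = N \<and> set_mset M \<subseteq> A" if "M \<in> ?T" for M
    using that Z by (auto dest!: Z)
  have "card ?T \<le> card (A \<rightarrow>\<^sub>E {..N})"
  proof (rule card_inj_on_le)
    show "(\<lambda>M. restrict (count M) A) ` ?T \<subseteq> A \<rightarrow>\<^sub>E {..N}"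
    proof (rule image_subsetI)
      fix M assume "M \<in> ?T"
      then have "count M x \<le> N" for x using T by (metis count_le_size)
      then show "restrict (count M) A \<in> A \<rightarrow>\<^sub>E {..N}" by simp
    qed
    show "inj_on (\<lambda>M. restrict (count M) A) ?T"
    proof (rule inj_onI, rule multiset_eqI)
      fix M M' x assume M: "M \<in> ?T" "M' \<in> ?T" "restrict (count M) A = restrict (count M') A"
      show "count M x = count M' x"
      proof (cases "x \<in> A")
        case True
        then show ?thesis using fun_cong[OF M(3), of x] by simp
      next
        case False
        then have "x \<notin># M" "x \<notin># M'" using T M by blast+
        then show ?thesis by (simp add: not_in_iff)
      qed
    qed
  qed (use A in \<open>simp add: finite_PiE\<close>)
  then have T_card: "real (card ?T) \<le> (real N + 1) ^ card A"
    using A by (simp add: card_PiE) (metis of_nat_Suc of_nat_le_iff of_nat_power add.commute)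
  have cls: "real (card (permutations_of_multiset M)) \<le> exp 1 * (real N + 1) * 2 powr (N * h)"
    if M: "M \<in> ?T" for M
  proof -
    from M obtain zs where zs: "zs \<in> Z" "M = mset zs" by blast
    have ne: "M \<noteq> {#}" using T[OF M] N by auto
    have "0 < card (permutations_of_multiset M)" by (simp add: card_gt_0_iff)
    then have "real (card (permutations_of_multiset M)) = exp (ln (card (permutations_of_multiset M)))"
      by simp
    also have "\<dots> \<le> exp (N * (ln 2 * shannon_entropy (pmf_of_multiset M)) + 1 + ln (real N + 1))"
      using ln_card_type_class(1)[OF ne] T[OF M] by simp
    also have "\<dots> \<le> exp (N * (ln 2 * h) + 1 + ln (real N + 1))"
      using h[OF zs(1)] zs by (intro iffD2[OF exp_le_cancel_iff] add_right_mono mult_left_mono) auto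
    also have "\<dots> = exp 1 * (real N + 1) * 2 powr (N * h)"
      by (simp add: exp_add powr_def mult_ac)
    finally show ?thesis .
  qed
  have "Z \<subseteq> (\<Union>M\<in>?T. permutations_of_multiset M)" by (auto simp: permutations_of_multiset_def)
  then have "card Z \<le> card (\<Union>M\<in>?T. permutations_of_multiset M)"
    using fin by (intro card_mono) auto
  also have "\<dots> \<le> (\<Sum>M\<in>?T. card (permutations_of_multiset M))"
    using fin by (intro card_UN_le) simp
  finally have "real (card Z) \<le> (\<Sum>M\<in>?T. real (card (permutations_of_multiset M)))"
    by (metis of_nat_le_iff of_nat_sum)
  also have "\<dots> \<le> real (card ?T) * (exp 1 * (real N + 1) * 2 powr (N * h))"
    by (rule sum_bounded_above) (rule cls)
  also have "\<dots> \<le> (real N + 1) ^ card A * (exp 1 * (real N + 1) * 2 powr (N * h))"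
    using T_card by (intro mult_right_mono) auto
  finally show ?thesis by (simp add: mult_ac)
qed

lemma shannon_entropy_superset:
  assumes "finite A" "set_pmf P \<subseteq> A"
  shows "shannon_entropy P = - (\<Sum>x\<in>A. pmf P x * log 2 (pmf P x))"
proof -
  have "(\<Sum>x\<in>set_pmf P. pmf P x * log 2 (pmf P x)) = (\<Sum>x\<in>A. pmf P x * log 2 (pmf P x))"
    using assms by (intro sum.mono_neutral_left) (auto simp: set_pmf_iff)
  then show ?thesis by (simp add: shannon_entropy_def)
qed

lemma continuous_on_x_log_x: "continuous_on {0..} (\<lambda>x::real. x * log 2 x)"
proof -
  have "((\<lambda>x::real. x * log 2 x) \<longlongrightarrow> 0) (at_right 0)"
    unfolding log_def by real_asymp
  then have 0: "((\<lambda>x::real. x * log 2 x) \<longlongrightarrow> 0 * log 2 0) (at 0 within {0..})"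
    by (simp add: at_within_Ici_at_right)
  have "((\<lambda>x::real. x * log 2 x) \<longlongrightarrow> x * log 2 x) (at x within {0..})" if "0 < x" for x
    using that by (intro tendsto_intros) auto
  then show ?thesis
    unfolding continuous_on_def using 0 by (metis atLeast_iff less_eq_real_def)
qed

lemma shannon_entropy_tendsto:
  fixes P :: "nat \<Rightarrow> 'a pmf"
  assumes A: "finite A" "\<And>n. set_pmf (P n) \<subseteq> A" "set_pmf Q \<subseteq> A"
    and lim: "\<And>x. (\<lambda>n. pmf (P n) x) \<longlonglongrightarrow> pmf Q x"
  shows "(\<lambda>n. shannon_entropy (P n)) \<longlonglongrightarrow> shannon_entropy Q"
proof -
  have "(\<lambda>n. pmf (P n) x * log 2 (pmf (P n) x)) \<longlonglongrightarrow> pmf Q x * log 2 (pmf Q x)" for x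
    using continuous_on_tendsto_compose[OF continuous_on_x_log_x lim[of x]] by simp
  then show ?thesis
    using A by (simp add: shannon_entropy_superset[of A]) (intro tendsto_minus tendsto_sum)
qed

lemma pmf_map_superset:
  assumes "finite A" "set_pmf P \<subseteq> A"
  shows "pmf (map_pmf f P) y = (\<Sum>x\<in>{x \<in> A. f x = y}. pmf P x)"
proof -
  have "pmf (map_pmf f P) y = measure P (f -` {y} \<inter> set_pmf P)"
    by (simp add: pmf_map measure_Int_set_pmf)
  also have "f -` {y} \<inter> set_pmf P = {x \<in> A. f x = y} \<inter> set_pmf P" using assms by auto
  also have "measure P \<dots> = measure P {x \<in> A. f x = y}" by (rule measure_Int_set_pmf)
  also have "\<dots> = (\<Sum>x\<in>{x \<in> A. f x = y}. pmf P x)" using assms by (intro measure_measure_pmf_finite) auto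
  finally show ?thesis .
qed

lemma pmf_map_tendsto:
  fixes P :: "nat \<Rightarrow> 'a pmf"
  assumes A: "finite A" "\<And>n. set_pmf (P n) \<subseteq> A" "set_pmf Q \<subseteq> A"
    and lim: "\<And>x. (\<lambda>n. pmf (P n) x) \<longlonglongrightarrow> pmf Q x"
  shows "(\<lambda>n. pmf (map_pmf f (P n)) y) \<longlonglongrightarrow> pmf (map_pmf f Q) y"
  using A lim by (simp add: pmf_map_superset[of A]) (intro tendsto_intros)

lemma map_pmf_of_multiset:
  assumes "M \<noteq> {#}"
  shows "map_pmf f (pmf_of_multiset M) = pmf_of_multiset (image_mset f M)"
proof (rule pmf_eqI)
  fix y
  have "count (image_mset f M) y = (\<Sum>x\<in>{x \<in> set_mset M. f x = y}. count M x)"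
    unfolding count_image_mset by (intro sum.cong) auto
  then show "pmf (map_pmf f (pmf_of_multiset M)) y = pmf (pmf_of_multiset (image_mset f M)) y"
    using assms by (simp add: pmf_map_superset[of "set_mset M"] sum_divide_distrib)
qed

lemma convergent_subsequence_pointwise:
  fixes f :: "nat \<Rightarrow> 'a \<Rightarrow> real"
  assumes "finite A" and bdd: "\<And>n x. 0 \<le> f n x \<and> f n x \<le> 1"
  shows "\<exists>r. strict_mono r \<and> (\<forall>x\<in>A. convergent (\<lambda>n. f (r n) x))"
  using assms(1)
proof induction
  case empty
  show ?case by (auto intro: strict_mono_id[unfolded id_def])
next
  case (insert x A)
  then obtain r where r: "strict_mono r" "\<And>y. y \<in> A \<Longrightarrow> convergent (\<lambda>n. f (r n) y)" by auto
  have "bounded (range (\<lambda>n. f (r n) x))"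
    by (rule boundedI[of _ 1]) (use bdd in auto)
  then obtain l s where s: "strict_mono s" "((\<lambda>n. f (r n) x) \<circ> s) \<longlonglongrightarrow> l"
    using bounded_imp_convergent_subsequence by blast
  have "convergent (\<lambda>n. f (r (s n)) y)" if "y \<in> insert x A" for y
  proof (cases "y = x")
    case True
    then show ?thesis using s(2) by (auto simp: o_def convergent_def)
  next
    case False
    then have "convergent ((\<lambda>n. f (r n) y) \<circ> s)" using that r(2) s(1) by (intro convergent_subseq_convergent) auto
    then show ?thesis by (simp add: o_def)
  qed
  then show ?case using r(1) s(1) by (intro exI[of _ "r \<circ> s"]) (auto intro: strict_mono_o[unfolded o_def])
qed

text \<open>
  The distributions on a finite set form a compact set.
\<close>

lemma pmf_convergent_subsequence:
  fixes Q :: "nat \<Rightarrow> 'a pmf"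
  assumes A: "finite A" "\<And>n. set_pmf (Q n) \<subseteq> A"
  obtains r Q' where "strict_mono r" "set_pmf Q' \<subseteq> A" "\<And>x. (\<lambda>n. pmf (Q (r n)) x) \<longlonglongrightarrow> pmf Q' x"
proof -
  obtain r where r: "strict_mono r" "\<And>x. x \<in> A \<Longrightarrow> convergent (\<lambda>n. pmf (Q (r n)) x)"
    using convergent_subsequence_pointwise[OF A(1), of "\<lambda>n. pmf (Q n)"] by (auto simp: pmf_le_1)
  define g where "g x = lim (\<lambda>n. pmf (Q (r n)) x)" for x
  have zero: "pmf (Q n) x = 0" if "x \<notin> A" for n x using A(2)[of n] that by (meson set_pmf_iff subsetD)
  have lim: "(\<lambda>n. pmf (Q (r n)) x) \<longlonglongrightarrow> g x" for x
  proof (cases "x \<in> A")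
    case True
    then show ?thesis using r(2) by (simp add: g_def convergent_LIMSEQ_iff)
  qed (simp add: zero g_def)
  have g0: "0 \<le> g x" for x using lim[of x] by (rule LIMSEQ_le_const) auto
  have gA: "g x = 0" if "x \<notin> A" for x using that by (simp add: g_def zero)
  have "(\<lambda>n. \<Sum>x\<in>A. pmf (Q (r n)) x) \<longlonglongrightarrow> (\<Sum>x\<in>A. g x)" by (intro tendsto_intros lim)
  then have sum: "(\<Sum>x\<in>A. g x) = 1" using A by (simp add: sum_pmf_eq_1 LIMSEQ_const_iff)
  have "(\<integral>\<^sup>+ x. ennreal (g x) \<partial>count_space UNIV) = (\<Sum>x\<in>A. ennreal (g x))"
    using gA by (intro nn_integral_count_space'[OF A(1)]) auto
  also have "\<dots> = 1" using sum g0 by (simp add: sum_ennreal)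
  finally have int: "(\<integral>\<^sup>+ x. ennreal (g x) \<partial>count_space UNIV) = 1" .
  have "pmf (embed_pmf g) x = g x" for x using g0 int by (intro pmf_embed_pmf) auto
  moreover from this have "set_pmf (embed_pmf g) \<subseteq> A" using gA by (metis set_pmf_iff subsetI)
  ultimately show ?thesis using lim by (intro that[OF r(1), of "embed_pmf g"]) simp_all
qed

text \<open>
  Round all probabilities but one down to multiples of \<open>1 / n\<close>, and let the remaining letter fill up.
\<close>

lemma multiset_approximation:
  fixes P :: "'a pmf"
  assumes "finite A" "set_pmf P \<subseteq> A"
  obtains M :: "nat \<Rightarrow> 'a multiset" where "\<And>n. size (M n) = n" "\<And>n. set_mset (M n) \<subseteq> A"
    "\<And>x. (\<lambda>n. real (count (M n) x) / n) \<longlonglongrightarrow> pmf P x"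
proof -
  obtain x0 where x0: "x0 \<in> A" using assms(2) set_pmf_not_empty[of P] by blast
  let ?A' = "A - {x0}"
  \<comment> \<open>The letter \<open>x0\<close> receives what the rounding of the others leaves over.\<close>
  define c where "c n x = nat \<lfloor>real n * pmf P x\<rfloor>" for n x
  have c: "real (c n x) \<le> n * pmf P x" "n * pmf P x < c n x + 1" for n x
    unfolding c_def by (simp, linarith)
  have sumP: "(\<Sum>x\<in>?A'. pmf P x) = 1 - pmf P x0"
    using sum_pmf_eq_1[OF assms] assms(1) x0 by (simp add: sum.remove)
  have "real (\<Sum>x\<in>?A'. c n x) \<le> n * (1 - pmf P x0)" for n
    using sum_mono[of ?A' "\<lambda>x. real (c n x)" "\<lambda>x. n * pmf P x"] c(1)
    by (simp flip: sum_distrib_left sumP)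
  moreover have "real n * (1 - pmf P x0) \<le> n" for n by (simp add: mult_left_le)
  ultimately have "real (\<Sum>x\<in>?A'. c n x) \<le> real n" for n using order_trans by blast
  then have le: "(\<Sum>x\<in>?A'. c n x) \<le> n" for n by (simp only: of_nat_le_iff)
  define M where "M n = (\<Sum>x\<in>?A'. replicate_mset (c n x) x) + replicate_mset (n - (\<Sum>x\<in>?A'. c n x)) x0"
    for n
  have count: "count (M n) x = (if x = x0 then n - (\<Sum>x\<in>?A'. c n x) else if x \<in> A then c n x else 0)" for n x
    using assms(1) by (auto simp: M_def count_sum)
  have "size (M n) = n" for n using le[of n] by (simp add: M_def)
  moreover have "set_mset (M n) \<subseteq> A" for n
    using x0 by (auto simp: count count_greater_zero_iff[symmetric] simp del: count_greater_zero_iff split: if_splits)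
  moreover have "(\<lambda>n. real (count (M n) x) / n) \<longlonglongrightarrow> pmf P x" for x
  proof -
    have lim: "(\<lambda>n. real (c n x) / n) \<longlonglongrightarrow> pmf P x" for x
    proof (rule tendsto_sandwich)
      show "(\<lambda>n. pmf P x - 1 / n) \<longlonglongrightarrow> pmf P x"
        using tendsto_diff[OF tendsto_const lim_1_over_n] by simp
      show "\<forall>\<^sub>F n in sequentially. pmf P x - 1 / n \<le> c n x / n"
        using eventually_gt_at_top[of 0]
      proof eventually_elim
        case (elim n)
        then have "pmf P x \<le> (c n x + 1) / n"
          using c(2)[of n x] by (simp add: pos_le_divide_eq mult.commute)
        then show ?case by (simp add: add_divide_distrib)
      qed
      show "\<forall>\<^sub>F n in sequentially. c n x / n \<le> pmf P x"
        using eventually_gt_at_top[of 0]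
      proof eventually_elim
        case (elim n)
        then show ?case using c(1)[of n x] by (simp add: field_simps)
      qed
    qed simp
    consider "x = x0" | "x \<noteq> x0" "x \<in> A" | "x \<notin> A" using x0 by blast
    then show ?thesis
    proof cases
      case 1
      have "(\<lambda>n. 1 - (\<Sum>x\<in>?A'. real (c n x) / n)) \<longlonglongrightarrow> 1 - (\<Sum>x\<in>?A'. pmf P x)"
        by (intro tendsto_intros lim)
      moreover have "\<forall>\<^sub>F n in sequentially. 1 - (\<Sum>x\<in>?A'. real (c n x) / n) = real (count (M n) x) / n"
        using eventually_gt_at_top[of 0]
      proof eventually_elim
        case (elim n)
        then show ?case using le[of n] 1
          by (simp add: count of_nat_diff diff_divide_distrib flip: sum_divide_distrib)
      qed
      ultimately show ?thesis using 1 by (simp add: sumP) (rule Lim_transform_eventually)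
    next
      case 2
      then show ?thesis using lim[of x] by (simp add: count)
    next
      case 3
      then have "pmf P x = 0" using assms(2) by (auto simp: set_pmf_iff)
      moreover have "x \<noteq> x0" using 3 x0 by blast
      ultimately show ?thesis using 3 by (simp add: count)
    qed
  qed
  ultimately show ?thesis by (rule that)
qed

section \<open>Average-free sets and ranks modulo a prime\<close>

text \<open>
  No element of \<open>S\<close> is the average of \<open>card J\<close> elements of \<open>S\<close> modulo \<open>p\<close>, except trivially. Points of
  \<open>F_p^e\<close> are represented by functions of which only the values below \<open>e\<close> matter.
\<close>

definition average_free :: "'j set \<Rightarrow> nat \<Rightarrow> nat \<Rightarrow> (nat \<Rightarrow> int) set \<Rightarrow> bool"
  where "average_free J p e S \<longleftrightarrow> (\<forall>f s. (\<forall>j\<in>J. f j \<in> S) \<longrightarrow> s \<in> S \<longrightarrow>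
    (\<forall>a<e. [(\<Sum>j\<in>J. f j a) = int (card J) * s a] (mod int p)) \<longrightarrow> (\<forall>j\<in>J. f j = s))"

text \<open>
  By strict convexity a point of a Euclidean sphere is not the average of other points of the sphere.
  Some sphere contains many of the points of the box \<open>{0..<d}^e\<close>, since the squared norms are integers
  of size at most \<open>e * d\<^sup>2\<close>; and as \<open>card J * d \<le> p\<close>, congruences between sums of coordinates are
  equations. This is Behrend's construction, with \<open>F_p^e\<close> in place of digit expansions.
\<close>

lemma exists_large_average_free_set:
  fixes J :: "'j set" and d e p :: nat
  assumes J: "finite J" "J \<noteq> {}" and d: "0 < d" and p: "card J * d \<le> p"
  obtains S :: "(nat \<Rightarrow> int) set" where "S \<subseteq> {..<e} \<rightarrow>\<^sub>E {0..<int d}"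
    "d ^ e \<le> card S * (e * d\<^sup>2 + 1)" "average_free J p e S"
proof -
  let ?F = "{..<e} \<rightarrow>\<^sub>E {0..<int d}"
  let ?q = "\<lambda>f. \<Sum>a<e. (f a)\<^sup>2"
  have q: "?q f \<in> {0..int (e * d\<^sup>2)}" if f: "f \<in> ?F" for f
  proof -
    have "(f a)\<^sup>2 \<le> (int d)\<^sup>2" if "a < e" for a
      using f that by (intro power_mono) (auto simp: PiE_iff less_imp_le)
    then have "?q f \<le> (\<Sum>a<e. (int d)\<^sup>2)" by (intro sum_mono) auto
    then show ?thesis by (simp add: sum_nonneg)
  qed
  have finF: "finite ?F" by (simp add: finite_PiE)
  obtain \<rho> where \<rho>: "card ?F \<le> card (?q -` {\<rho>} \<inter> ?F) * card {0..int (e * d\<^sup>2)}"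
    using pigeonhole_card[of ?q ?F "{0..int (e * d\<^sup>2)}"] q finF by auto
  define S where "S = ?q -` {\<rho>} \<inter> ?F"
  have S: "S \<subseteq> ?F" "\<And>s. s \<in> S \<Longrightarrow> ?q s = \<rho>" by (auto simp: S_def)
  have card: "d ^ e \<le> card S * (e * d\<^sup>2 + 1)"
    using \<rho> by (simp add: S_def card_PiE nat_add_distrib nat_mult_distrib nat_power_eq add.commute)
  have avg: "f j = s" if f: "\<And>j. j \<in> J \<Longrightarrow> f j \<in> S" and s: "s \<in> S"
    and cong: "\<And>a. a < e \<Longrightarrow> [(\<Sum>j\<in>J. f j a) = int (card J) * s a] (mod int p)" and j: "j \<in> J" for f s j
  proof -
    have rng: "0 \<le> t a" "t a < int d" if "t \<in> S" "a < e" for t a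
      using S(1) that by (auto simp: PiE_iff)
    have Jd: "int (card J) * int d \<le> int p" using p by (metis of_nat_le_iff of_nat_mult)
    have J0: "0 < int (card J)" using J by (simp add: card_gt_0_iff)
    have eq: "(\<Sum>j\<in>J. f j a) = int (card J) * s a" if a: "a < e" for a
    proof (rule cong_less_imp_eq_int)
      show "0 \<le> (\<Sum>j\<in>J. f j a)" using rng f a by (intro sum_nonneg) auto
      have "(\<Sum>j\<in>J. f j a) < (\<Sum>j\<in>J. int d)" using rng f a J by (intro sum_strict_mono) auto
      then show "(\<Sum>j\<in>J. f j a) < int p" using Jd by simp
      show "0 \<le> int (card J) * s a" using rng s a by simp
      have "int (card J) * s a < int (card J) * int d" using rng s a J0 by simp
      then show "int (card J) * s a < int p" using Jd by simp
    qed (rule cong[OF a])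
    \<comment> \<open>As all points have the same norm, the sum of their squared distances from their average vanishes.\<close>
    have "(\<Sum>j\<in>J. \<Sum>a<e. (f j a - s a)\<^sup>2)
        = (\<Sum>j\<in>J. ?q (f j)) - 2 * (\<Sum>a<e. (\<Sum>j\<in>J. f j a) * s a) + int (card J) * ?q s"
      by (simp add: power2_diff sum.distrib sum_subtractf sum_distrib_left sum_distrib_right
          sum.swap[of _ J] mult_ac)
    also have "(\<Sum>j\<in>J. ?q (f j)) = int (card J) * \<rho>" using S(2) f by simp
    also have "(\<Sum>a<e. (\<Sum>j\<in>J. f j a) * s a) = int (card J) * ?q s"
      by (simp add: eq sum_distrib_left power2_eq_square mult_ac)
    also have "?q s = \<rho>" using S(2) s .
    finally have "(\<Sum>j\<in>J. \<Sum>a<e. (f j a - s a)\<^sup>2) = 0" by simp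
    then have "\<forall>a<e. f j a = s a"
      using j J by (simp add: sum_nonneg_eq_0_iff sum_nonneg)
    then show "f j = s" using f[OF j] s S(1) by (intro PiE_ext[of _ "{..<e}"]) auto
  qed
  have "average_free J p e S"
    unfolding average_free_def
  proof (intro allI impI ballI)
    fix f s j
    assume "\<forall>j\<in>J. f j \<in> S" "s \<in> S"
      "\<forall>a<e. [(\<Sum>j\<in>J. f j a) = int (card J) * s a] (mod int p)" "j \<in> J"
    then show "f j = s" by (intro avg[of f s j]) simp_all
  qed
  then show ?thesis by (rule that[OF S(1) card])
qed

definition rat_vec :: "('k::finite \<Rightarrow> int) \<Rightarrow> rat ^ 'k"
  where "rat_vec x = (\<chi> i. rat_of_int (x i))"

lemma rat_vec_eq_iff [simp]: "rat_vec x = rat_vec y \<longleftrightarrow> x = y"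
  by (auto simp: rat_vec_def vec_eq_iff fun_eq_iff)

text \<open>
  Reduction modulo \<open>p\<close> maps the elements of \<open>A\<close> to distinct, linearly independent vectors.
\<close>

definition preserves_independence :: "nat \<Rightarrow> ('k::finite \<Rightarrow> int) set \<Rightarrow> bool"
  where "preserves_independence p A \<longleftrightarrow>
    (\<forall>w. (\<forall>i. int p dvd (\<Sum>x\<in>A. w x * x i)) \<longrightarrow> (\<forall>x\<in>A. int p dvd w x))"

lemma clear_denominators:
  fixes f :: "'k::finite \<Rightarrow> rat"
  shows "\<exists>m::nat. 0 < m \<and> (\<forall>i. \<exists>g. of_nat m * f i = of_int g)"
proof -
  have "\<exists>m::nat. 0 < m \<and> (\<forall>i\<in>I. \<exists>g. of_nat m * f i = of_int g)" if "finite I" for I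
    using that
  proof induction
    case (insert i I)
    then obtain m :: nat where m: "0 < m" "\<And>i. i \<in> I \<Longrightarrow> \<exists>g. of_nat m * f i = of_int g" by auto
    obtain a b where ab: "f i = of_int a / of_int b" "0 < b"
      by (metis quotient_of_div quotient_of_denom_pos surj_pair)
    have "\<exists>g. of_nat (m * nat b) * f j = of_int g" if j: "j \<in> insert i I" for j
    proof (cases "j = i")
      case True
      have "of_nat (m * nat b) * f j = of_int (int m * a)" using ab True by simp
      then show ?thesis by blast
    next
      case False
      then obtain g where "of_nat m * f j = of_int g" using m j by blast
      then have "of_nat (m * nat b) * f j = of_int (b * g)" using ab(2) by simp
      then show ?thesis by blast
    qed
    then show ?case using m(1) ab(2) by (intro exI[of _ "m * nat b"]) simp
  qed (auto intro: exI[of _ 1])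
  from this[of UNIV] show ?thesis by simp
qed

text \<open>
  A rational basis dual to \<open>A\<close> is defined over the integers up to a denominator \<open>m\<close>, and primes greater
  than \<open>m\<close> do not divide it.
\<close>

lemma large_prime_preserves_independence:
  fixes A :: "('k::finite \<Rightarrow> int) set"
  assumes fin: "finite A" and ind: "vec.independent (rat_vec ` A)"
  shows "\<exists>p0. \<forall>p>p0. prime p \<longrightarrow> preserves_independence p A"
proof -
  have "\<exists>m g. 0 < (m::nat) \<and> (\<forall>y\<in>A. (\<Sum>i\<in>UNIV. g i * y i) = (if y = x then int m else 0))" for x
  proof -
    let ?t = "\<lambda>v. if v = rat_vec x then (1 :: rat ^ 'k) else 0"
    obtain F :: "rat ^ 'k \<Rightarrow> rat ^ 'k" where F: "Vector_Spaces.linear (*s) (*s) F"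
      "\<And>v. v \<in> rat_vec ` A \<Longrightarrow> F v = ?t v"
      using vec.linear_independent_extend[OF ind, of ?t] by metis
    define i0 :: 'k where "i0 = undefined"
    define f where "f i = matrix F $ i0 $ i" for i
    have f: "(\<Sum>i\<in>UNIV. f i * rat_of_int (y i)) = (if y = x then 1 else 0)" if "y \<in> A" for y
    proof -
      have "(\<Sum>i\<in>UNIV. f i * rat_of_int (y i)) = (matrix F *v rat_vec y) $ i0"
        by (simp add: matrix_vector_mult_def f_def rat_vec_def)
      also have "\<dots> = F (rat_vec y) $ i0" by (simp add: matrix_works[OF F(1)])
      finally show ?thesis using that by (auto simp: F(2))
    qed
    obtain m :: nat where m: "0 < m" "\<forall>i. \<exists>g. of_nat m * f i = of_int g"
      using clear_denominators[of f] by auto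
    then obtain g where g: "\<And>i. of_nat m * f i = of_int (g i)" by metis
    have "(\<Sum>i\<in>UNIV. g i * y i) = (if y = x then int m else 0)" if "y \<in> A" for y
    proof -
      have "rat_of_int (\<Sum>i\<in>UNIV. g i * y i) = of_nat m * (\<Sum>i\<in>UNIV. f i * rat_of_int (y i))"
        by (simp add: sum_distrib_left g[symmetric] mult.assoc)
      also have "\<dots> = rat_of_int (if y = x then int m else 0)" using f[OF that] by simp
      finally show ?thesis by (simp only: of_int_eq_iff)
    qed
    then show ?thesis using m(1) by blast
  qed
  then obtain m g where m: "\<And>x. 0 < (m x :: nat)"
    and g: "\<And>x y. y \<in> A \<Longrightarrow> (\<Sum>i\<in>UNIV. g x i * y i) = (if y = x then int (m x) else 0)" by metis
  have "preserves_independence p A" if p: "prime p" "(\<Sum>x\<in>A. m x) < p" for p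
    unfolding preserves_independence_def
  proof (intro allI impI ballI)
    fix w x assume w: "\<forall>i. int p dvd (\<Sum>y\<in>A. w y * y i)" and x: "x \<in> A"
    have "(\<Sum>i\<in>UNIV. g x i * (\<Sum>y\<in>A. w y * y i)) = (\<Sum>y\<in>A. w y * (\<Sum>i\<in>UNIV. g x i * y i))"
      by (simp add: sum_distrib_left sum.swap[of _ A] mult_ac)
    also have "\<dots> = (\<Sum>y\<in>A. if y = x then w x * int (m x) else 0)"
      by (intro sum.cong) (auto simp: g)
    also have "\<dots> = w x * int (m x)" using fin x by simp
    finally have "int p dvd w x * int (m x)"
      using w by (metis (no_types, lifting) dvd_mult dvd_sum)
    moreover have "m x \<le> (\<Sum>x\<in>A. m x)" using fin x by (intro member_le_sum) auto
    then have "\<not> int p dvd int (m x)" using p m[of x] by (auto dest: nat_dvd_not_less simp: nat_dvd_not_less)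
    ultimately show "int p dvd w x"
      using p(1) by (meson prime_dvd_mult_iff prime_nat_int_transfer)
  qed
  then show ?thesis by blast
qed

lemma large_prime_preserves_independence_subsets:
  fixes D :: "('k::finite \<Rightarrow> int) set"
  assumes "finite D"
  shows "\<exists>p0. \<forall>p>p0. prime p \<longrightarrow> (\<forall>A\<subseteq>D. vec.independent (rat_vec ` A) \<longrightarrow> preserves_independence p A)"
proof -
  have "\<exists>p0. \<forall>p>p0. prime p \<longrightarrow> vec.independent (rat_vec ` A) \<longrightarrow> preserves_independence p A"
    if "A \<subseteq> D" for A
    using large_prime_preserves_independence[of A] finite_subset[OF that assms] by blast
  then obtain b where b: "\<And>A p. A \<subseteq> D \<Longrightarrow> b A < p \<Longrightarrow> prime p \<Longrightarrow>
      vec.independent (rat_vec ` A) \<Longrightarrow> preserves_independence p A" by metis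
  have "b A \<le> (\<Sum>A\<in>Pow D. b A)" if "A \<subseteq> D" for A
    using assms that by (intro member_le_sum) auto
  then show ?thesis using b by (intro exI[of _ "\<Sum>A\<in>Pow D. b A"]) (meson le_less_trans)
qed

text \<open>
  If the vectors \<open>c l\<close> with \<open>l \<in> L\<close> form a basis of the span, and are independent modulo \<open>p\<close>, then the
  other coordinates of an element of the kernel determine those in \<open>L\<close>.
\<close>

lemma card_kernel_mod_prime:
  fixes c :: "nat \<Rightarrow> 'k::finite \<Rightarrow> int"
  assumes good: "\<And>A. A \<subseteq> c ` {..<N} \<Longrightarrow> vec.independent (rat_vec ` A) \<Longrightarrow> preserves_independence p A"
  shows "card {w \<in> {..<N} \<rightarrow>\<^sub>E {0..<int p}. \<forall>i. int p dvd (\<Sum>l<N. c l i * w l)}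
    * p ^ vec.dim (rat_vec ` c ` {..<N}) \<le> p ^ N" (is "card ?K * p ^ ?r \<le> _")
proof -
  obtain B where B: "B \<subseteq> rat_vec ` c ` {..<N}" "vec.independent B" "card B = ?r"
    using vec.basis_exists[of "rat_vec ` c ` {..<N}"] by metis
  then have "B \<subseteq> (\<lambda>l. rat_vec (c l)) ` {..<N}" by (simp add: image_image)
  then obtain L where L: "L \<subseteq> {..<N}" "inj_on (\<lambda>l. rat_vec (c l)) L" "B = (\<lambda>l. rat_vec (c l)) ` L"
    by (auto simp: subset_image_inj)
  have finL: "finite L" using L(1) finite_subset by blast
  have cardL: "card L = ?r" using B(3) L card_image by metis
  have injL: "inj_on c L" using L(2) by (auto simp: inj_on_def)
  have "preserves_independence p (c ` L)"
    using L B by (intro good) (auto simp: image_image)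
  then have pres: "int p dvd w l" if "\<forall>i. int p dvd (\<Sum>l\<in>L. w l * c l i)" "l \<in> L" for w l
    unfolding preserves_independence_def using that injL
    by (auto simp: sum.reindex inv_into_f_f dest!: spec[of _ "\<lambda>x. w (inv_into L c x)"] cong: sum.cong)
  have "inj_on (\<lambda>w. restrict w ({..<N} - L)) ?K"
  proof (rule inj_onI)
    fix w w' assume w: "w \<in> ?K" and w': "w' \<in> ?K"
      and eq: "restrict w ({..<N} - L) = restrict w' ({..<N} - L)"
    have off: "w l = w' l" if "l \<in> {..<N} - L" for l using fun_cong[OF eq, of l] that by simp
    have "int p dvd (\<Sum>l\<in>L. (w l - w' l) * c l i)" for i
    proof -
      have "int p dvd (\<Sum>l<N. c l i * w l) - (\<Sum>l<N. c l i * w' l)" using w w' by (intro dvd_diff) auto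
      also have "(\<Sum>l<N. c l i * w l) - (\<Sum>l<N. c l i * w' l) = (\<Sum>l<N. (w l - w' l) * c l i)"
        by (simp add: sum_subtractf algebra_simps)
      also have "\<dots> = (\<Sum>l\<in>L. (w l - w' l) * c l i)"
        using L(1) off by (intro sum.mono_neutral_right) auto
      finally show ?thesis .
    qed
    then have dvd: "int p dvd w l - w' l" if "l \<in> L" for l using pres[of "\<lambda>l. w l - w' l"] that by blast
    have "w l = w' l" if l: "l \<in> L" for l
    proof -
      have "l < N" using L(1) l by auto
      then have "w l \<in> {0..<int p}" "w' l \<in> {0..<int p}" using w w' by (auto simp: PiE_iff)
      moreover have "[w l = w' l] (mod int p)" using dvd[OF l] by (simp add: cong_iff_dvd_diff)
      ultimately show ?thesis by (auto intro: cong_less_imp_eq_int)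
    qed
    then have "w l = w' l" if "l < N" for l using off that by (cases "l \<in> L") auto
    then show "w = w'" using w w' by (intro PiE_ext[of w "{..<N}"]) auto
  qed
  moreover have "(\<lambda>w. restrict w ({..<N} - L)) ` ?K \<subseteq> ({..<N} - L) \<rightarrow>\<^sub>E {0..<int p}"
    by (rule image_subsetI) (simp add: restrict_PiE_iff PiE_iff)
  ultimately have "card ?K \<le> card (({..<N} - L) \<rightarrow>\<^sub>E {0..<int p})"
    by (rule card_inj_on_le) (simp add: finite_PiE)
  also have "\<dots> = p ^ (N - ?r)"
    using L(1) finL cardL by (simp add: card_PiE card_Diff_subset)
  finally have "card ?K * p ^ ?r \<le> p ^ (N - ?r) * p ^ ?r" by simp
  moreover have "?r \<le> N" using cardL card_mono[OF _ L(1)] by simp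
  ultimately show ?thesis by (simp flip: power_add)
qed

section \<open>Hashing the words over a tight support\<close>

lemma sum_card_filter_swap:
  assumes "finite A" "finite B"
  shows "(\<Sum>x\<in>A. card {y \<in> B. P x y}) = (\<Sum>y\<in>B. card {x \<in> A. P x y})"
  by (rule sum_multicount_gen) (use assms in auto)

text \<open>
  The pairs of words that an isolated diagonal cannot both contain.
\<close>

definition collisions :: "('k \<Rightarrow> 'b) list set \<Rightarrow> (('k \<Rightarrow> 'b) list \<times> ('k \<Rightarrow> 'b) list) set"
  where "collisions \<Psi> = {(xs, ys) \<in> \<Psi> \<times> \<Psi>. xs \<noteq> ys \<and> (\<exists>i. leg i xs = leg i ys)}"

text \<open>
  The words have length \<open>N\<close>, and the hash values lie in \<open>F_p^e\<close>. The factor \<open>k0\<close> is distinguished: its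
  hash value is determined by those in the other factors \<open>J\<close>.
\<close>

locale tight_hash =
  fixes \<Phi> :: "('k::finite \<Rightarrow> 'b) set" and \<alpha> :: "'k \<Rightarrow> 'b \<Rightarrow> int" and k0 :: 'k
    and p e d N :: nat and S :: "(nat \<Rightarrow> int) set" and J :: "'k set"
  assumes J_def: "J = UNIV - {k0}"
    and finite_\<Phi>: "finite \<Phi>"
    and tight: "\<And>b. b \<in> \<Phi> \<Longrightarrow> (\<Sum>i\<in>UNIV. \<alpha> i (b i)) = 0"
    and J_nonempty: "J \<noteq> {}"
    and d_le_p: "d \<le> p" and p_pos: "0 < p"
    and S_box: "S \<subseteq> {..<e} \<rightarrow>\<^sub>E {0..<int d}"
    and average_free: "average_free J p e S"
begin

lemma average_freeD:
  "(\<And>j. j \<in> J \<Longrightarrow> f j \<in> S) \<Longrightarrow> s \<in> S \<Longrightarrow>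
    (\<And>a. a < e \<Longrightarrow> [(\<Sum>j\<in>J. f j a) = int (card J) * s a] (mod int p)) \<Longrightarrow> j \<in> J \<Longrightarrow> f j = s"
  using average_free unfolding average_free_def by blast

definition hash :: "(nat \<Rightarrow> nat \<Rightarrow> int) \<Rightarrow> 'k \<Rightarrow> 'b list \<Rightarrow> nat \<Rightarrow> int"
  where "hash v i bs a = (\<Sum>l<N. \<alpha> i (bs ! l) * v a l)"

text \<open>
  A seed of the hash function consists of a vector \<open>u j\<close> of \<open>F_p^e\<close> for each \<open>j\<close> in \<open>J\<close>, which makes the hash
  values in different factors independent, and of a vector of \<open>F_p^e\<close> for each of the \<open>N\<close> positions. The
  latter are stored as \<open>e\<close> vectors of length \<open>N\<close>, because each of them contributes independently to the
  probability that two words collide.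
\<close>

definition shifts :: "('k \<Rightarrow> nat \<Rightarrow> int) set"
  where "shifts = J \<rightarrow>\<^sub>E ({..<e} \<rightarrow>\<^sub>E {0..<int p})"

definition directions :: "(nat \<Rightarrow> nat \<Rightarrow> int) set"
  where "directions = {..<e} \<rightarrow>\<^sub>E ({..<N} \<rightarrow>\<^sub>E {0..<int p})"

text \<open>
  The sum of the hash values in the factors \<open>J\<close> is the value in \<open>k0\<close>. So the latter is compared with a
  multiple of an element of \<open>S\<close>, which avoids a division by \<open>card J\<close>.
\<close>

definition accepts :: "('k \<Rightarrow> nat \<Rightarrow> int) \<times> (nat \<Rightarrow> nat \<Rightarrow> int) \<Rightarrow> 'k \<Rightarrow> 'b list \<Rightarrow> bool"
  where "accepts = (\<lambda>(u, v) i bs. \<exists>s\<in>S. \<forall>a<e.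
    if i = k0 then [(\<Sum>j\<in>J. u j a) - hash v k0 bs a = int (card J) * s a] (mod int p)
    else [u i a + hash v i bs a = s a] (mod int p))"

definition survives :: "('k \<Rightarrow> nat \<Rightarrow> int) \<times> (nat \<Rightarrow> nat \<Rightarrow> int) \<Rightarrow> ('k \<Rightarrow> 'b) list \<Rightarrow> bool"
  where "survives \<omega> ys \<longleftrightarrow> (\<forall>i. accepts \<omega> i (leg i ys))"

definition common_value ::
  "('k \<Rightarrow> nat \<Rightarrow> int) \<times> (nat \<Rightarrow> nat \<Rightarrow> int) \<Rightarrow> ('k \<Rightarrow> 'b) list \<Rightarrow> (nat \<Rightarrow> int) \<Rightarrow> bool"
  where "common_value = (\<lambda>(u, v) ys s. s \<in> S \<and>
    (\<forall>j\<in>J. \<forall>a<e. [u j a + hash v j (leg j ys) a = s a] (mod int p)))"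

lemma finite_J [simp]: "finite J" and k0_notin_J [simp]: "k0 \<notin> J" and in_J_iff: "j \<in> J \<longleftrightarrow> j \<noteq> k0"
  by (auto simp: J_def)

lemma finite_S: "finite S"
  using S_box by (rule finite_subset) (simp add: finite_PiE)

text \<open>
  This is where tightness enters.
\<close>

lemma sum_hash:
  assumes "set ys \<subseteq> \<Phi>" "length ys = N"
  shows "(\<Sum>j\<in>J. hash v j (leg j ys) a) = - hash v k0 (leg k0 ys) a"
proof -
  have "(\<Sum>i\<in>UNIV. hash v i (leg i ys) a) = (\<Sum>l<N. (\<Sum>i\<in>UNIV. \<alpha> i ((ys ! l) i)) * v a l)"
    using assms(2) by (simp add: hash_def sum.swap[of _ UNIV] sum_distrib_right)
  also have "\<dots> = 0"
    using assms by (intro sum.neutral) (auto simp: tight subset_iff)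
  finally show ?thesis
    using sum.remove[of UNIV k0 "\<lambda>i. hash v i (leg i ys) a"] by (simp add: J_def)
qed

lemma common_value_sum:
  assumes ys: "set ys \<subseteq> \<Phi>" "length ys = N" and s: "common_value (u, v) ys s" and a: "a < e"
  shows "[(\<Sum>j\<in>J. u j a) - hash v k0 (leg k0 ys) a = int (card J) * s a] (mod int p)"
proof -
  have "[(\<Sum>j\<in>J. u j a + hash v j (leg j ys) a) = (\<Sum>j\<in>J. s a)] (mod int p)"
    using s a by (intro cong_sum) (auto simp: common_value_def)
  then show ?thesis by (simp add: sum.distrib sum_hash[OF ys])
qed

text \<open>
  Acceptance of the legs in \<open>J\<close> gives elements of \<open>S\<close>, and acceptance of the leg in \<open>k0\<close> says that an
  element of \<open>S\<close> is their average; so they coincide.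
\<close>

lemma survives_iff:
  assumes ys: "set ys \<subseteq> \<Phi>" "length ys = N"
  shows "survives \<omega> ys \<longleftrightarrow> (\<exists>s. common_value \<omega> ys s)"
proof
  obtain u v where \<omega>: "\<omega> = (u, v)" by (cases \<omega>)
  {
    assume surv: "survives \<omega> ys"
    have "\<forall>j. \<exists>s\<in>S. \<forall>a<e. if j = k0 then
        [(\<Sum>j\<in>J. u j a) - hash v k0 (leg k0 ys) a = int (card J) * s a] (mod int p)
        else [u j a + hash v j (leg j ys) a = s a] (mod int p)"
      using surv unfolding survives_def accepts_def \<omega> by (auto cong: if_cong)
    then obtain f where f: "\<And>j. f j \<in> S"
      "\<And>j a. a < e \<Longrightarrow> if j = k0 then
        [(\<Sum>j\<in>J. u j a) - hash v k0 (leg k0 ys) a = int (card J) * f j a] (mod int p)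
        else [u j a + hash v j (leg j ys) a = f j a] (mod int p)"
      by metis
    have fJ: "[u j a + hash v j (leg j ys) a = f j a] (mod int p)" if "a < e" "j \<in> J" for j a
      using f(2)[OF that(1), of j] that(2) by (simp add: in_J_iff)
    have "[(\<Sum>j\<in>J. f j a) = int (card J) * f k0 a] (mod int p)" if "a < e" for a
    proof -
      have "[(\<Sum>j\<in>J. u j a + hash v j (leg j ys) a) = (\<Sum>j\<in>J. f j a)] (mod int p)"
        using fJ[OF that] by (intro cong_sum)
      then have "[(\<Sum>j\<in>J. f j a) = (\<Sum>j\<in>J. u j a) - hash v k0 (leg k0 ys) a] (mod int p)"
        by (simp add: sum.distrib sum_hash[OF ys] cong_sym)
      moreover have "[(\<Sum>j\<in>J. u j a) - hash v k0 (leg k0 ys) a = int (card J) * f k0 a] (mod int p)"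
        using f(2)[OF that, of k0] by simp
      ultimately show ?thesis by (rule cong_trans)
    qed
    then have "f j = f k0" if "j \<in> J" for j using average_freeD[of f "f k0"] f(1) that by blast
    then have "common_value \<omega> ys (f k0)" using f(1) fJ by (auto simp: common_value_def \<omega>)
    then show "\<exists>s. common_value \<omega> ys s" by (rule exI[of _ "f k0"])
  }
  {
    assume "\<exists>s. common_value \<omega> ys s"
    then obtain s where s: "common_value (u, v) ys s" by (auto simp: \<omega>)
    have "accepts (u, v) i (leg i ys)" for i
    proof (cases "i = k0")
      case True
      then show ?thesis
        using common_value_sum[OF ys s] s unfolding accepts_def by (auto simp: common_value_def)
    next
      case False
      then have "i \<in> J" by (simp add: in_J_iff)
      then show ?thesis using s False unfolding accepts_def by (auto simp: common_value_def)
    qed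
    then show "survives \<omega> ys" by (simp add: survives_def \<omega>)
  }
qed

lemma box_eqI:
  assumes "f \<in> {..<e} \<rightarrow>\<^sub>E {0..<int p}" "g \<in> {..<e} \<rightarrow>\<^sub>E {0..<int p}"
    and "\<And>a. a < e \<Longrightarrow> [f a = g a] (mod int p)"
  shows "f = g"
proof (rule PiE_ext[OF assms(1,2)])
  fix a assume "a \<in> {..<e}"
  then show "f a = g a" using assms by (intro cong_less_imp_eq_int[of _ "int p"]) (auto simp: PiE_iff)
qed

lemma S_box': "S \<subseteq> {..<e} \<rightarrow>\<^sub>E {0..<int p}"
proof -
  have "{0..<int d} \<subseteq> {0..<int p}" using d_le_p by auto
  then show ?thesis using S_box PiE_mono by blast
qed

lemma finite_seeds: "finite shifts" "finite directions"
  by (auto simp: shifts_def directions_def finite_PiE)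

lemma card_shifts: "card shifts = p ^ (e * card J)"
  by (simp add: shifts_def card_PiE power_mult)

lemma card_directions: "card directions = p ^ (e * N)"
  by (simp add: directions_def card_PiE power_mult mult.commute[of e])

text \<open>
  For every element \<open>s\<close> of \<open>S\<close> and every choice of directions there are shifts with which all legs hash
  to \<open>s\<close>.
\<close>

lemma card_survives_ge:
  assumes ys: "set ys \<subseteq> \<Phi>" "length ys = N"
  shows "card S * p ^ (e * N) \<le> card {\<omega> \<in> shifts \<times> directions. survives \<omega> ys}"
proof -
  let ?f = "\<lambda>(s, v). (\<lambda>j\<in>J. \<lambda>a\<in>{..<e}. (s a - hash v j (leg j ys) a) mod int p, v)"
  have "inj_on ?f (S \<times> directions)"
  proof (rule inj_onI)
    fix z z' assume z: "z \<in> S \<times> directions" "z' \<in> S \<times> directions" "?f z = ?f z'"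
    obtain s v s' v' where sv: "z = (s, v)" "z' = (s', v')" by (cases z, cases z') blast
    have s: "s \<in> S" "s' \<in> S" and vv: "v = v'" and eq:
      "(\<lambda>j\<in>J. \<lambda>a\<in>{..<e}. (s a - hash v' j (leg j ys) a) mod int p)
        = (\<lambda>j\<in>J. \<lambda>a\<in>{..<e}. (s' a - hash v' j (leg j ys) a) mod int p)"
      using z unfolding sv by auto
    obtain j where j: "j \<in> J" using J_nonempty by blast
    have "[s a = s' a] (mod int p)" if a: "a < e" for a
    proof -
      have "[s a - hash v' j (leg j ys) a = s' a - hash v' j (leg j ys) a] (mod int p)"
        using fun_cong[OF fun_cong[OF eq, of j], of a] a j by (simp add: cong_def)
      then show ?thesis by (metis cong_add_rcancel diff_add_cancel cong_add cong_refl)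
    qed
    then have "s = s'" using s S_box' by (intro box_eqI) auto
    then show "z = z'" using vv by (simp add: sv)
  qed
  moreover have "?f ` (S \<times> directions) \<subseteq> {\<omega> \<in> shifts \<times> directions. survives \<omega> ys}"
  proof (rule image_subsetI)
    fix z assume "z \<in> S \<times> directions"
    then obtain s v where z: "z = (s, v)" and s: "s \<in> S" and v: "v \<in> directions" by auto
    have "(\<lambda>j\<in>J. \<lambda>a\<in>{..<e}. (s a - hash v j (leg j ys) a) mod int p, v) \<in> shifts \<times> directions"
      using v p_pos by (auto simp: shifts_def)
    moreover have "common_value (\<lambda>j\<in>J. \<lambda>a\<in>{..<e}. (s a - hash v j (leg j ys) a) mod int p, v) ys s"
      using s by (simp add: common_value_def cong_def mod_simps)
    then have "survives (\<lambda>j\<in>J. \<lambda>a\<in>{..<e}. (s a - hash v j (leg j ys) a) mod int p, v) ys"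
      unfolding survives_iff[OF ys] by (rule exI[of _ s])
    ultimately show "?f z \<in> {\<omega> \<in> shifts \<times> directions. survives \<omega> ys}" by (simp add: z)
  qed
  ultimately have "card (S \<times> directions) \<le> card {\<omega> \<in> shifts \<times> directions. survives \<omega> ys}"
    using finite_seeds by (intro card_inj_on_le) auto
  then show ?thesis by (simp add: card_cartesian_product card_directions)
qed

definition difference :: "('k \<Rightarrow> 'b) \<times> ('k \<Rightarrow> 'b) \<Rightarrow> 'k \<Rightarrow> int"
  where "difference = (\<lambda>(x, y) i. \<alpha> i (x i) - \<alpha> i (y i))"

lemma relation_rank_eq: "relation_rank \<alpha> R = vec.dim (rat_vec ` difference ` R)"
proof -
  have "(\<lambda>(x, y). (\<chi> i. rat_of_int (\<alpha> i (x i) - \<alpha> i (y i))) :: rat ^ 'k) ` R = rat_vec ` difference ` R"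
    by (auto simp: image_image rat_vec_def difference_def split_beta)
  then show ?thesis by (simp add: relation_rank_def)
qed

text \<open>
  If both words survive, the shared leg forces their common values to be equal. The directions then
  are orthogonal, modulo \<open>p\<close>, to the differences of the letters of the two words, and the shifts are
  determined by the common value and the directions.
\<close>

lemma card_survives_pair_le:
  assumes xs: "set xs \<subseteq> \<Phi>" "length xs = N" and ys: "set ys \<subseteq> \<Phi>" "length ys = N"
    and i: "leg i xs = leg i ys"
    and good: "\<And>A. A \<subseteq> difference ` (\<Phi> \<times> \<Phi>) \<Longrightarrow> vec.independent (rat_vec ` A) \<Longrightarrow>
      preserves_independence p A"
  shows "card {\<omega> \<in> shifts \<times> directions. survives \<omega> xs \<and> survives \<omega> ys}
    * (p ^ e) ^ relation_rank \<alpha> (set (zip xs ys)) \<le> card S * p ^ (e * N)"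
proof -
  define c where "c l = difference (xs ! l, ys ! l)" for l
  let ?r = "relation_rank \<alpha> (set (zip xs ys))"
  define K where "K = {w \<in> {..<N} \<rightarrow>\<^sub>E {0..<int p}. \<forall>i. int p dvd (\<Sum>l<N. c l i * w l)}"
  let ?W = "{\<omega> \<in> shifts \<times> directions. survives \<omega> xs \<and> survives \<omega> ys}"
  have zip: "set (zip xs ys) = (\<lambda>l. (xs ! l, ys ! l)) ` {..<N}"
    using xs(2) ys(2) by (auto simp: set_zip)
  have c_img: "c ` {..<N} = difference ` set (zip xs ys)" by (simp add: c_def zip image_image)
  also have "set (zip xs ys) \<subseteq> \<Phi> \<times> \<Phi>"
    using xs(1) ys(1) by (auto dest: set_zip_leftD set_zip_rightD)
  then have "difference ` set (zip xs ys) \<subseteq> difference ` (\<Phi> \<times> \<Phi>)" by (rule image_mono)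
  finally have "card K * p ^ vec.dim (rat_vec ` c ` {..<N}) \<le> p ^ N"
    unfolding K_def by (intro card_kernel_mod_prime good) auto
  then have K: "card K * p ^ ?r \<le> p ^ N" by (simp add: c_img relation_rank_eq)
  have "K \<subseteq> {..<N} \<rightarrow>\<^sub>E {0..<int p}" by (auto simp: K_def)
  then have finK: "finite K" by (rule finite_subset) (simp add: finite_PiE)
  \<comment> \<open>A surviving seed is determined by the common value of \<open>xs\<close> and its directions.\<close>
  define t where "t \<omega> = (SOME s. common_value \<omega> xs s)" for \<omega>
  have t: "common_value \<omega> xs (t \<omega>)" if "survives \<omega> xs" for \<omega>
    using that unfolding t_def survives_iff[OF xs] by (rule someI_ex)
  have "card ?W \<le> card (S \<times> ({..<e} \<rightarrow>\<^sub>E K))"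
  proof (rule card_inj_on_le)
    show "inj_on (\<lambda>\<omega>. (t \<omega>, snd \<omega>)) ?W"
    proof (rule inj_onI)
      fix \<omega> \<omega>' assume \<omega>: "\<omega> \<in> ?W" and \<omega>': "\<omega>' \<in> ?W" and eq: "(t \<omega>, snd \<omega>) = (t \<omega>', snd \<omega>')"
      obtain u u' v where uv: "\<omega> = (u, v)" "\<omega>' = (u', v)" using eq by (cases \<omega>; cases \<omega>') auto
      have cv: "common_value (u, v) xs (t \<omega>)" "common_value (u', v) xs (t \<omega>)"
        using t[of \<omega>] t[of \<omega>'] \<omega> \<omega>' eq uv by auto
      have "u j = u' j" if j: "j \<in> J" for j
      proof (rule box_eqI)
        show "u j \<in> {..<e} \<rightarrow>\<^sub>E {0..<int p}" "u' j \<in> {..<e} \<rightarrow>\<^sub>E {0..<int p}"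
          using \<omega> \<omega>' uv j by (auto simp: shifts_def)
        fix a assume a: "a < e"
        have "[u j a + hash v j (leg j xs) a = u' j a + hash v j (leg j xs) a] (mod int p)"
          using cv a j by (simp add: common_value_def cong_def)
        then show "[u j a = u' j a] (mod int p)" by (simp add: cong_add_rcancel)
      qed
      then have "u = u'" using \<omega> \<omega>' uv by (intro PiE_ext[of u J _ u']) (auto simp: shifts_def)
      then show "\<omega> = \<omega>'" using uv by simp
    qed
    show "(\<lambda>\<omega>. (t \<omega>, snd \<omega>)) ` ?W \<subseteq> S \<times> ({..<e} \<rightarrow>\<^sub>E K)"
    proof (rule image_subsetI)
      fix \<omega> assume \<omega>: "\<omega> \<in> ?W"
      obtain u v where uv: "\<omega> = (u, v)" by (cases \<omega>)
      have x: "common_value (u, v) xs (t \<omega>)" using t \<omega> uv by auto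
      from \<omega> obtain s where y: "common_value (u, v) ys s" unfolding survives_iff[OF ys] uv by blast
      have S: "t \<omega> \<in> S" "s \<in> S" using x y by (auto simp: common_value_def)
      \<comment> \<open>The shared leg forces both words to hash to the same element.\<close>
      have s_eq: "t \<omega> = s"
      proof (cases "i = k0")
        case True
        have "[(\<Sum>j\<in>J. t \<omega> a) = int (card J) * s a] (mod int p)" if "a < e" for a
          using cong_trans[OF cong_sym[OF common_value_sum[OF xs x that]]] common_value_sum[OF ys y that]
            i True by simp
        then show ?thesis using average_freeD[of "\<lambda>_. t \<omega>" s] S J_nonempty by blast
      next
        case False
        then have j: "i \<in> J" by (simp add: in_J_iff)
        have "[t \<omega> a = s a] (mod int p)" if a: "a < e" for a
        proof -
          have "[u i a + hash v i (leg i xs) a = t \<omega> a] (mod int p)"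
            using x j a by (auto simp: common_value_def)
          moreover have "[u i a + hash v i (leg i xs) a = s a] (mod int p)"
            using y j a by (auto simp: common_value_def i)
          ultimately show ?thesis by (blast intro: cong_trans cong_sym)
        qed
        then show ?thesis using S S_box' by (intro box_eqI) auto
      qed
      have hJ: "[hash v j (leg j xs) a = hash v j (leg j ys) a] (mod int p)" if "j \<in> J" "a < e" for j a
      proof -
        have "[u j a + hash v j (leg j xs) a = u j a + hash v j (leg j ys) a] (mod int p)"
          using x y that unfolding common_value_def s_eq by (simp add: cong_def)
        then show ?thesis by (simp add: cong_add_lcancel)
      qed
      have "[(\<Sum>j\<in>J. hash v j (leg j xs) a) = (\<Sum>j\<in>J. hash v j (leg j ys) a)] (mod int p)"
        if "a < e" for a using hJ that by (intro cong_sum) auto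
      then have hk0: "[hash v k0 (leg k0 xs) a = hash v k0 (leg k0 ys) a] (mod int p)" if "a < e" for a
        using that by (simp add: sum_hash[OF xs] sum_hash[OF ys] cong_minus_minus_iff)
      have "v a \<in> K" if a: "a < e" for a
      proof -
        have "int p dvd (\<Sum>l<N. c l j * v a l)" for j
        proof -
          have "[hash v j (leg j xs) a = hash v j (leg j ys) a] (mod int p)"
            using hJ hk0 a by (cases "j = k0") (auto simp: in_J_iff)
          then have "int p dvd hash v j (leg j xs) a - hash v j (leg j ys) a"
            by (simp add: cong_iff_dvd_diff)
          also have "hash v j (leg j xs) a - hash v j (leg j ys) a = (\<Sum>l<N. c l j * v a l)"
            using xs(2) ys(2)
            by (simp add: hash_def c_def difference_def sum_subtractf left_diff_distrib)
          finally show ?thesis .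
        qed
        moreover have "v a \<in> {..<N} \<rightarrow>\<^sub>E {0..<int p}" using \<omega> uv a by (auto simp: directions_def)
        ultimately show ?thesis by (simp add: K_def)
      qed
      moreover have "v \<in> extensional {..<e}" using \<omega> uv by (auto simp: directions_def PiE_iff)
      ultimately show "(t \<omega>, snd \<omega>) \<in> S \<times> ({..<e} \<rightarrow>\<^sub>E K)" using S uv by (auto simp: PiE_iff)
    qed
    show "finite (S \<times> ({..<e} \<rightarrow>\<^sub>E K))" using finite_S finK by (intro finite_cartesian_product finite_PiE) auto
  qed
  also have "\<dots> = card S * card K ^ e" by (simp add: card_cartesian_product card_PiE)
  finally have "card ?W * (p ^ e) ^ ?r \<le> card S * card K ^ e * (p ^ e) ^ ?r" by (rule mult_le_mono1)
  also have "\<dots> = card S * (card K * p ^ ?r) ^ e"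
    by (simp add: power_mult_distrib power_commutes mult.commute flip: power_mult)
  also have "\<dots> \<le> card S * (p ^ N) ^ e" by (intro mult_le_mono2 power_mono K) simp
  finally show ?thesis by (simp add: mult.commute flip: power_mult)
qed

text \<open>
  By the two counts above, some seed makes the number of surviving words minus the number of surviving
  collisions at least average. Discard all surviving words that collide with a surviving word; it does
  not suffice to keep one word of each collision, since words that are removed must not reappear when
  legs of the remaining words are combined.
\<close>

lemma exists_isolated_family:
  fixes \<Psi> :: "('k \<Rightarrow> 'b) list set"
  assumes \<Psi>: "\<And>ys. ys \<in> \<Psi> \<Longrightarrow> set ys \<subseteq> \<Phi> \<and> length ys = N"
    and good: "\<And>A. A \<subseteq> difference ` (\<Phi> \<times> \<Phi>) \<Longrightarrow> vec.independent (rat_vec ` A) \<Longrightarrow>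
      preserves_independence p A"
  obtains X where "X \<subseteq> \<Psi>"
    "\<forall>xs\<in>X. \<forall>ys\<in>\<Psi>. (\<forall>i. leg i ys \<in> leg i ` X) \<longrightarrow> (\<exists>i. leg i xs = leg i ys) \<longrightarrow> ys = xs"
    "card S / real p ^ (e * card J) * (card \<Psi> -
      (\<Sum>z\<in>collisions \<Psi>. 1 / (real p ^ e) ^ relation_rank \<alpha> (set (zip (fst z) (snd z))))) \<le> card X"
proof -
  define C where "C = collisions \<Psi>"
  note C_def = C_def[unfolded collisions_def]
  let ?\<Omega> = "shifts \<times> directions"
  have fin\<Omega>: "finite ?\<Omega>" using finite_seeds by simp
  have fin\<Psi>: "finite \<Psi>"
    by (rule finite_subset[OF _ finite_lists_length_eq[OF finite_\<Phi>, of N]]) (use \<Psi> in auto)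
  have "C \<subseteq> \<Psi> \<times> \<Psi>" by (auto simp: C_def)
  then have finC: "finite C" using fin\<Psi> by (meson finite_SigmaI finite_subset)
  let ?P = "\<lambda>\<omega>. {ys \<in> \<Psi>. survives \<omega> ys}"
  let ?C = "\<lambda>\<omega>. {z \<in> C. survives \<omega> (fst z) \<and> survives \<omega> (snd z)}"
  let ?rk = "\<lambda>z :: ('k \<Rightarrow> 'b) list \<times> ('k \<Rightarrow> 'b) list. relation_rank \<alpha> (set (zip (fst z) (snd z)))"
  let ?b = "real (card S) * (card \<Psi> - (\<Sum>z\<in>C. 1 / (real p ^ e) ^ ?rk z)) / real p ^ (e * card J)"
  have pe: "0 < real p ^ n" for n using p_pos by simp
  have P: "real (card S) * real p ^ (e * N) * card \<Psi> \<le> (\<Sum>\<omega>\<in>?\<Omega>. real (card (?P \<omega>)))"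
  proof -
    have "card \<Psi> * (card S * p ^ (e * N)) \<le> (\<Sum>ys\<in>\<Psi>. card {\<omega> \<in> ?\<Omega>. survives \<omega> ys})"
      using sum_bounded_below[of \<Psi> "card S * p ^ (e * N)" "\<lambda>ys. card {\<omega> \<in> ?\<Omega>. survives \<omega> ys}"]
        card_survives_ge \<Psi> by simp
    also have "\<dots> = (\<Sum>\<omega>\<in>?\<Omega>. card (?P \<omega>))"
      by (rule sum_card_filter_swap[OF fin\<Psi> fin\<Omega>])
    finally have "real (card \<Psi> * (card S * p ^ (e * N))) \<le> real (\<Sum>\<omega>\<in>?\<Omega>. card (?P \<omega>))"
      by (simp only: of_nat_le_iff)
    then show ?thesis by (simp add: mult_ac)
  qed
  have Cle: "(\<Sum>\<omega>\<in>?\<Omega>. real (card (?C \<omega>)))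
      \<le> real (card S) * real p ^ (e * N) * (\<Sum>z\<in>C. 1 / (real p ^ e) ^ ?rk z)"
  proof -
    have "real (card {\<omega> \<in> ?\<Omega>. survives \<omega> (fst z) \<and> survives \<omega> (snd z)})
        \<le> real (card S) * real p ^ (e * N) * (1 / (real p ^ e) ^ ?rk z)" if z: "z \<in> C" for z
    proof -
      obtain xs ys where xy: "z = (xs, ys)" by (cases z)
      obtain i where "leg i xs = leg i ys" "xs \<in> \<Psi>" "ys \<in> \<Psi>" using z xy by (auto simp: C_def)
      then have "card {\<omega> \<in> ?\<Omega>. survives \<omega> xs \<and> survives \<omega> ys} * (p ^ e) ^ ?rk z \<le> card S * p ^ (e * N)"
        using card_survives_pair_le[OF _ _ _ _ _ good, of xs ys i] \<Psi> xy by simp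
      then have "real (card {\<omega> \<in> ?\<Omega>. survives \<omega> xs \<and> survives \<omega> ys} * (p ^ e) ^ ?rk z)
          \<le> real (card S * p ^ (e * N))" by (simp only: of_nat_le_iff)
      then show ?thesis using pe[of e] xy by (simp add: pos_le_divide_eq)
    qed
    then have "(\<Sum>z\<in>C. real (card {\<omega> \<in> ?\<Omega>. survives \<omega> (fst z) \<and> survives \<omega> (snd z)}))
        \<le> (\<Sum>z\<in>C. real (card S) * real p ^ (e * N) * (1 / (real p ^ e) ^ ?rk z))"
      by (rule sum_mono)
    also have "\<dots> = real (card S) * real p ^ (e * N) * (\<Sum>z\<in>C. 1 / (real p ^ e) ^ ?rk z)"
      by (rule sum_distrib_left[symmetric])
    also have "(\<Sum>z\<in>C. real (card {\<omega> \<in> ?\<Omega>. survives \<omega> (fst z) \<and> survives \<omega> (snd z)}))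
        = (\<Sum>\<omega>\<in>?\<Omega>. real (card (?C \<omega>)))"
      using arg_cong[OF sum_card_filter_swap[OF finC fin\<Omega>,
          of "\<lambda>z \<omega>. survives \<omega> (fst z) \<and> survives \<omega> (snd z)"], of real]
      by (simp only: of_nat_sum)
    finally show ?thesis .
  qed
  have "\<exists>\<omega>\<in>?\<Omega>. ?b \<le> real (card (?P \<omega>)) - real (card (?C \<omega>))"
  proof (rule ccontr)
    assume "\<not> ?thesis"
    then have lt: "real (card (?P \<omega>)) - real (card (?C \<omega>)) < ?b" if "\<omega> \<in> ?\<Omega>" for \<omega>
      using that by force
    have "?\<Omega> \<noteq> {}"
      using p_pos card_shifts card_directions by (metis card.empty mult_eq_0_iff card_cartesian_product power_not_zero gr_implies_not0)
    then have "(\<Sum>\<omega>\<in>?\<Omega>. real (card (?P \<omega>)) - real (card (?C \<omega>))) < (\<Sum>\<omega>\<in>?\<Omega>. ?b)"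
      using fin\<Omega> lt by (intro sum_strict_mono)
    also have "(\<Sum>\<omega>\<in>?\<Omega>. ?b) = real (card ?\<Omega>) * ?b" by simp
    also have "\<dots> = real (card S) * real p ^ (e * N) * (card \<Psi> - (\<Sum>z\<in>C. 1 / (real p ^ e) ^ ?rk z))"
      using p_pos by (simp add: card_cartesian_product card_shifts card_directions)
    finally show False using P Cle by (simp add: sum_subtractf right_diff_distrib)
  qed
  then obtain \<omega> where \<omega>: "?b \<le> real (card (?P \<omega>)) - real (card (?C \<omega>))" by blast
  define X where "X = ?P \<omega> - fst ` ?C \<omega>"
  have finCw: "finite (?C \<omega>)" using finC by simp
  have "card (?P \<omega>) - card (?C \<omega>) \<le> card X"
  proof -
    have "card (?P \<omega>) - card (fst ` ?C \<omega>) \<le> card X"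
      unfolding X_def using finCw by (intro diff_card_le_card_Diff) simp
    moreover have "card (fst ` ?C \<omega>) \<le> card (?C \<omega>)" using finCw by (rule card_image_le)
    ultimately show ?thesis by linarith
  qed
  then have card: "?b \<le> real (card X)" using \<omega> by linarith
  show ?thesis
  proof (rule that[of X])
    show "X \<subseteq> \<Psi>" by (auto simp: X_def)
    show "\<forall>xs\<in>X. \<forall>ys\<in>\<Psi>. (\<forall>i. leg i ys \<in> leg i ` X) \<longrightarrow> (\<exists>i. leg i xs = leg i ys) \<longrightarrow> ys = xs"
    proof (intro ballI impI, rule ccontr)
      fix xs ys assume xs: "xs \<in> X" and ys: "ys \<in> \<Psi>" "\<forall>i. leg i ys \<in> leg i ` X"
        and i: "\<exists>i. leg i xs = leg i ys" and ne: "ys \<noteq> xs"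
      have "accepts \<omega> i (leg i ys)" for i
      proof -
        obtain z where "z \<in> X" "leg i ys = leg i z" using ys(2) by blast
        then show ?thesis by (auto simp: X_def survives_def)
      qed
      then have "(xs, ys) \<in> ?C \<omega>"
        using xs ys i ne by (auto simp: X_def C_def survives_def)
      then have "xs \<in> fst ` ?C \<omega>" by (metis (no_types, lifting) fst_conv imageI)
      then show False using xs by (simp add: X_def)
    qed
    show "card S / real p ^ (e * card J) * (card \<Psi> -
      (\<Sum>z\<in>collisions \<Psi>. 1 / (real p ^ e) ^ relation_rank \<alpha> (set (zip (fst z) (snd z))))) \<le> card X"
      using card by (simp add: C_def collisions_def)
  qed
qed

end

section \<open>Large isolated diagonals\<close>

text \<open>
  Otherwise a limit point of the joint types violating the bound would be a coupling of the marginals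
  of \<open>P\<close> on \<open>R\<close> with entropy greater than \<open>h\<close>.
\<close>

lemma joint_type_entropy_le:
  fixes \<Phi> :: "('k::finite \<Rightarrow> 'b) set" and P :: "('k \<Rightarrow> 'b) pmf" and M :: "nat \<Rightarrow> ('k \<Rightarrow> 'b) multiset"
  assumes \<Phi>: "finite \<Phi>" "set_pmf P \<subseteq> \<Phi>"
    and M: "\<And>n. size (M n) = n" "\<And>n. set_mset (M n) \<subseteq> \<Phi>"
      "\<And>x. (\<lambda>n. real (count (M n) x) / n) \<longlonglongrightarrow> pmf P x"
    and R: "R \<subseteq> \<Phi> \<times> \<Phi>"
    and h: "\<forall>Q\<in>couplings (\<lambda>i. marginal i P) R. shannon_entropy Q \<le> h"
    and \<epsilon>: "0 < \<epsilon>"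
  shows "\<forall>\<^sub>F n in sequentially. \<forall>zs. length zs = n \<longrightarrow> set zs \<subseteq> R \<longrightarrow>
    (\<forall>i. image_mset (\<lambda>z. fst z i) (mset zs) = image_mset (\<lambda>y. y i) (M n) \<and>
         image_mset (\<lambda>z. snd z i) (mset zs) = image_mset (\<lambda>y. y i) (M n)) \<longrightarrow>
    shannon_entropy (pmf_of_multiset (mset zs)) \<le> h + \<epsilon>"
proof (rule ccontr)
  define bad where "bad n zs \<longleftrightarrow> length zs = n \<and> set zs \<subseteq> R \<and>
    (\<forall>i. image_mset (\<lambda>z. fst z i) (mset zs) = image_mset (\<lambda>y. y i) (M n) \<and>
         image_mset (\<lambda>z. snd z i) (mset zs) = image_mset (\<lambda>y. y i) (M n)) \<and>
    h + \<epsilon> < shannon_entropy (pmf_of_multiset (mset zs))" for n zs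
  assume "\<not> ?thesis"
  then have "\<exists>\<^sub>F n in sequentially. \<exists>zs. bad n zs"
    unfolding not_eventually bad_def by (rule frequently_elim1) (auto simp: not_le)
  then have "\<exists>\<^sub>F n in sequentially. 0 < n \<and> (\<exists>zs. bad n zs)"
    using eventually_gt_at_top[of 0] by (rule frequently_eventually_conj)
  then have "infinite {n. 0 < n \<and> (\<exists>zs. bad n zs)}"
    by (simp add: cofinite_eq_sequentially[symmetric] frequently_cofinite)
  then obtain s :: "nat \<Rightarrow> nat" where s: "strict_mono s" "\<And>n. 0 < s n \<and> (\<exists>zs. bad (s n) zs)"
    by (auto dest!: infinite_enumerate)
  then obtain zs where "\<And>n. bad (s n) (zs n)" by metis
  note zs = this[unfolded bad_def]
  have finR: "finite R" using R \<Phi>(1) by (meson finite_SigmaI finite_subset)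
  have ne: "mset (zs n) \<noteq> {#}" "M (s n) \<noteq> {#}" for n
    using zs[of n] s(2)[of n] M(1)[of "s n"] by auto
  define Q where "Q n = pmf_of_multiset (mset (zs n))" for n
  have setQ: "set_pmf (Q n) \<subseteq> R" for n using zs[of n] ne by (simp add: Q_def)
  obtain r Q' where r: "strict_mono r" and Q': "set_pmf Q' \<subseteq> R"
    "\<And>x. (\<lambda>n. pmf (Q (r n)) x) \<longlonglongrightarrow> pmf Q' x"
  proof (rule pmf_convergent_subsequence[where Q = Q, OF finR setQ])
    fix r Q' assume lim: "strict_mono r" "set_pmf Q' \<subseteq> R" "\<And>x. (\<lambda>n. pmf (Q (r n)) x) \<longlonglongrightarrow> pmf Q' x"
    show thesis by (rule that[OF lim])
  qed
  have sr: "filterlim (\<lambda>n. s (r n)) at_top sequentially"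
    using strict_mono_o[OF s(1) r] by (simp add: o_def filterlim_subseq)
  have limM: "(\<lambda>n. pmf (pmf_of_multiset (M (s (r n)))) x) \<longlonglongrightarrow> pmf P x" for x
    using filterlim_compose[OF M(3)[of x] sr] ne M(1) by simp
  have setM: "set_pmf (pmf_of_multiset (M (s (r n)))) \<subseteq> \<Phi>" for n using ne M(2) by simp
  have marg: "map_pmf f Q' = marginal i P"
    if "\<And>n. image_mset f (mset (zs n)) = image_mset (\<lambda>y. y i) (M (s n))" for f i
  proof (rule pmf_eqI)
    fix y
    have "pmf (map_pmf f (Q (r n))) y = pmf (map_pmf (\<lambda>y. y i) (pmf_of_multiset (M (s (r n))))) y" for n
      using ne by (simp only: Q_def map_pmf_of_multiset that not_False_eq_True)
    moreover have "(\<lambda>n. pmf (map_pmf f (Q (r n))) y) \<longlonglongrightarrow> pmf (map_pmf f Q') y"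
      by (rule pmf_map_tendsto[OF finR setQ Q'])
    moreover have "(\<lambda>n. pmf (map_pmf (\<lambda>y. y i) (pmf_of_multiset (M (s (r n))))) y)
        \<longlonglongrightarrow> pmf (map_pmf (\<lambda>y. y i) P) y"
      by (rule pmf_map_tendsto[OF \<Phi>(1) setM \<Phi>(2) limM])
    ultimately show "pmf (map_pmf f Q') y = pmf (marginal i P) y"
      unfolding marginal_def by (simp only: LIMSEQ_unique)
  qed
  have "Q' \<in> couplings (\<lambda>i. marginal i P) R"
    using Q'(1) zs
    by (auto simp: couplings_def distributions_on_def marginal_def[of _ "map_pmf _ _"] map_pmf_comp intro!: marg)
  then have "shannon_entropy Q' \<le> h" using h by blast
  moreover have "(\<lambda>n. shannon_entropy (Q (r n))) \<longlonglongrightarrow> shannon_entropy Q'"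
    by (rule shannon_entropy_tendsto[OF finR setQ Q'])
  then have "h + \<epsilon> \<le> shannon_entropy Q'"
    by (rule LIMSEQ_le_const) (use zs in \<open>auto simp: Q_def intro: less_imp_le\<close>)
  ultimately show False using \<epsilon> by simp
qed

text \<open>
  A pair off the diagonal gives a nonzero row, because the maps \<open>\<alpha> i\<close> are injective.
\<close>

lemma relation_rank_pos:
  assumes R: "R \<in> coupling_relations \<Phi>" and inj: "\<And>i. inj_on (\<alpha> i) ((\<lambda>b. b i) ` \<Phi>)"
  shows "1 \<le> relation_rank \<alpha> R"
proof -
  let ?d = "\<lambda>(x, y). (\<chi> i. rat_of_int (\<alpha> i (x i) - \<alpha> i (y i))) :: rat ^ 'a"
  from R obtain x y where xy: "(x, y) \<in> R" "x \<noteq> y" "x \<in> \<Phi>" "y \<in> \<Phi>"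
    by (auto simp: coupling_relations_def)
  then obtain i where i: "x i \<noteq> y i" by auto
  then have "\<alpha> i (x i) \<noteq> \<alpha> i (y i)" using inj[of i] xy by (auto dest: inj_onD)
  then have "?d (x, y) $ i \<noteq> 0" by (simp del: of_int_diff)
  then have nz: "?d (x, y) \<noteq> 0" by (metis zero_index)
  have "vec.independent {?d (x, y)}" using nz by (simp add: vec.dependent_single)
  moreover have "{?d (x, y)} \<subseteq> ?d ` R" using xy(1) by blast
  ultimately have "card {?d (x, y)} \<le> vec.dim (?d ` R)"
    by (metis (no_types, lifting) vec.dim_eq_card_independent vec.dim_subset)
  then show ?thesis by (simp add: relation_rank_def)
qed

lemma eventually_log_le_linear:
  fixes k :: real
  assumes "0 < k"
  shows "\<forall>\<^sub>F n in sequentially. a + b * ln (real n + 1) \<le> k * real n"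
proof -
  have 1: "(\<lambda>n. 1 / real n) \<longlonglongrightarrow> 0" by real_asymp
  have 2: "(\<lambda>n. ln (real n + 1) / real n) \<longlonglongrightarrow> 0" by real_asymp
  have "(\<lambda>n. a * (1 / real n) + b * (ln (real n + 1) / real n)) \<longlonglongrightarrow> a * 0 + b * 0"
    by (intro tendsto_intros 1 2)
  then have "\<forall>\<^sub>F n in sequentially. a * (1 / real n) + b * (ln (real n + 1) / real n) < k"
    using assms by (intro order_tendstoD) auto
  then show ?thesis using eventually_gt_at_top[of 0]
  proof eventually_elim
    case (elim n)
    have "a * (1 / real n) + b * (ln (real n + 1) / real n) = (a + b * ln (real n + 1)) / real n"
      by (simp add: add_divide_distrib)
    then have "(a + b * ln (real n + 1)) / real n \<le> k" using elim(1) by simp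
    then show ?case using elim(2) by (simp add: pos_divide_le_eq)
  qed
qed

text \<open>
  The words are selected by conditions on their legs only, so that every word over \<open>\<Phi>\<close> with legs among
  those of selected words is selected too.
\<close>

definition marginal_class :: "('k \<Rightarrow> 'b) set \<Rightarrow> ('k \<Rightarrow> 'b) multiset \<Rightarrow> ('k \<Rightarrow> 'b) list set"
  where "marginal_class \<Phi> M = {ys. set ys \<subseteq> \<Phi> \<and> length ys = size M \<and>
    (\<forall>i. mset (leg i ys) = image_mset (\<lambda>y. y i) M)}"

lemma eventually_marginal_class_ge:
  fixes \<Phi> :: "('k::finite \<Rightarrow> 'b) set"
  assumes \<Phi>: "finite \<Phi>" "set_pmf P \<subseteq> \<Phi>"
    and M: "\<And>n. size (M n) = n" "\<And>n. set_mset (M n) \<subseteq> \<Phi>"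
      "\<And>x. (\<lambda>n. real (count (M n) x) / n) \<longlonglongrightarrow> pmf P x"
    and \<delta>: "0 < \<delta>"
  shows "\<forall>\<^sub>F n in sequentially.
    2 powr (real n * (shannon_entropy P - \<delta>)) \<le> card (marginal_class \<Phi> (M n))"
proof -
  have limH: "(\<lambda>n. shannon_entropy (pmf_of_multiset (M (Suc n)))) \<longlonglongrightarrow> shannon_entropy P"
  proof (rule shannon_entropy_tendsto[OF \<Phi>(1) _ \<Phi>(2)])
    have ne: "M (Suc n) \<noteq> {#}" for n using M(1)[of "Suc n"] by auto
    show "set_pmf (pmf_of_multiset (M (Suc n))) \<subseteq> \<Phi>" for n using ne M(2) by simp
    show "(\<lambda>n. pmf (pmf_of_multiset (M (Suc n))) x) \<longlonglongrightarrow> pmf P x" for x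
      using LIMSEQ_Suc[OF M(3)[of x]] ne M(1) by simp
  qed
  then have "(\<lambda>n. shannon_entropy (pmf_of_multiset (M n))) \<longlonglongrightarrow> shannon_entropy P"
    by (rule LIMSEQ_imp_Suc)
  then have "\<forall>\<^sub>F n in sequentially. shannon_entropy P - \<delta> / 2 < shannon_entropy (pmf_of_multiset (M n))"
    using \<delta> by (intro order_tendstoD) auto
  moreover have "\<forall>\<^sub>F n in sequentially. card \<Phi> + card \<Phi> * ln (real n + 1) \<le> ln 2 * \<delta> / 2 * real n"
    using \<delta> by (intro eventually_log_le_linear) simp
  ultimately show ?thesis using eventually_gt_at_top[of 0]
  proof eventually_elim
    case (elim n)
    let ?T = "permutations_of_multiset (M n)"
    have ne: "M n \<noteq> {#}" using M(1)[of n] elim by auto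
    have "real n * (ln 2 * (shannon_entropy P - \<delta> / 2)) \<le> real n * (ln 2 * shannon_entropy (pmf_of_multiset (M n)))"
      using elim(1) by (intro mult_left_mono) auto
    moreover have "real (card (set_mset (M n))) * (1 + ln (real n + 1)) \<le> card \<Phi> * (1 + ln (real n + 1))"
      using \<Phi>(1) M(2) by (intro mult_right_mono) (auto intro: card_mono)
    ultimately have "real n * (ln 2 * (shannon_entropy P - \<delta> / 2)) - card \<Phi> * (1 + ln (real n + 1))
        \<le> ln (card ?T)"
      using ln_card_type_class(2)[OF ne] unfolding M(1) by linarith
    then have "(real n * (shannon_entropy P - \<delta>)) * ln 2 \<le> ln (card ?T)"
      using elim(2) by (simp add: algebra_simps)
    moreover have "0 < card ?T" by (simp add: card_gt_0_iff)
    ultimately have "2 powr (real n * (shannon_entropy P - \<delta>)) \<le> card ?T"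
      unfolding powr_def by (simp add: ln_ge_iff)
    also have "card ?T \<le> card (marginal_class \<Phi> (M n))"
    proof (rule card_mono)
      show "finite (marginal_class \<Phi> (M n))"
        by (rule finite_subset[OF _ finite_lists_length_eq[OF \<Phi>(1), of "size (M n)"]]) (auto simp: marginal_class_def)
      show "?T \<subseteq> marginal_class \<Phi> (M n)"
      proof
        fix ys assume "ys \<in> ?T"
        then have ys: "mset ys = M n" by (rule permutations_of_multisetD)
        then have "set ys \<subseteq> \<Phi>" "length ys = size (M n)" using M(2)[of n] by (metis set_mset_mset, metis size_mset)
        then show "ys \<in> marginal_class \<Phi> (M n)" by (simp add: marginal_class_def ys)
      qed
    qed
    finally show ?case by simp
  qed
qed

text \<open>
  A colliding pair of words is a word over the relation \<open>R\<close> of its pairs of letters, and its joint type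
  is almost a coupling of the marginals of \<open>P\<close>.
\<close>

lemma eventually_collisions_le:
  fixes \<Phi> :: "('k::finite \<Rightarrow> 'b) set"
  assumes \<Phi>: "finite \<Phi>" "set_pmf P \<subseteq> \<Phi>"
    and M: "\<And>n. size (M n) = n" "\<And>n. set_mset (M n) \<subseteq> \<Phi>"
      "\<And>x. (\<lambda>n. real (count (M n) x) / n) \<longlonglongrightarrow> pmf P x"
    and h: "\<And>R Q. R \<in> coupling_relations \<Phi> \<Longrightarrow> Q \<in> couplings (\<lambda>i. marginal i P) R \<Longrightarrow> shannon_entropy Q \<le> h R"
    and \<delta>: "0 < \<delta>"
  shows "\<forall>\<^sub>F n in sequentially. \<forall>R\<in>coupling_relations \<Phi>.
    card {z \<in> collisions (marginal_class \<Phi> (M n)). set (zip (fst z) (snd z)) = R}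
      \<le> exp 1 * (real n + 1) ^ Suc ((card \<Phi>)\<^sup>2) * 2 powr (real n * (h R + \<delta>))"
proof (rule eventually_ball_finite)
  show "finite (coupling_relations \<Phi>)"
    by (rule finite_subset[of _ "Pow (\<Phi> \<times> \<Phi>)"]) (use \<Phi>(1) in \<open>auto simp: coupling_relations_def\<close>)
  show "\<forall>R\<in>coupling_relations \<Phi>. \<forall>\<^sub>F n in sequentially.
    card {z \<in> collisions (marginal_class \<Phi> (M n)). set (zip (fst z) (snd z)) = R}
      \<le> exp 1 * (real n + 1) ^ Suc ((card \<Phi>)\<^sup>2) * 2 powr (real n * (h R + \<delta>))"
  proof
    fix R assume R: "R \<in> coupling_relations \<Phi>"
    then have R\<Phi>: "R \<subseteq> \<Phi> \<times> \<Phi>" by (auto simp: coupling_relations_def)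
    then have finR: "finite R" using \<Phi>(1) by (meson finite_SigmaI finite_subset)
    have cardR: "card R \<le> (card \<Phi>)\<^sup>2"
      using card_mono[OF _ R\<Phi>] \<Phi>(1) by (simp add: card_cartesian_product power2_eq_square)
    have hR: "\<forall>Q\<in>couplings (\<lambda>i. marginal i P) R. shannon_entropy Q \<le> h R" using h[OF R] by blast
    show "\<forall>\<^sub>F n in sequentially.
      card {z \<in> collisions (marginal_class \<Phi> (M n)). set (zip (fst z) (snd z)) = R}
        \<le> exp 1 * (real n + 1) ^ Suc ((card \<Phi>)\<^sup>2) * 2 powr (real n * (h R + \<delta>))"
      using joint_type_entropy_le[OF \<Phi> M R\<Phi> hR \<delta>] eventually_gt_at_top[of 0]
    proof eventually_elim
      case (elim n)
      let ?C = "{z \<in> collisions (marginal_class \<Phi> (M n)). set (zip (fst z) (snd z)) = R}"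
      let ?zip = "\<lambda>z. zip (fst z) (snd z)"
      have C: "length (fst z) = n" "length (snd z) = n" "set (?zip z) = R"
        "mset (leg i (fst z)) = image_mset (\<lambda>y. y i) (M n)" "mset (leg i (snd z)) = image_mset (\<lambda>y. y i) (M n)"
        if "z \<in> ?C" for z i using that by (auto simp: collisions_def marginal_class_def M(1))
      have legs: "map (\<lambda>z. fst z i) (?zip z) = leg i (fst z)" "map (\<lambda>z. snd z i) (?zip z) = leg i (snd z)"
        if "z \<in> ?C" for z i
        using C(1,2)[OF that] by (simp_all add: list_eq_iff_nth_eq)
      have "inj_on ?zip ?C"
      proof (rule inj_onI)
        fix z z' assume z: "z \<in> ?C" and z': "z' \<in> ?C" and eq: "?zip z = ?zip z'"
        have proj: "map fst (?zip z) = fst z" "map snd (?zip z) = snd z" if "z \<in> ?C" for z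
          using C(1,2)[OF that] by simp_all
        from arg_cong[OF eq, of "map fst"] have "fst z = fst z'" unfolding proj[OF z] proj[OF z'] .
        moreover from arg_cong[OF eq, of "map snd"] have "snd z = snd z'" unfolding proj[OF z] proj[OF z'] .
        ultimately show "z = z'" by (rule prod_eqI)
      qed
      then have "card ?C = card (?zip ` ?C)" by (rule card_image[symmetric])
      also have "real \<dots> \<le> exp 1 * (real n + 1) ^ Suc (card R) * 2 powr (n * (h R + \<delta>))"
      proof (rule card_lists_bounded_entropy[OF finR elim(2)])
        fix zs assume "zs \<in> ?zip ` ?C"
        then obtain z where z: "z \<in> ?C" "zs = ?zip z" by blast
        show len: "set zs \<subseteq> R \<and> length zs = n" using C(1-3)[OF z(1)] z(2) by simp
        have "image_mset (\<lambda>z. fst z i) (mset zs) = image_mset (\<lambda>y. y i) (M n) \<and>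
            image_mset (\<lambda>z. snd z i) (mset zs) = image_mset (\<lambda>y. y i) (M n)" for i
          using C(4,5)[OF z(1), of i] legs[OF z(1), of i] unfolding z(2) by (metis mset_map)
        note legs_eq = allI[OF this]
        show "shannon_entropy (pmf_of_multiset (mset zs)) \<le> h R + \<delta>"
          by (rule elim(1)[THEN spec, THEN mp, THEN mp, THEN mp,
              OF conjunct2[OF len] conjunct1[OF len] legs_eq])
      qed
      also have "\<dots> \<le> exp 1 * (real n + 1) ^ Suc ((card \<Phi>)\<^sup>2) * 2 powr (n * (h R + \<delta>))"
        using cardR by (intro mult_right_mono mult_left_mono power_increasing) auto
      finally show ?case .
    qed
  qed
qed

text \<open>
  Apply \<open>exists_isolated_family\<close> with \<open>p ^ e\<close> slightly larger than \<open>2 powr (N * \<mu>)\<close>. For a relation of rank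
  \<open>\<rho>\<close> there are at most \<open>2 powr (N * (H(P) + \<mu> * \<rho> + \<delta>))\<close> collisions, up to a polynomial factor, and each
  survives with relative probability \<open>p ^ (- e * \<rho>)\<close>. So for \<open>\<rho> \<ge> 1\<close> all collisions together weigh less than
  half of the words.
\<close>

lemma exists_diagonal:
  fixes \<Phi> :: "('k::finite \<Rightarrow> 'b) set" and \<alpha> :: "'k \<Rightarrow> 'b \<Rightarrow> int" and P :: "('k \<Rightarrow> 'b) pmf" and \<mu> \<epsilon> :: real
  assumes \<Phi>: "finite \<Phi>" "set_pmf P \<subseteq> \<Phi>"
    and tight: "\<And>b. b \<in> \<Phi> \<Longrightarrow> (\<Sum>i\<in>UNIV. \<alpha> i (b i)) = 0"
    and inj: "\<And>i. inj_on (\<alpha> i) ((\<lambda>b. b i) ` \<Phi>)"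
    and k: "2 \<le> CARD('k)"
    and \<mu>: "0 \<le> \<mu>" "\<And>R Q. R \<in> coupling_relations \<Phi> \<Longrightarrow> Q \<in> couplings (\<lambda>i. marginal i P) R \<Longrightarrow>
      shannon_entropy Q \<le> shannon_entropy P + \<mu> * relation_rank \<alpha> R"
    and \<epsilon>: "0 < \<epsilon>"
  obtains m n X where "0 < m" "m * (shannon_entropy P - (real CARD('k) - 2) * \<mu> - \<epsilon>) \<le> real n"
    "isolated_diagonal \<Phi> m X"
    "2 ^ n \<le> card X"
proof -
  let ?H = "shannon_entropy P"
  define k0 :: 'k where "k0 = undefined"
  define J where "J = UNIV - {k0}"
  define r where "r = card J"
  have r_eq: "real r = real CARD('k) - 1" and r: "1 \<le> r"
    using k by (auto simp: r_def J_def card_Diff_subset)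
  \<comment> \<open>The losses below add up to \<open>3 * r + 1\<close> multiples of \<open>N * \<delta>\<close>: three for each of the \<open>r - 1\<close> factors \<open>p ^ e\<close>
    left over, one each for the size of \<open>\<Psi>\<close>, the number of spheres, the side length of the box and
    the bounded factors.\<close>
  define \<delta> where "\<delta> = \<epsilon> / (3 * r + 1)"
  have \<delta>: "0 < \<delta>" using \<epsilon> by (simp add: \<delta>_def add_nonneg_pos)
  define D where "D = (\<lambda>(x, y) i. \<alpha> i (x i) - \<alpha> i (y i)) ` (\<Phi> \<times> \<Phi>)"
  have "finite D" using \<Phi>(1) by (simp add: D_def)
  then obtain p0 where p0: "\<forall>p>p0. prime p \<longrightarrow>
      (\<forall>A\<subseteq>D. vec.independent (rat_vec ` A) \<longrightarrow> preserves_independence p A)"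
    using large_prime_preserves_independence_subsets by metis
  \<comment> \<open>The box has density at least \<open>(2 * r) ^ (- e)\<close> in \<open>F_p^e\<close>. This bound on \<open>p\<close> makes that loss at most
    \<open>2 powr (N * \<delta>)\<close>, up to a constant factor.\<close>
  obtain q0 :: nat where q0: "2 powr (log 2 (2 * r) * (\<mu> + 3 * \<delta>) / \<delta>) < q0"
    using reals_Archimedean2 by blast
  obtain p where p: "prime p" "max p0 (max q0 (2 * r)) < p" using bigger_prime by blast
  then have p_gt: "p0 < p" "q0 < p" "2 * r < p" by auto
  define t where "t = log 2 p"
  have p_powr: "real p = 2 powr t" using p_gt by (simp add: t_def)
  have "log 2 (2 powr (log 2 (2 * r) * (\<mu> + 3 * \<delta>) / \<delta>)) < t"
    unfolding t_def using q0 p_gt by (intro log_less) auto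
  then have t_gt: "log 2 (2 * r) * (\<mu> + 3 * \<delta>) / \<delta> < t" by simp
  have log_r: "0 < log 2 (2 * r)" using r by simp
  have \<mu>\<delta>: "0 < \<mu> + 3 * \<delta>" using \<mu>(1) \<delta> by simp
  have "0 < log 2 (2 * r) * (\<mu> + 3 * \<delta>) / \<delta>" using log_r \<mu>\<delta> \<delta> by simp
  then have t: "0 < t" using t_gt by simp
  define d where "d = p div r"
  have rd: "r * d \<le> p" by (simp add: d_def)
  have d: "0 < d" using p_gt r by (simp add: d_def div_greater_zero_iff)
  have d_ge: "real p / (2 * r) \<le> d"
  proof -
    have "p < r * (d + 1)" using r by (simp add: d_def dividend_less_times_div)
    also have "\<dots> \<le> r * (2 * d)" using d by (intro mult_le_mono2) simp
    finally have "real p \<le> real (r * (2 * d))" by (simp only: of_nat_le_iff less_imp_le)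
    then show ?thesis using r by (simp add: pos_divide_le_eq mult_ac)
  qed
  define c where "c = (\<mu> + 3 * \<delta>) / t"
  have c: "0 < c" using \<mu>\<delta> t by (simp add: c_def)
  \<comment> \<open>So \<open>p ^ e N\<close> lies between \<open>2 powr (N * (\<mu> + 3 * \<delta>))\<close> and \<open>p\<close> times this number.\<close>
  define e where "e N = nat \<lceil>N * c\<rceil>" for N :: nat
  have e: "N * c \<le> e N" "e N \<le> N * c + 1" for N
  proof -
    have "0 \<le> N * c" using c by simp
    then have "0 \<le> \<lceil>N * c\<rceil>" by simp
    then have "real (e N) = of_int \<lceil>N * c\<rceil>" unfolding e_def by simp
    then show "N * c \<le> e N" "e N \<le> N * c + 1" by linarith+
  qed
  obtain M where M: "\<And>n. size (M n) = n" "\<And>n. set_mset (M n) \<subseteq> \<Phi>"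
    "\<And>x. (\<lambda>n. real (count (M n) x) / n) \<longlonglongrightarrow> pmf P x"
  proof (rule multiset_approximation[OF \<Phi>])
    fix M :: "nat \<Rightarrow> ('k \<Rightarrow> 'b) multiset"
    assume *: "\<And>n. size (M n) = n" "\<And>n. set_mset (M n) \<subseteq> \<Phi>"
      "\<And>x. (\<lambda>n. real (count (M n) x) / n) \<longlonglongrightarrow> pmf P x"
    show thesis by (rule that[OF *])
  qed
  let ?\<Psi> = "\<lambda>N. marginal_class \<Phi> (M N)"
  let ?rk = "\<lambda>R :: (('k \<Rightarrow> 'b) \<times> ('k \<Rightarrow> 'b)) set. real (relation_rank \<alpha> R)"
  let ?CR = "coupling_relations \<Phi>"
  have finCR: "finite ?CR"
    by (rule finite_subset[of _ "Pow (\<Phi> \<times> \<Phi>)"]) (use \<Phi>(1) in \<open>auto simp: coupling_relations_def\<close>)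
  let ?D = "Suc ((card \<Phi>)\<^sup>2)"
  have ev1: "\<forall>\<^sub>F N in sequentially. 2 powr (real N * (?H - \<delta>)) \<le> card (?\<Psi> N)"
    by (rule eventually_marginal_class_ge[OF \<Phi> M \<delta>])
  have ev2: "\<forall>\<^sub>F N in sequentially. \<forall>R\<in>?CR.
    card {z \<in> collisions (?\<Psi> N). set (zip (fst z) (snd z)) = R}
      \<le> exp 1 * (real N + 1) ^ ?D * 2 powr (real N * ((?H + \<mu> * ?rk R) + \<delta>))"
    by (rule eventually_collisions_le[OF \<Phi> M \<mu>(2) \<delta>])
  have ev3: "\<forall>\<^sub>F N in sequentially. (1 + ln (2 * (real (card ?CR) + 1))) + ?D * ln (real N + 1) \<le> \<delta> * ln 2 * real N"
    using \<delta> by (intro eventually_log_le_linear) simp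
  have ev4: "\<forall>\<^sub>F N in sequentially. ln ((c + 1) * d\<^sup>2 + 1) + 1 * ln (real N + 1) \<le> \<delta> * ln 2 * real N"
    using \<delta> by (intro eventually_log_le_linear) simp
  have ev5: "\<forall>\<^sub>F N in sequentially. ((real r - 1) * t + log 2 (2 * r) + 2) + 0 * ln (real N + 1) \<le> \<delta> * real N"
    using \<delta> by (intro eventually_log_le_linear) simp
  obtain N where N: "2 powr (real N * (?H - \<delta>)) \<le> card (?\<Psi> N)"
    "\<forall>R\<in>?CR. card {z \<in> collisions (?\<Psi> N). set (zip (fst z) (snd z)) = R}
      \<le> exp 1 * (real N + 1) ^ ?D * 2 powr (real N * ((?H + \<mu> * ?rk R) + \<delta>))"
    "(1 + ln (2 * (real (card ?CR) + 1))) + ?D * ln (real N + 1) \<le> \<delta> * ln 2 * real N"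
    "ln ((c + 1) * d\<^sup>2 + 1) + 1 * ln (real N + 1) \<le> \<delta> * ln 2 * real N"
    "((real r - 1) * t + log 2 (2 * r) + 2) + 0 * ln (real N + 1) \<le> \<delta> * real N"
    "0 < N"
    using eventually_happens'[OF sequentially_bot, OF eventually_conj[OF ev1 eventually_conj[OF ev2
      eventually_conj[OF ev3 eventually_conj[OF ev4 eventually_conj[OF ev5 eventually_gt_at_top[of 0]]]]]]]
    by blast
  define e' where "e' = e N"
  have e': "N * c \<le> e'" "e' \<le> N * c + 1" using e by (auto simp: e'_def)
  have Nct: "N * c * t = N * (\<mu> + 3 * \<delta>)" using t by (simp add: c_def)
  have pe: "(real p) ^ x = 2 powr (t * x)" for x :: nat
    using p_gt by (simp add: p_powr powr_realpow[symmetric] powr_powr)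
  obtain S where S: "S \<subseteq> {..<e'} \<rightarrow>\<^sub>E {0..<int d}" "d ^ e' \<le> card S * (e' * d\<^sup>2 + 1)"
    and avg: "average_free J p e' S"
    by (rule exists_large_average_free_set[of J d p e']) (use r d rd in \<open>auto simp: r_def\<close>)
  interpret tight_hash \<Phi> \<alpha> k0 p e' d N S J
  proof
    show "J = UNIV - {k0}" by (fact J_def)
    show "finite \<Phi>" "\<And>b. b \<in> \<Phi> \<Longrightarrow> (\<Sum>i\<in>UNIV. \<alpha> i (b i)) = 0" by (fact \<Phi> tight)+
    show "J \<noteq> {}" using r by (auto simp: r_def)
    show "d \<le> p" by (simp add: d_def)
    show "0 < p" using p_gt by simp
    show "S \<subseteq> {..<e'} \<rightarrow>\<^sub>E {0..<int d}" by (fact S)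
    show "average_free J p e' S" by (fact avg)
  qed
  have good: "preserves_independence p A"
    if "A \<subseteq> difference ` (\<Phi> \<times> \<Phi>)" "vec.independent (rat_vec ` A)" for A
    using p0 p_gt(1) p(1) that unfolding D_def difference_def by blast
  have \<Psi>: "set ys \<subseteq> \<Phi> \<and> length ys = N" if "ys \<in> ?\<Psi> N" for ys
    using that by (auto simp: marginal_class_def M(1))
  obtain X where X: "X \<subseteq> ?\<Psi> N"
    "\<forall>xs\<in>X. \<forall>ys\<in>?\<Psi> N. (\<forall>i. leg i ys \<in> leg i ` X) \<longrightarrow> (\<exists>i. leg i xs = leg i ys) \<longrightarrow> ys = xs"
    and cardX: "card S / real p ^ (e' * card J) * (card (?\<Psi> N) -
      (\<Sum>z\<in>collisions (?\<Psi> N). 1 / (real p ^ e') ^ relation_rank \<alpha> (set (zip (fst z) (snd z))))) \<le> card X"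
    by (rule exists_isolated_family[OF \<Psi> good])
  have fin\<Psi>: "finite (?\<Psi> N)"
    by (rule finite_subset[OF _ finite_lists_length_eq[OF \<Phi>(1), of N]]) (use \<Psi> in auto)
  let ?C = "collisions (?\<Psi> N)"
  have finC: "finite ?C"
    by (rule finite_subset[of _ "?\<Psi> N \<times> ?\<Psi> N"]) (use fin\<Psi> in \<open>auto simp: collisions_def\<close>)
  have coll: "(\<Sum>z\<in>?C. 1 / (real p ^ e') ^ relation_rank \<alpha> (set (zip (fst z) (snd z)))) \<le> card (?\<Psi> N) / 2"
  proof -
    let ?g = "\<lambda>R. 1 / (real p ^ e') ^ relation_rank \<alpha> R"
    let ?z = "\<lambda>z :: ('k \<Rightarrow> 'b) list \<times> ('k \<Rightarrow> 'b) list. set (zip (fst z) (snd z))"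
    have zC: "?z z \<in> ?CR" if z: "z \<in> ?C" for z
    proof -
      obtain xs ys i where xy: "z = (xs, ys)" "xs \<in> ?\<Psi> N" "ys \<in> ?\<Psi> N" "xs \<noteq> ys" "leg i xs = leg i ys"
        using z by (auto simp: collisions_def)
      have len: "length xs = N" "length ys = N" "set xs \<subseteq> \<Phi>" "set ys \<subseteq> \<Phi>" using \<Psi> xy by auto
      obtain l where l: "l < N" "xs ! l \<noteq> ys ! l" using xy(4) len by (metis nth_equalityI)
      have "(xs ! l, ys ! l) \<in> set (zip xs ys)" using l len by (auto simp: set_zip)
      then have "\<not> set (zip xs ys) \<subseteq> Id_on \<Phi>" using l by auto
      moreover have "set (zip xs ys) \<subseteq> \<Phi> \<times> \<Phi>"
        using len by (auto dest: set_zip_leftD set_zip_rightD)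
      moreover have "x i = y i" if mem: "(x, y) \<in> set (zip xs ys)" for x y
      proof -
        obtain l where "l < N" "x = xs ! l" "y = ys ! l" using mem len by (auto simp: set_zip)
        then show ?thesis using arg_cong[OF xy(5), of "\<lambda>bs. bs ! l"] len by simp
      qed
      ultimately have "set (zip xs ys) \<subseteq> {(x, y). x \<in> \<Phi> \<and> y \<in> \<Phi> \<and> x i = y i}"
        "set (zip xs ys) \<subseteq> \<Phi> \<times> \<Phi>" "\<not> set (zip xs ys) \<subseteq> Id_on \<Phi>" by blast+
      then show ?thesis unfolding coupling_relations_def xy(1) fst_conv snd_conv by blast
    qed
    have summand_le: "real (card {z \<in> ?C. ?z z = R}) * ?g R
        \<le> exp 1 * (real N + 1) ^ ?D * 2 powr (real N * (?H - 2 * \<delta>))" if R: "R \<in> ?CR" for R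
    proof -
      let ?\<rho> = "relation_rank \<alpha> R"
      have \<rho>: "1 \<le> ?\<rho>" using relation_rank_pos[OF R inj] .
      have "N * c * t \<le> e' * t" using e'(1) t by (intro mult_right_mono) simp_all
      then have "N * (\<mu> + 3 * \<delta>) \<le> t * e'" unfolding Nct by (simp only: mult.commute[of t])
      then have "N * (\<mu> + 3 * \<delta>) * ?\<rho> \<le> t * e' * ?\<rho>" by (rule mult_right_mono) simp
      then have "2 powr (N * (\<mu> + 3 * \<delta>) * ?\<rho>) \<le> 2 powr (t * e' * ?\<rho>)" by (rule powr_mono) simp
      also have "\<dots> = (real p ^ e') ^ ?\<rho>"
        by (subst power_mult[symmetric], subst pe) (simp add: mult.assoc)
      finally have "2 powr (N * (\<mu> + 3 * \<delta>) * ?\<rho>) \<le> (real p ^ e') ^ ?\<rho>" .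
      then have "?g R \<le> 1 / 2 powr (N * (\<mu> + 3 * \<delta>) * ?\<rho>)"
        by (intro divide_left_mono) (auto simp: p_powr)
      then have g: "?g R \<le> 2 powr (- (N * (\<mu> + 3 * \<delta>) * ?\<rho>))" by (simp add: powr_minus_divide)
      have g0: "0 \<le> ?g R" by simp
      have "real (card {z \<in> ?C. ?z z = R}) * ?g R
          \<le> (exp 1 * (real N + 1) ^ ?D * 2 powr (real N * ((?H + \<mu> * ?\<rho>) + \<delta>))) * 2 powr (- (N * (\<mu> + 3 * \<delta>) * ?\<rho>))"
        using N(2) R g g0 by (intro mult_mono) auto
      also have "\<dots> = exp 1 * (real N + 1) ^ ?D * 2 powr (real N * ((?H + \<mu> * ?\<rho>) + \<delta>) - N * (\<mu> + 3 * \<delta>) * ?\<rho>)"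
        by (simp add: powr_add[symmetric] mult.assoc)
      also have "\<dots> \<le> exp 1 * (real N + 1) ^ ?D * 2 powr (real N * (?H - 2 * \<delta>))"
      proof -
        have "3 * \<delta> \<le> 3 * \<delta> * ?\<rho>" using \<rho> \<delta> by simp
        then have "(?H + \<mu> * ?\<rho>) + \<delta> - (\<mu> + 3 * \<delta>) * ?\<rho> \<le> ?H - 2 * \<delta>"
          by (simp add: algebra_simps)
        then have "real N * ((?H + \<mu> * ?\<rho>) + \<delta> - (\<mu> + 3 * \<delta>) * ?\<rho>) \<le> real N * (?H - 2 * \<delta>)"
          by (rule mult_left_mono) simp
        then have "real N * ((?H + \<mu> * ?\<rho>) + \<delta>) - N * (\<mu> + 3 * \<delta>) * ?\<rho> \<le> real N * (?H - 2 * \<delta>)"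
          by (simp only: right_diff_distrib mult.assoc)
        then show ?thesis by (intro mult_left_mono) auto
      qed
      finally show ?thesis .
    qed
    have "(\<Sum>z\<in>?C. 1 / (real p ^ e') ^ relation_rank \<alpha> (set (zip (fst z) (snd z)))) = (\<Sum>R\<in>?CR. \<Sum>z\<in>{z \<in> ?C. ?z z = R}. ?g (?z z))"
      using zC by (intro sum.group[symmetric] finC finCR) auto
    also have "\<dots> = (\<Sum>R\<in>?CR. real (card {z \<in> ?C. ?z z = R}) * ?g R)"
      by (intro sum.cong) auto
    also have "\<dots> \<le> real (card ?CR) * (exp 1 * (real N + 1) ^ ?D * 2 powr (real N * (?H - 2 * \<delta>)))"
      by (rule sum_bounded_above) (rule summand_le)
    also have "\<dots> \<le> (real (card ?CR) + 1) * (exp 1 * (real N + 1) ^ ?D * 2 powr (real N * (?H - 2 * \<delta>)))"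
      by (intro mult_right_mono) auto
    also have "\<dots> = (exp (1 + ln (2 * (real (card ?CR) + 1)) + ?D * ln (real N + 1)) / 2) * 2 powr (real N * (?H - 2 * \<delta>))"
    proof -
      have "exp (?D * ln (real N + 1)) = (real N + 1) ^ ?D"
        using exp_of_nat_mult[of ?D "ln (real N + 1)"] by (simp add: add_pos_nonneg)
      then show ?thesis by (simp add: exp_add add_nonneg_pos del: power_Suc of_nat_Suc)
    qed
    also have "\<dots> \<le> (exp (\<delta> * ln 2 * real N) / 2) * 2 powr (real N * (?H - 2 * \<delta>))"
      using N(3) by (intro mult_right_mono divide_right_mono) auto
    also have "exp (\<delta> * ln 2 * real N) = 2 powr (real N * \<delta>)" by (simp add: powr_def mult_ac)
    also have "2 powr (real N * \<delta>) / 2 * 2 powr (real N * (?H - 2 * \<delta>)) = 2 powr (real N * (?H - \<delta>)) / 2"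
      by (simp add: powr_add[symmetric] algebra_simps)
    also have "\<dots> \<le> card (?\<Psi> N) / 2" using N(1) by simp
    finally show ?thesis .
  qed
  have cardS: "2 powr (e' * (t - log 2 (2 * r)) - N * \<delta>) \<le> card S"
  proof -
    have "real (e' * d\<^sup>2 + 1) \<le> (N * c + 1) * d\<^sup>2 + 1" using e'(2) by (simp add: mult_right_mono)
    also have "\<dots> \<le> (real N + 1) * ((c + 1) * d\<^sup>2 + 1)"
    proof -
      have "N * c + 1 \<le> (real N + 1) * (c + 1)" using c by (simp add: algebra_simps)
      then have "(N * c + 1) * d\<^sup>2 \<le> (real N + 1) * (c + 1) * d\<^sup>2" by (rule mult_right_mono) simp
      moreover have "(real N + 1) * ((c + 1) * d\<^sup>2 + 1) = (real N + 1) * (c + 1) * d\<^sup>2 + (real N + 1)"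
        by (simp add: algebra_simps)
      ultimately show ?thesis by linarith
    qed
    also have "\<dots> = exp (ln ((c + 1) * d\<^sup>2 + 1) + 1 * ln (real N + 1))"
      using c by (simp add: exp_add add_nonneg_pos)
    also have "\<dots> \<le> exp (\<delta> * ln 2 * real N)" using N(4) by simp
    also have "\<dots> = 2 powr (N * \<delta>)" by (simp add: powr_def mult_ac)
    finally have poly: "real (e' * d\<^sup>2 + 1) \<le> 2 powr (N * \<delta>)" .
    have "real p / (2 * r) = 2 powr (t - log 2 (2 * r))"
      using r by (simp add: powr_diff p_powr)
    then have "2 powr (e' * (t - log 2 (2 * r))) = (real p / (2 * r)) ^ e'"
      by (simp add: powr_realpow[symmetric] powr_powr mult.commute)
    also have "\<dots> \<le> real d ^ e'" using d_ge by (intro power_mono) auto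
    also have "\<dots> = real (d ^ e')" by simp
    also have "\<dots> \<le> real (card S * (e' * d\<^sup>2 + 1))" using S(2) by (simp only: of_nat_le_iff)
    also have "\<dots> = card S * real (e' * d\<^sup>2 + 1)" by (rule of_nat_mult)
    also have "\<dots> \<le> card S * 2 powr (N * \<delta>)" using poly by (intro mult_left_mono) auto
    finally show ?thesis by (simp add: powr_diff pos_divide_le_eq)
  qed
  let ?E = "N * (?H - (real CARD('k) - 2) * \<mu> - \<epsilon>) + 1"
  have "2 powr ?E \<le> card X"
  proof -
    have pos: "0 < real p ^ (e' * card J)" by (simp add: p_powr)
    have "2 powr ?E \<le> 2 powr (e' * (t - log 2 (2 * r)) - N * \<delta> - t * (e' * r) + (N * (?H - \<delta>) - 1))"
    proof (rule powr_mono)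
      have "t * e' \<le> t * (N * c + 1)" using e'(2) t by (intro mult_left_mono) simp_all
      also have "\<dots> = N * c * t + t" by (simp add: algebra_simps)
      finally have "t * e' \<le> N * (\<mu> + 3 * \<delta>) + t" unfolding Nct .
      then have 1: "(real r - 1) * (t * e') \<le> (real r - 1) * (N * (\<mu> + 3 * \<delta>) + t)" using r by (intro mult_left_mono) simp_all
      have "log 2 (2 * r) * c \<le> \<delta>"
        using t_gt t \<delta> by (simp add: c_def field_simps)
      then have "N * (log 2 (2 * r) * c) \<le> N * \<delta>" using r by (intro mult_left_mono) simp_all
      moreover have "log 2 (2 * r) * e' \<le> log 2 (2 * r) * (N * c + 1)"
        using log_r e'(2) by (intro mult_left_mono) auto
      ultimately have 2: "e' * log 2 (2 * r) \<le> N * \<delta> + log 2 (2 * r)"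
        by (simp add: algebra_simps)
      have k_eq: "real CARD('k) - 2 = real r - 1" using r_eq by simp
      have \<epsilon>_eq: "\<epsilon> = (3 * r + 1) * \<delta>" by (simp add: \<delta>_def)
      have "?E = N * ?H - N * ((real r - 1) * \<mu>) - N * (3 * (real r - 1) + 4) * \<delta> + 1"
        unfolding \<epsilon>_eq k_eq by (simp add: algebra_simps)
      also have "\<dots> \<le> N * ?H - N * ((real r - 1) * \<mu>) - N * (3 * (real r - 1) + 3) * \<delta> - ((real r - 1) * t + log 2 (2 * r) + 1)"
        using N(5) by (simp add: algebra_simps)
      also have "\<dots> = - ((real r - 1) * (N * (\<mu> + 3 * \<delta>) + t)) - (N * \<delta> + log 2 (2 * r)) - N * \<delta> + (N * (?H - \<delta>) - 1)"
        by (simp add: algebra_simps)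
      also have "\<dots> \<le> - ((real r - 1) * (t * e')) - e' * log 2 (2 * r) - N * \<delta> + (N * (?H - \<delta>) - 1)"
        using 1 2 by linarith
      also have "\<dots> = e' * (t - log 2 (2 * r)) - N * \<delta> - t * (e' * r) + (N * (?H - \<delta>) - 1)"
        by (simp add: algebra_simps)
      finally show "?E \<le> e' * (t - log 2 (2 * r)) - N * \<delta> - t * (e' * r) + (N * (?H - \<delta>) - 1)" .
    qed simp
    also have "\<dots> = 2 powr (e' * (t - log 2 (2 * r)) - N * \<delta>) / real p ^ (e' * card J) * (2 powr (N * (?H - \<delta>)) / 2)"
      by (simp add: pe powr_add powr_diff r_def)
    also have "\<dots> \<le> card S / real p ^ (e' * card J) * (card (?\<Psi> N) / 2)"
      using cardS N(1) pos by (intro mult_mono divide_right_mono) auto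
    also have "\<dots> \<le> card S / real p ^ (e' * card J) * (card (?\<Psi> N) -
      (\<Sum>z\<in>collisions (?\<Psi> N). 1 / (real p ^ e') ^ relation_rank \<alpha> (set (zip (fst z) (snd z)))))"
      using coll by (intro mult_left_mono) auto
    also have "\<dots> \<le> card X" by (fact cardX)
    finally show ?thesis .
  qed
  moreover have "0 < 2 powr ?E" by simp
  ultimately have X0: "0 < real (card X)" by linarith
  have E_le: "?E \<le> log 2 (card X)"
    using \<open>2 powr ?E \<le> card X\<close> X0 by (simp only: le_log_iff)
  define n where "n = nat \<lfloor>log 2 (card X)\<rfloor>"
  have log0: "0 \<le> log 2 (card X)" using X0 by simp
  have n_le: "real n \<le> log 2 (card X)" and n_ge: "log 2 (card X) - 1 \<le> n"
  proof -
    have "real n = of_int \<lfloor>log 2 (card X)\<rfloor>" using log0 unfolding n_def by simp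
    then show "real n \<le> log 2 (card X)" "log 2 (card X) - 1 \<le> n" by linarith+
  qed
  show thesis
  proof (rule that[of N n X])
    show "0 < N" by (fact N(6))
    show "N * (?H - (real CARD('k) - 2) * \<mu> - \<epsilon>) \<le> real n" using E_le n_ge by linarith
    have "length ys = N \<and> set ys \<subseteq> \<Phi>" if "ys \<in> X" for ys using X(1) \<Psi> that by blast
    moreover have "inj_on (leg i) X" for i
    proof (rule inj_onI)
      fix xs ys assume "xs \<in> X" "ys \<in> X" "leg i xs = leg i ys"
      then show "xs = ys" using X by blast
    qed
    moreover have "ys \<in> X" if ys: "length ys = N" "set ys \<subseteq> \<Phi>" and legs: "\<And>i. leg i ys \<in> leg i ` X" for ys
    proof -
      have "\<exists>xs\<in>X. leg i ys = leg i xs" for i using legs[of i] by blast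
      then obtain x where x: "\<And>i. x i \<in> X" "\<And>i. leg i ys = leg i (x i)" by metis
      have "mset (leg i ys) = image_mset (\<lambda>y. y i) (M N)" for i
        unfolding x(2)[of i] using X(1) x(1)[of i] by (auto simp: marginal_class_def)
      then have "ys \<in> ?\<Psi> N" using ys by (simp add: marginal_class_def M(1))
      moreover have "\<exists>i. leg i (x k0) = leg i ys" using x(2)[of k0] by metis
      ultimately have "ys = x k0" using X(2) x(1)[of k0] legs by blast
      then show ?thesis using x(1) by simp
    qed
    ultimately show "isolated_diagonal \<Phi> N X" unfolding isolated_diagonal_def by blast
    have "real (2 ^ n) = 2 powr n" by (simp add: powr_realpow)
    also have "\<dots> \<le> 2 powr (log 2 (card X))" using n_le by (intro powr_mono) auto
    also have "\<dots> = card X" using X0 by simp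
    finally show "2 ^ n \<le> card X" by (simp only: of_nat_le_iff)
  qed
qed

section \<open>The lower bound\<close>

lemma shannon_entropy_le_card:
  assumes "finite A" "set_pmf P \<subseteq> A"
  shows "shannon_entropy P \<le> card A / ln 2"
proof -
  have "- (pmf P x * log 2 (pmf P x)) \<le> 1 / ln 2" for x
  proof (cases "pmf P x = 0")
    case False
    then have pos: "0 < pmf P x" by (simp add: less_le)
    then have "ln (1 / pmf P x) \<le> 1 / pmf P x - 1" by (intro ln_le_minus_one) simp
    then have "pmf P x * ln (1 / pmf P x) \<le> pmf P x * (1 / pmf P x - 1)"
      using pos by (intro mult_left_mono) auto
    also have "\<dots> \<le> 1" using pos by (simp add: right_diff_distrib)
    finally have "- (pmf P x * ln (pmf P x)) \<le> 1" using pos by (simp add: ln_div)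
    then have "- (pmf P x * ln (pmf P x)) / ln 2 \<le> 1 / ln 2" by (rule divide_right_mono) simp
    then show ?thesis by (simp add: log_def)
  qed simp
  then have "(\<Sum>x\<in>A. - (pmf P x * log 2 (pmf P x))) \<le> of_nat (card A) * (1 / ln 2)"
    by (intro sum_bounded_above) auto
  then show ?thesis by (simp add: shannon_entropy_superset[OF assms] sum_negf)
qed

lemma shannon_entropy_map_inj:
  assumes "inj f"
  shows "shannon_entropy (map_pmf f P) = shannon_entropy P"
  using assms by (simp add: shannon_entropy_def sum.reindex inj_on_subset[OF assms] pmf_map_inj')

text \<open>
  The penalty is a real number: entropies of couplings are bounded, and \<open>\<mu>\<close> is nonnegative because
  the relation of all pairs that agree in a fixed factor admits the diagonal coupling of \<open>P\<close> with itself,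
  which has the entropy of \<open>P\<close>.
\<close>

lemma penalty_controls_couplings:
  fixes \<Phi> :: "('k::finite \<Rightarrow> 'b) set" and \<alpha> :: "'k \<Rightarrow> 'b \<Rightarrow> int"
  assumes \<Phi>: "finite \<Phi>" "set_pmf P \<subseteq> \<Phi>"
    and inj: "\<And>i. inj_on (\<alpha> i) ((\<lambda>b. b i) ` \<Phi>)"
  obtains \<mu> where "penalty \<alpha> \<Phi> P = ereal \<mu>" "0 \<le> \<mu>"
    "\<And>R Q. R \<in> coupling_relations \<Phi> \<Longrightarrow> Q \<in> couplings (\<lambda>i. marginal i P) R \<Longrightarrow>
      shannon_entropy Q \<le> shannon_entropy P + \<mu> * relation_rank \<alpha> R"
proof (cases "coupling_relations \<Phi> = {}")
  case True
  then show ?thesis by (intro that[of 0]) (auto simp: penalty_def zero_ereal_def)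
next
  case False
  let ?H = "shannon_entropy P"
  let ?Hmax = "\<lambda>R. SUP Q\<in>couplings (\<lambda>i. marginal i P) R. ereal (shannon_entropy Q)"
  have pen: "penalty \<alpha> \<Phi> P = (SUP R\<in>coupling_relations \<Phi>. (?Hmax R - ereal ?H) / ereal (real (relation_rank \<alpha> R)))"
    using False by (simp add: penalty_def)
  have rank: "1 \<le> relation_rank \<alpha> R" if "R \<in> coupling_relations \<Phi>" for R
    using relation_rank_pos[OF that inj] .
  have lower: "ereal ((shannon_entropy Q - ?H) / relation_rank \<alpha> R) \<le> penalty \<alpha> \<Phi> P"
    if R: "R \<in> coupling_relations \<Phi>" and Q: "Q \<in> couplings (\<lambda>i. marginal i P) R" for R Q
  proof -
    have "ereal ((shannon_entropy Q - ?H) / relation_rank \<alpha> R)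
        = (ereal (shannon_entropy Q) - ereal ?H) / ereal (real (relation_rank \<alpha> R))"
      using rank[OF R] by simp
    also have "\<dots> \<le> (?Hmax R - ereal ?H) / ereal (real (relation_rank \<alpha> R))"
      using rank[OF R] Q by (intro ereal_divide_right_mono ereal_minus_mono SUP_upper) auto
    also have "\<dots> \<le> penalty \<alpha> \<Phi> P" unfolding pen by (rule SUP_upper[OF R])
    finally show ?thesis .
  qed
  let ?c = "card (\<Phi> \<times> \<Phi>) / ln 2"
  have "penalty \<alpha> \<Phi> P \<le> ereal (?c + \<bar>?H\<bar>)"
    unfolding pen
  proof (rule SUP_least)
    fix R assume R: "R \<in> coupling_relations \<Phi>"
    then have sub: "R \<subseteq> \<Phi> \<times> \<Phi>" by (auto simp: coupling_relations_def)
    have "?Hmax R \<le> ereal ?c"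
    proof (rule SUP_least)
      fix Q assume "Q \<in> couplings (\<lambda>i. marginal i P) R"
      then have "set_pmf Q \<subseteq> \<Phi> \<times> \<Phi>" using sub by (auto simp: couplings_def distributions_on_def)
      then show "ereal (shannon_entropy Q) \<le> ereal ?c"
        using shannon_entropy_le_card[of "\<Phi> \<times> \<Phi>" Q] \<Phi>(1) by simp
    qed
    then have "(?Hmax R - ereal ?H) / ereal (real (relation_rank \<alpha> R))
        \<le> (ereal ?c - ereal ?H) / ereal (real (relation_rank \<alpha> R))"
      using rank[OF R] by (intro ereal_divide_right_mono ereal_minus_mono) auto
    also have "\<dots> = ereal ((?c - ?H) / relation_rank \<alpha> R)" using rank[OF R] by simp
    also have "\<dots> \<le> ereal (?c + \<bar>?H\<bar>)"
    proof -
      have "(?c - ?H) / relation_rank \<alpha> R \<le> (?c + \<bar>?H\<bar>) / relation_rank \<alpha> R"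
        by (intro divide_right_mono) auto
      also have "\<dots> \<le> (?c + \<bar>?H\<bar>) / 1"
        using rank[OF R] by (intro divide_left_mono) auto
      finally show ?thesis by simp
    qed
    finally show "(?Hmax R - ereal ?H) / ereal (real (relation_rank \<alpha> R)) \<le> ereal (?c + \<bar>?H\<bar>)" .
  qed
  moreover have nonneg: "0 \<le> penalty \<alpha> \<Phi> P"
  proof -
    from False obtain R i where R: "R \<subseteq> {(x, y). x \<in> \<Phi> \<and> y \<in> \<Phi> \<and> x i = y i}" "\<not> R \<subseteq> Id_on \<Phi>"
      by (auto simp: coupling_relations_def)
    let ?R = "{(x, y). x \<in> \<Phi> \<and> y \<in> \<Phi> \<and> x i = y i}"
    have "\<not> ?R \<subseteq> Id_on \<Phi>" using R by blast
    then have R': "?R \<in> coupling_relations \<Phi>" unfolding coupling_relations_def by blast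
    let ?Q = "map_pmf (\<lambda>x. (x, x)) P"
    have "?Q \<in> couplings (\<lambda>i. marginal i P) ?R"
      using \<Phi>(2) by (auto simp: couplings_def distributions_on_def map_pmf_comp)
    from lower[OF R' this] show ?thesis
      by (simp add: shannon_entropy_map_inj inj_def zero_ereal_def)
  qed
  ultimately obtain \<mu> where \<mu>: "penalty \<alpha> \<Phi> P = ereal \<mu>" by (cases "penalty \<alpha> \<Phi> P") auto
  show ?thesis
  proof (rule that[OF \<mu>])
    show "0 \<le> \<mu>" using nonneg \<mu> by simp
    fix R Q assume R: "R \<in> coupling_relations \<Phi>" and Q: "Q \<in> couplings (\<lambda>i. marginal i P) R"
    have "(shannon_entropy Q - ?H) / relation_rank \<alpha> R \<le> \<mu>" using lower[OF R Q] \<mu> by simp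
    then show "shannon_entropy Q \<le> ?H + \<mu> * relation_rank \<alpha> R"
      using rank[OF R] by (simp add: pos_divide_le_eq)
  qed
qed

theorem theorem1p2p4:
  fixes smul :: "complex \<Rightarrow> 'v::ab_group_add \<Rightarrow> 'v"
    and V B :: "'k::finite \<Rightarrow> 'v set"
    and \<phi> :: "('k \<Rightarrow> 'v \<Rightarrow> complex) \<Rightarrow> complex"
    and \<alpha> :: "'k \<Rightarrow> 'v \<Rightarrow> int"
    and \<Phi> :: "('k \<Rightarrow> 'v) set"
  assumes "vector_space smul"
    and "\<And>i. module.subspace smul (V i)"
    and "\<And>i. is_basis_of smul (B i) (V i)"
    and "\<phi> \<in> tensor_product smul V"
    and "\<phi> \<noteq> (\<lambda>_. 0)"
    and "\<Phi> = tensor_support smul B \<phi>"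
    and "tight_wrt B \<Phi> \<alpha>"
  shows "monomial_subexponent B (tensor_coeff smul B \<phi>) \<ge>
    (SUP P\<in>distributions_on \<Phi>.
      ereal (shannon_entropy P) - ereal (real CARD('k) - 2) * penalty \<alpha> \<Phi> P)"
proof (rule SUP_least)
  fix P assume P: "P \<in> distributions_on \<Phi>"
  then have supp: "set_pmf P \<subseteq> \<Phi>" by (simp add: distributions_on_def)
  let ?t = "tensor_coeff smul B \<phi>"
  let ?H = "shannon_entropy P"
  have finB: "finite (B i)" for i using assms(3)[of i] by (simp add: is_basis_of_def)
  have \<Phi>_eq: "\<Phi> = {b \<in> (\<Pi> i\<in>UNIV. B i). ?t b \<noteq> 0}" by (simp add: assms(6) tensor_support_def)
  have "(\<Pi> i\<in>UNIV. B i) = Pi\<^sub>E UNIV B" by (auto simp: PiE_def)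
  then have "finite (\<Pi> i\<in>UNIV. B i)" using finB by (simp add: finite_PiE)
  then have fin\<Phi>: "finite \<Phi>" by (simp add: \<Phi>_eq)
  have tight: "(\<Sum>i\<in>UNIV. \<alpha> i (b i)) = 0" if "b \<in> \<Phi>" for b
    using assms(7) that by (simp add: tight_wrt_def)
  have injB: "inj_on (\<alpha> i) (B i)" for i using assms(7) by (simp add: tight_wrt_def)
  have inj: "inj_on (\<alpha> i) ((\<lambda>b. b i) ` \<Phi>)" for i
    by (rule inj_on_subset[OF injB]) (auto simp: \<Phi>_eq)
  show "ereal ?H - ereal (real CARD('k) - 2) * penalty \<alpha> \<Phi> P \<le> monomial_subexponent B ?t"
  proof (cases "2 \<le> CARD('k)")
    case True
    obtain \<mu> where \<mu>: "penalty \<alpha> \<Phi> P = ereal \<mu>" "0 \<le> \<mu>"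
      "\<And>R Q. R \<in> coupling_relations \<Phi> \<Longrightarrow> Q \<in> couplings (\<lambda>i. marginal i P) R \<Longrightarrow>
        shannon_entropy Q \<le> ?H + \<mu> * relation_rank \<alpha> R"
      by (rule penalty_controls_couplings[OF fin\<Phi> supp inj]) blast
    let ?b = "?H - (real CARD('k) - 2) * \<mu>"
    have "ereal ?b \<le> monomial_subexponent B ?t"
    proof (rule ereal_le_epsilon2)
      fix \<epsilon> :: real assume \<epsilon>: "0 < \<epsilon>"
      obtain m n X where m: "0 < m" "m * (?b - \<epsilon>) \<le> real n"
        and X: "isolated_diagonal \<Phi> m X" "2 ^ n \<le> card X"
        by (rule exists_diagonal[OF fin\<Phi> supp tight inj True \<mu>(2,3) \<epsilon>])
      have "monomial_degeneration (power_basis m B) (tensor_power m ?t)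
          (power_basis n unit_basis) (tensor_power n unit_tensor)"
        by (rule unit_degeneration_of_diagonal[OF finB \<Phi>_eq X])
      then have le: "ereal (real n / real m) \<le> monomial_subexponent B ?t" using m(1) by (rule monomial_subexponent_ge)
      have "?b \<le> real n / real m + \<epsilon>" using m by (simp add: pos_le_divide_eq mult.commute flip: diff_le_eq)
      then have "ereal ?b \<le> ereal (real n / real m) + ereal \<epsilon>" by simp
      also have "\<dots> \<le> monomial_subexponent B ?t + ereal \<epsilon>" using le by (rule add_right_mono)
      finally show "ereal ?b \<le> monomial_subexponent B ?t + ereal \<epsilon>" .
    qed
    then show ?thesis by (simp add: \<mu>(1))
  next
    case False
    \<comment> \<open>With a single factor, tightness leaves only one basis vector in the support, and the bound is zero.\<close>
    have "0 < CARD('k)" by (simp add: card_gt_0_iff)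
    then have card: "CARD('k) = 1" using False by linarith
    then obtain i0 :: 'k where i0: "UNIV = {i0}" by (meson card_1_singletonE)
    have eq: "b = b'" if b: "b \<in> \<Phi>" "b' \<in> \<Phi>" for b b'
    proof -
      have "\<alpha> i0 (b i0) = \<alpha> i0 (b' i0)" using tight[OF b(1)] tight[OF b(2)] by (simp add: i0)
      then have "b i0 = b' i0" using inj_onD[OF inj[of i0]] b by blast
      moreover have "i = i0" for i using i0 by blast
      ultimately show ?thesis by (metis ext)
    qed
    obtain b where b: "b \<in> \<Phi>" using supp set_pmf_not_empty[of P] by blast
    then have "set_pmf P \<subseteq> {b}" using supp eq by blast
    then have "P = return_pmf b" by (simp add: set_pmf_subset_singleton)
    then have "?H = 0" by (simp add: shannon_entropy_def)
    moreover have "coupling_relations \<Phi> = {}"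
    proof -
      have "\<Phi> \<times> \<Phi> \<subseteq> Id_on \<Phi>" using eq by auto
      then show ?thesis unfolding coupling_relations_def by blast
    qed
    then have "penalty \<alpha> \<Phi> P = 0" by (simp add: penalty_def)
    ultimately show ?thesis using monomial_subexponent_nonneg by (simp add: zero_ereal_def[symmetric])
  qed
qed

end
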